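(* There exists at most one function $\Phi$ with $$\Phi\in C([0,T],L^2(\Theta))\cap L^2((0,T),H^1_0(\Theta)),\qquad \partial_t\Phi\in L^2((0,T),H^1_0(\Theta))\cap C([0,T],L^2(\Theta)),\qquad \partial_{tt}\Phi\in L^2((0,T),H^1_0(\Theta)^* ),$$ satisfying $\Phi(\cdot,0)=\tilde\Phi_0$, $\partial_t\Phi(\cdot,0)=\tilde\Psi_0$ and such that for all $\chi\in H^1_0(\Theta)$ and for a.a. $t\in(0,T)$ $$\langle\partial_{tt}\Phi(t),\chi\rangle+\left(\rho(t)\,\partial_t^{\mu(t)}\Phi(t),\chi\right)+\left(\beta(t)\nabla\Phi(t),\nabla\chi\right)=\left(f(\Phi(t)),\chi\right)+\left(Q(t),\chi\right).$$
   Context: Let $T>0$ and let $\Theta\subset\mathbb{R}^d$ be a bounded Lipschitz domain. $(\cdot,\cdot)$ and $\|\cdot\|$ denote the inner product and norm of $L^2(\Theta)$ (also for vector-valued functions), $H^1_0(\Theta)^*$ is the dual of $H^1_0(\Theta)$ and $\langle\cdot,\cdot\rangle$ the duality pairing between them. $\mathcal{X}:=L^\infty(\Theta\times(0,T))$. The variable-order Caputo derivative is $$\partial_t^{\mu(t)}\Phi(t):=\frac{1}{\Gamma(1-\mu(t))}\int_0^t\frac{\partial_r\Phi(r)}{(t-r)^{\mu(t)}}\,dr .$$ Standing assumptions on the data: (AS1) $\mu\in L^\infty([0,T])$ with $0\le\mu(t)\le\bar\mu<1$, where $\bar\mu:=\sup_{t\in[0,T]}\mu(t)$; (AS2) $\rho,\beta\in\mathcal{X}$;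 (AS3) $Q\in C([0,T],L^2(\Theta))$; (AS4) $f:\mathbb{R}\to\mathbb{R}$ is Lipschitz continuous: there is $L_f>0$ with $|f(z_1)-f(z_2)|\le L_f|z_1-z_2|$ for all $z_1,z_2\in\mathbb{R}$; (AS5) $\beta\ge\tilde\beta_0$ a.e. in $\Theta\times(0,T)$, for some constant $\tilde\beta_0>0$; (AS6) $\partial_t\beta\in\mathcal{X}$; (AS7) $\rho\ge0$ a.e. in $\Theta\times(0,T)$; (AS8) $\tilde\Phi_0\in H^1_0(\Theta)$ and $\tilde\Psi_0\in L^2(\Theta)$. *)

theory Defs
  imports "HOL-Analysis.Analysis" "HOL-Probability.Essential_Supremum"
begin

text \<open>Functions are kept as representatives, so elements of Lebesgue and Sobolev spaces are
  functions, equality in these spaces being equality almost everywhere.\<close>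

definition lipschitz_domain :: "'a::euclidean_space set \<Rightarrow> bool" where
  "lipschitz_domain S \<longleftrightarrow>
     open S \<and> connected S \<and> bounded S \<and> S \<noteq> {} \<and>
     (\<forall>p\<in>frontier S. \<exists>r>0. \<exists>e \<gamma> L. norm e = 1 \<and> L-lipschitz_on {z. z \<bullet> e = 0} \<gamma> \<and>
        S \<inter> ball p r = {y \<in> ball p r. y \<bullet> e > \<gamma> (y - (y \<bullet> e) *\<^sub>R e)})"

definition L2 :: "'a::euclidean_space set \<Rightarrow> ('a \<Rightarrow> 'b::euclidean_space) set" where
  "L2 S = {u \<in> borel_measurable (lebesgue_on S). integrable (lebesgue_on S) (\<lambda>x. (norm (u x))\<^sup>2)}"

definition L2_inner ::
  "'a::euclidean_space set \<Rightarrow> ('a \<Rightarrow> 'b::euclidean_space) \<Rightarrow> ('a \<Rightarrow> 'b) \<Rightarrow> real" where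
  "L2_inner S u v = (\<integral>x. u x \<bullet> v x \<partial>lebesgue_on S)"

definition L2_norm :: "'a::euclidean_space set \<Rightarrow> ('a \<Rightarrow> 'b::euclidean_space) \<Rightarrow> real" where
  "L2_norm S u = sqrt (L2_inner S u u)"

definition Linf :: "'a::euclidean_space set \<Rightarrow> ('a \<Rightarrow> real) set" where
  "Linf S = {u \<in> borel_measurable (lebesgue_on S). \<exists>C. AE x in lebesgue_on S. \<bar>u x\<bar> \<le> C}"

primrec Ck :: "nat \<Rightarrow> ('a::euclidean_space \<Rightarrow> real) \<Rightarrow> bool" where
  "Ck 0 f \<longleftrightarrow> continuous_on UNIV f"
| "Ck (Suc k) f \<longleftrightarrow> f differentiable_on UNIV \<and>
     (\<forall>i\<in>Basis. Ck k (\<lambda>x. frechet_derivative f (at x) i))"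

definition test_functions :: "'a::euclidean_space set \<Rightarrow> ('a \<Rightarrow> real) set" where
  "test_functions S = {\<phi>. (\<forall>k. Ck k \<phi>) \<and> compact (closure {x. \<phi> x \<noteq> 0}) \<and> closure {x. \<phi> x \<noteq> 0} \<subseteq> S}"

text \<open>\<open>g\<close> is the distributional derivative of \<open>u\<close> on \<open>S\<close> in direction \<open>i\<close>.
  It is only used for \<open>u\<close> and \<open>g\<close> that are locally integrable on \<open>S\<close>.\<close>
definition weak_partial ::
  "'a::euclidean_space set \<Rightarrow> 'a \<Rightarrow> ('a \<Rightarrow> real) \<Rightarrow> ('a \<Rightarrow> real) \<Rightarrow> bool" where
  "weak_partial S i u g \<longleftrightarrow> (\<forall>\<phi>\<in>test_functions S.
     (\<integral>x. u x * frechet_derivative \<phi> (at x) i \<partial>lebesgue_on S) = - (\<integral>x. g x * \<phi> x \<partial>lebesgue_on S))"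

definition weak_gradient ::
  "'a::euclidean_space set \<Rightarrow> ('a \<Rightarrow> real) \<Rightarrow> ('a \<Rightarrow> 'a) \<Rightarrow> bool" where
  "weak_gradient S u g \<longleftrightarrow> (\<forall>i\<in>Basis. weak_partial S i u (\<lambda>x. g x \<bullet> i))"

definition H1 :: "'a::euclidean_space set \<Rightarrow> ('a \<Rightarrow> real) set" where
  "H1 S = {u \<in> L2 S. \<exists>g\<in>L2 S. weak_gradient S u g}"

definition grad :: "'a::euclidean_space set \<Rightarrow> ('a \<Rightarrow> real) \<Rightarrow> 'a \<Rightarrow> 'a" where
  "grad S u = (SOME g. g \<in> L2 S \<and> weak_gradient S u g)"

definition H1_norm :: "'a::euclidean_space set \<Rightarrow> ('a \<Rightarrow> real) \<Rightarrow> real" where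
  "H1_norm S u = sqrt ((L2_norm S u)\<^sup>2 + (L2_norm S (grad S u))\<^sup>2)"

definition H10 :: "'a::euclidean_space set \<Rightarrow> ('a \<Rightarrow> real) set" where
  "H10 S = {u \<in> H1 S. \<exists>\<phi>. (\<forall>n. \<phi> n \<in> test_functions S) \<and>
     (\<lambda>n. H1_norm S (\<lambda>x. \<phi> n x - u x)) \<longlonglongrightarrow> 0}"

text \<open>A functional is a total function of which only the values on \<open>H10 S\<close> matter. Boundedness and
  linearity together make it respect almost-everywhere equality.\<close>
definition H10_dual :: "'a::euclidean_space set \<Rightarrow> (('a \<Rightarrow> real) \<Rightarrow> real) set" where
  "H10_dual S = {F.
     (\<forall>u\<in>H10 S. \<forall>v\<in>H10 S. F (\<lambda>x. u x + v x) = F u + F v) \<and>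
     (\<forall>c. \<forall>u\<in>H10 S. F (\<lambda>x. c * u x) = c * F u) \<and>
     (\<exists>C. \<forall>u\<in>H10 S. \<bar>F u\<bar> \<le> C * H1_norm S u)}"

definition H10_dual_norm :: "'a::euclidean_space set \<Rightarrow> (('a \<Rightarrow> real) \<Rightarrow> real) \<Rightarrow> real" where
  "H10_dual_norm S F = (SUP u\<in>{u \<in> H10 S. H1_norm S u \<le> 1}. \<bar>F u\<bar>)"

text \<open>The library's Bochner integral needs a Banach space that is a type, whereas the spaces here
  depend on the domain. In the following definitions the target space is a set \<open>V\<close> of real functions, closed under
  the pointwise operations, with a seminorm \<open>N\<close> on it. It is instantiated by the square-integrable
  functions, by \<open>H10\<close>, and by \<open>H10_dual\<close>, whose elements are real functions on functions.\<close>

definition strongly_measurable ::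
  "'t measure \<Rightarrow> ('x \<Rightarrow> real) set \<Rightarrow> (('x \<Rightarrow> real) \<Rightarrow> real) \<Rightarrow> ('t \<Rightarrow> 'x \<Rightarrow> real) \<Rightarrow> bool" where
  "strongly_measurable M V N u \<longleftrightarrow>
     (AE t in M. u t \<in> V) \<and>
     (\<exists>s. (\<forall>n. simple_function M (s n) \<and> s n ` space M \<subseteq> V) \<and>
          (AE t in M. (\<lambda>n. N (\<lambda>x. s n t x - u t x)) \<longlonglongrightarrow> 0))"

definition bochner_L2 ::
  "'t measure \<Rightarrow> ('x \<Rightarrow> real) set \<Rightarrow> (('x \<Rightarrow> real) \<Rightarrow> real) \<Rightarrow> ('t \<Rightarrow> 'x \<Rightarrow> real) set" where
  "bochner_L2 M V N = {u. strongly_measurable M V N u \<and> integrable M (\<lambda>t. (N (u t))\<^sup>2)}"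

definition continuous_into ::
  "'t::topological_space set \<Rightarrow> ('x \<Rightarrow> real) set \<Rightarrow> (('x \<Rightarrow> real) \<Rightarrow> real) \<Rightarrow> ('t \<Rightarrow> 'x \<Rightarrow> real) set" where
  "continuous_into A V N = {u. \<forall>t\<in>A. u t \<in> V \<and>
     ((\<lambda>r. N (\<lambda>x. u r x - u t x)) \<longlongrightarrow> 0) (at t within A)}"

text \<open>\<open>I\<close> is the limit of the integrals of simple functions converging to \<open>u\<close> in mean. A simple
  function has finitely many values, so its integral in \<open>V\<close> is the pointwise one.\<close>
definition has_bochner_integral_in ::
  "'t measure \<Rightarrow> ('x \<Rightarrow> real) set \<Rightarrow> (('x \<Rightarrow> real) \<Rightarrow> real) \<Rightarrow> ('t \<Rightarrow> 'x \<Rightarrow> real) \<Rightarrow> ('x \<Rightarrow> real) \<Rightarrow> bool"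
  where
  "has_bochner_integral_in M V N u I \<longleftrightarrow>
     strongly_measurable M V N u \<and> I \<in> V \<and>
     (\<exists>s. (\<forall>n. simple_function M (s n) \<and> s n ` space M \<subseteq> V \<and>
               emeasure M {t \<in> space M. s n t \<noteq> (\<lambda>_. 0)} \<noteq> \<infinity>) \<and>
          (\<lambda>n. \<integral>\<^sup>+t. ennreal (N (\<lambda>x. s n t x - u t x)) \<partial>M) \<longlonglongrightarrow> 0 \<and>
          (\<lambda>n. N (\<lambda>x. (\<integral>t. s n t x \<partial>M) - I x)) \<longlonglongrightarrow> 0)"

definition bochner_integral_in ::
  "'t measure \<Rightarrow> ('x \<Rightarrow> real) set \<Rightarrow> (('x \<Rightarrow> real) \<Rightarrow> real) \<Rightarrow> ('t \<Rightarrow> 'x \<Rightarrow> real) \<Rightarrow> 'x \<Rightarrow> real" where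
  "bochner_integral_in M V N u = (SOME I. has_bochner_integral_in M V N u I)"

text \<open>The \<open>V\<close>-valued distributional derivative on the interval from \<open>0\<close> to \<open>T\<close>.\<close>
definition weak_time_deriv ::
  "real \<Rightarrow> ('x \<Rightarrow> real) set \<Rightarrow> (('x \<Rightarrow> real) \<Rightarrow> real) \<Rightarrow> (real \<Rightarrow> 'x \<Rightarrow> real) \<Rightarrow> (real \<Rightarrow> 'x \<Rightarrow> real) \<Rightarrow> bool"
  where
  "weak_time_deriv T V N u v \<longleftrightarrow> (\<forall>\<phi>\<in>test_functions {0<..<T}. \<exists>I.
     has_bochner_integral_in (lebesgue_on {0<..<T}) V N (\<lambda>t x. deriv \<phi> t * u t x) I \<and>
     has_bochner_integral_in (lebesgue_on {0<..<T}) V N (\<lambda>t x. \<phi> t * v t x) (\<lambda>x. - I x))"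

text \<open>The variable-order Caputo derivative at time \<open>t\<close> of a function with time derivative \<open>v\<close>.\<close>
definition caputo ::
  "'a::euclidean_space set \<Rightarrow> (real \<Rightarrow> real) \<Rightarrow> (real \<Rightarrow> 'a \<Rightarrow> real) \<Rightarrow> real \<Rightarrow> 'a \<Rightarrow> real" where
  "caputo S \<mu> v t x = 1 / Gamma (1 - \<mu> t) *
     bochner_integral_in (lebesgue_on {0<..<t}) (L2 S) (L2_norm S)
       (\<lambda>r y. v r y / (t - r) powr \<mu> t) x"

text \<open>\<open>v\<close> and \<open>w\<close> are the first and second time derivatives of \<open>\<Phi>\<close>. The second one is the derivative of
  \<open>v\<close> as a function into \<open>H10_dual S\<close>, in which \<open>v t\<close> is the functional \<open>\<eta> \<mapsto> L2_inner S (v t) \<eta>\<close>.\<close>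
definition weak_solution ::
  "real \<Rightarrow> 'a::euclidean_space set \<Rightarrow> (real \<Rightarrow> real) \<Rightarrow> (real \<Rightarrow> 'a \<Rightarrow> real) \<Rightarrow> (real \<Rightarrow> 'a \<Rightarrow> real) \<Rightarrow>
   (real \<Rightarrow> 'a \<Rightarrow> real) \<Rightarrow> (real \<Rightarrow> real) \<Rightarrow> ('a \<Rightarrow> real) \<Rightarrow> ('a \<Rightarrow> real) \<Rightarrow> (real \<Rightarrow> 'a \<Rightarrow> real) \<Rightarrow> bool"
  where
  "weak_solution T S \<mu> \<rho> \<beta> Q f \<Phi>\<^sub>0 \<Psi>\<^sub>0 \<Phi> \<longleftrightarrow> (\<exists>v w.
     \<Phi> \<in> continuous_into {0..T} (L2 S) (L2_norm S) \<inter>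
         bochner_L2 (lebesgue_on {0<..<T}) (H10 S) (H1_norm S) \<and>
     v \<in> bochner_L2 (lebesgue_on {0<..<T}) (H10 S) (H1_norm S) \<inter>
         continuous_into {0..T} (L2 S) (L2_norm S) \<and>
     w \<in> bochner_L2 (lebesgue_on {0<..<T}) (H10_dual S) (H10_dual_norm S) \<and>
     weak_time_deriv T (L2 S) (L2_norm S) \<Phi> v \<and>
     weak_time_deriv T (H10_dual S) (H10_dual_norm S) (\<lambda>t \<eta>. L2_inner S (v t) \<eta>) w \<and>
     (AE x in lebesgue_on S. \<Phi> 0 x = \<Phi>\<^sub>0 x) \<and>
     (AE x in lebesgue_on S. v 0 x = \<Psi>\<^sub>0 x) \<and>
     (\<forall>\<eta>\<in>H10 S. AE t in lebesgue_on {0<..<T}.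
        w t \<eta> + L2_inner S (\<lambda>x. \<rho> t x * caputo S \<mu> v t x) \<eta>
          + L2_inner S (\<lambda>x. \<beta> t x *\<^sub>R grad S (\<Phi> t) x) (grad S \<eta>)
        = L2_inner S (\<lambda>x. f (\<Phi> t x)) \<eta> + L2_inner S (Q t) \<eta>))"

end

theory Submission
  imports Defs
begin

text \<open>The difference \<open>z\<close> of two solutions has zero initial data, and \<open>z t\<close> lies in \<open>H10\<close> for every \<open>t\<close>
  because it is the integral of its time derivative \<open>v\<close>. The weak equation cannot be tested with \<open>v\<close> directly
  without a chain rule for the dual pairing. Instead its integral over a window of length \<open>h\<close> is tested with the
  centred difference \<open>z (t + h) - z (t - h)\<close>, as in the leapfrog scheme, and averaged over the position of the
  window. The inertial term becomes the difference of two consecutive values of \<open>\<parallel>z (t + h) - z t\<parallel>\<^sup>2 / h\<^sup>2\<close>, and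
  the elliptic term, by symmetry, the difference of the mixed terms \<open>(\<beta> \<nabla>z (t + h), \<nabla>z t)\<close>, up to an error
  controlled by the Lipschitz continuity of \<open>\<beta>\<close> in time, so that both telescope. As \<open>h\<close> tends to \<open>0\<close> this gives
  the energy inequality for \<open>\<parallel>v t\<parallel>\<^sup>2 + \<parallel>\<nabla>z t\<parallel>\<^sup>2\<close>.

  At time \<open>t\<close> the Caputo term is at most a constant times the supremum of \<open>\<parallel>v\<parallel>\<close> on \<open>[0, t]\<close>: the
  function \<open>1 / Gamma\<close> is bounded on \<open>[0, 1]\<close>, and the integral of the kernel is bounded because the orders stay
  away from \<open>1\<close>. For a large \<open>\<lambda>\<close> the energy inequality thus improves any bound \<open>K exp (\<lambda> t)\<close> for the energy
  to \<open>K exp (\<lambda> t) / 2\<close>, and the energy vanishes.\<close>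

section \<open>Smooth functions with compact support\<close>

text \<open>Centred differences are forced by algebra: if \<open>P\<close> and \<open>R\<close> are
  consecutive increments of \<open>z\<close>, the inertial term is the inner product of
  \<open>P - R\<close> with the test function, and \<open>P + R\<close> is the choice that turns it
  into a difference of squares. The gradient is frozen at the middle of each window. The error is
  the square of an increment of \<open>A\<close>, the integral of the \<open>H1\<close> norm of the
  velocity. As \<open>A\<close> is continuous and monotone, these squares sum to at most the largest
  increment times the total variation, which vanishes with \<open>h\<close>. This is where a
  velocity in \<open>L2\<close> with values in \<open>H10\<close> enters. The mixed elliptic term
  has no sign by itself. Coercivity returns at the final time, where its two arguments differ by an
  increment of \<open>A\<close>. The equation and the Lipschitz bound for \<beta> hold only almost
  everywhere in time; integrated over windows they hold for every position of the window. The memory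
  term rules out a pointwise Gronwall argument. The increasing weight
  \<open>exp (\<lambda> t)\<close> bounds the past by its value at \<open>t\<close>, and integrating
  it in time yields the factor \<open>1 / \<lambda>\<close>, which beats all constants.\<close>

lemma Ck_SucI:
  assumes "\<And>x. (f has_derivative f' x) (at x)" "\<And>i. i \<in> Basis \<Longrightarrow> Ck k (\<lambda>x. f' x i)"
  shows "Ck (Suc k) f"
proof -
  have "frechet_derivative f (at x) = f' x" for x
    using assms(1) frechet_derivative_at by metis
  then show ?thesis
    using assms by (auto simp: differentiable_on_def intro: differentiableI)
qed

lemma Ck_SucD:
  assumes "Ck (Suc k) f"
  shows "(f has_derivative frechet_derivative f (at x)) (at x)"
    and "i \<in> Basis \<Longrightarrow> Ck k (\<lambda>x. frechet_derivative f (at x) i)"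
  using assms by (auto simp: differentiable_on_def frechet_derivative_works)

lemma Ck_Suc_imp: "Ck (Suc k) f \<Longrightarrow> Ck k f"
proof (induction k arbitrary: f)
  case 0
  then show ?case by (simp add: differentiable_imp_continuous_on)
next
  case (Suc k)
  show ?case
    by (rule Ck_SucI[OF Ck_SucD(1)[OF Suc.prems]]) (use Suc in auto)
qed

lemma Ck_const: "Ck k (\<lambda>x. c)"
proof (induction k arbitrary: c)
  case (Suc k)
  show ?case by (rule Ck_SucI[where f' = "\<lambda>_ _. 0"]) (use Suc in auto)
qed simp

lemma Ck_add: "Ck k f \<Longrightarrow> Ck k g \<Longrightarrow> Ck k (\<lambda>x. f x + g x)"
proof (induction k arbitrary: f g)
  case 0
  then show ?case by (auto intro: continuous_intros)
next
  case (Suc k)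
  show ?case
    by (rule Ck_SucI[OF has_derivative_add[OF Ck_SucD(1)[OF Suc.prems(1)] Ck_SucD(1)[OF Suc.prems(2)]]])
      (use Suc Ck_SucD(2) in blast)
qed

lemma Ck_mult: "Ck k f \<Longrightarrow> Ck k g \<Longrightarrow> Ck k (\<lambda>x. f x * g x)"
proof (induction k arbitrary: f g)
  case 0
  then show ?case by (auto intro: continuous_intros)
next
  case (Suc k)
  show ?case
    by (rule Ck_SucI[OF has_derivative_mult[OF Ck_SucD(1)[OF Suc.prems(1)] Ck_SucD(1)[OF Suc.prems(2)]]])
      (use Suc Ck_SucD(2) Ck_Suc_imp in \<open>intro Ck_add; blast\<close>)
qed

lemma Ck_prod: "(\<And>i. i \<in> I \<Longrightarrow> Ck k (f i)) \<Longrightarrow> Ck k (\<lambda>x. \<Prod>i\<in>I. f i x)"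
proof (induction I rule: infinite_finite_induct)
  case (insert i I)
  then show ?case by (auto intro: Ck_mult)
qed (auto intro: Ck_const)

lemma Ck_SucI_real:
  fixes f :: "real \<Rightarrow> real"
  assumes "\<And>x. (f has_real_derivative f' x) (at x)" "Ck k f'"
  shows "Ck (Suc k) f"
  by (rule Ck_SucI[where f' = "\<lambda>x h. f' x * h"]) (use assms in \<open>auto simp: has_field_derivative_def\<close>)

lemma Ck_SucD_real:
  fixes f :: "real \<Rightarrow> real"
  assumes "Ck (Suc k) f"
  shows "(f has_real_derivative deriv f x) (at x)" and "Ck k (deriv f)"
proof -
  have *: "(f has_real_derivative frechet_derivative f (at x) 1) (at x)" for x
  proof -
    have "bounded_linear (frechet_derivative f (at x))"
      using Ck_SucD(1)[OF assms] has_derivative_bounded_linear by blast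
    then have h: "frechet_derivative f (at x) h = frechet_derivative f (at x) 1 * h" for h
      using linear_simps(5)[of "frechet_derivative f (at x)" h 1] by simp
    show ?thesis
      unfolding has_field_derivative_def
      by (rule has_derivative_eq_rhs[OF Ck_SucD(1)[OF assms]]) (simp add: fun_eq_iff h[symmetric])
  qed
  then have d: "deriv f = (\<lambda>x. frechet_derivative f (at x) 1)"
    by (auto simp: DERIV_imp_deriv)
  show "(f has_real_derivative deriv f x) (at x)" "Ck k (deriv f)"
    using * Ck_SucD(2)[OF assms, of 1] by (auto simp: d)
qed

text \<open>Differentiation in direction \<open>j\<close> returns the same composition with
  \<open>deriv \<theta>\<close>, times a constant, so the induction is over all
  \<open>\<theta>\<close>. One-variable functions become smooth functions of a coordinate in this
  way.\<close>

lemma Ck_compose_affine: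
  fixes \<theta> :: "real \<Rightarrow> real" and i :: "'a::euclidean_space"
  assumes "Ck k \<theta>"
  shows "Ck k (\<lambda>x::'a. \<theta> (c * (x \<bullet> i) + d))"
  using assms
proof (induction k arbitrary: \<theta>)
  case 0
  then have "continuous_on UNIV \<theta>" by simp
  then show ?case
    by (auto intro!: continuous_on_compose2[of UNIV \<theta>] continuous_intros)
next
  case (Suc k)
  show ?case
  proof (rule Ck_SucI)
    fix x :: 'a
    show "((\<lambda>x. \<theta> (c * (x \<bullet> i) + d)) has_derivative (\<lambda>h. deriv \<theta> (c * (x \<bullet> i) + d) * (c * (h \<bullet> i)))) (at x)"
      using Ck_SucD_real(1)[OF Suc.prems, of "c * (x \<bullet> i) + d"]
      unfolding has_field_derivative_def
      by (intro has_derivative_compose[where g = \<theta> and f = "\<lambda>x. c * (x \<bullet> i) + d"])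
        (auto intro!: derivative_eq_intros)
  next
    fix j :: 'a
    show "Ck k (\<lambda>x. deriv \<theta> (c * (x \<bullet> i) + d) * (c * (j \<bullet> i)))"
      using Suc.IH[OF Ck_SucD_real(2)[OF Suc.prems]] Ck_const by (rule Ck_mult)
  qed
qed

text \<open>The index records what changes under differentiation. For \<open>flat\<close> it is the
  polynomial in front of the exponential.\<close>

lemma Ck_family:
  fixes F :: "'i \<Rightarrow> real \<Rightarrow> real"
  assumes "\<And>p x. (F p has_real_derivative F (D p) x) (at x)"
  shows "Ck k (F p)"
proof (induction k arbitrary: p)
  case 0
  then show ?case
    using assms by (auto intro!: continuous_at_imp_continuous_on DERIV_isCont)
next
  case (Suc k)
  show ?case by (rule Ck_SucI_real[OF assms Suc])
qed

text \<open>The parameter \<open>e\<close> lets bumps increase to the indicator of a box as \<open>e\<close> tends to \<open>0\<close>.\<close>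
definition flat :: "real \<Rightarrow> real \<Rightarrow> real" where
  "flat e x = (if x > 0 then exp (- (e / x)) else 0)"

text \<open>Read with \<open>x\<close> as the reciprocal of a variable tending to \<open>0\<close>
  from the right, this is the flatness of \<open>flat e\<close> at \<open>0\<close> to every
  order.\<close>

lemma tendsto_poly_mult_exp_neg:
  assumes "e > 0"
  shows "((\<lambda>x::real. poly p x * exp (- (e * x))) \<longlongrightarrow> 0) at_top"
proof -
  have *: "((\<lambda>x::real. x ^ n * exp (- (e * x))) \<longlongrightarrow> 0) at_top" for n
  proof -
    have "((\<lambda>x. (e * x) ^ n / exp (e * x)) \<longlongrightarrow> 0) at_top"
      by (rule filterlim_compose[OF tendsto_power_div_exp_0])
        (use assms in \<open>auto intro: filterlim_tendsto_pos_mult_at_top[OF tendsto_const _ filterlim_ident]\<close>)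
    from tendsto_mult_right[OF this, of "1 / e ^ n"] show ?thesis
      using assms by (simp add: power_mult_distrib exp_minus field_simps)
  qed
  have "((\<lambda>x. \<Sum>i\<le>degree p. coeff p i * (x ^ i * exp (- (e * x)))) \<longlongrightarrow> (\<Sum>i\<le>degree p. coeff p i * 0)) at_top"
    by (intro tendsto_sum tendsto_mult tendsto_const *)
  then show ?thesis by (simp add: poly_altdef sum_distrib_right mult.assoc)
qed

lemma Ck_flat:
  assumes e: "e > 0"
  shows "Ck k (flat e)"
proof -
  define F where "F = (\<lambda>p x. if x > 0 then poly p (1 / x) * exp (- (e / x)) else (0::real))"
  \<comment> \<open>The derivative of \<open>p (1 / x) exp (- e / x)\<close> is
    \<open>(e p (1 / x) - p' (1 / x)) / x\<^sup>2\<close> times the exponential; the factor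
    \<open>1 / x\<^sup>2\<close> is the polynomial \<open>[:0, 0, 1:]\<close>.\<close>
  define D where "D = (\<lambda>p::real poly. [:0, 0, 1:] * (smult e p - pderiv p))"
  have "(F p has_real_derivative F (D p) x) (at x)" for p x
  proof (cases x "0::real" rule: linorder_cases)
    case less
    have "((\<lambda>_. 0) has_real_derivative 0) (at x)" by simp
    then have "(F p has_real_derivative 0) (at x)"
      by (rule has_field_derivative_transform_within_open[where S = "{..<0}"]) (use less in \<open>auto simp: F_def\<close>)
    then show ?thesis using less by (simp add: F_def)
  next
    case greater
    have "((\<lambda>x. poly p (1 / x) * exp (- (e / x))) has_real_derivative F (D p) x) (at x)"
      using greater by (auto simp: F_def D_def intro!: derivative_eq_intros)
        (simp add: field_simps power2_eq_square)
    then show ?thesis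
      by (rule has_field_derivative_transform_within_open[where S = "{0<..}"]) (use greater in \<open>auto simp: F_def\<close>)
  next
    case equal
    have "((\<lambda>h. (F p (0 + h) - F p 0) / h) \<longlongrightarrow> 0) (at_right 0)"
    proof -
      \<comment> \<open>With \<open>y = 1 / h\<close> the right difference quotient at
        \<open>0\<close> is \<open>y p (y) exp (- e y)\<close>; the factor \<open>[:0, 1:]\<close>
        is the division by \<open>h\<close>.\<close>
      have "((\<lambda>x. poly ([:0, 1:] * p) x * exp (- (e * x))) \<longlongrightarrow> 0) at_top"
        by (rule tendsto_poly_mult_exp_neg[OF e])
      then have "((\<lambda>h. poly ([:0, 1:] * p) (inverse h) * exp (- (e * inverse h))) \<longlongrightarrow> 0) (at_right 0)"
        using filterlim_compose[OF _ filterlim_inverse_at_top_right] by blast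
      then show ?thesis
        by (rule Lim_transform_eventually)
          (auto simp: F_def field_simps eventually_at_filter)
    qed
    moreover have "((\<lambda>h. (F p (0 + h) - F p 0) / h) \<longlongrightarrow> 0) (at_left 0)"
      by (rule Lim_transform_eventually[OF tendsto_const]) (auto simp: F_def eventually_at_filter)
    ultimately have "((\<lambda>h. (F p (0 + h) - F p 0) / h) \<longlongrightarrow> 0) (at 0)"
      by (simp add: filterlim_split_at)
    then show ?thesis unfolding equal by (simp add: DERIV_def F_def cong: if_cong)
  qed
  then have "Ck k (F [:1:])" by (rule Ck_family)
  moreover have "F [:1:] = flat e" by (auto simp: F_def flat_def)
  ultimately show ?thesis by simp
qed

lemma flat_nonneg: "0 \<le> flat e x" and flat_le_1: "0 \<le> e \<Longrightarrow> flat e x \<le> 1"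
  by (auto simp: flat_def)

lemma tendsto_flat: "(\<lambda>n. flat (1 / Suc n) x) \<longlonglongrightarrow> indicator {0<..} x"
proof (cases "x > 0")
  case True
  have "(\<lambda>n. exp (- ((1 / x) * (1 / Suc n)))) \<longlonglongrightarrow> exp (- ((1 / x) * 0))"
    by (intro tendsto_intros LIMSEQ_Suc lim_1_over_n)
  then show ?thesis using True by (simp add: flat_def mult.commute)
qed (simp add: flat_def)

definition bump1 :: "real \<Rightarrow> real \<Rightarrow> real \<Rightarrow> real \<Rightarrow> real" where
  "bump1 e a b x = flat e (x - a) * flat e (b - x)"

lemma Ck_bump1: "e > 0 \<Longrightarrow> Ck k (bump1 e a b)"
  unfolding bump1_def
  using Ck_compose_affine[OF Ck_flat, of e k 1 "1::real" "- a"]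
    Ck_compose_affine[OF Ck_flat, of e k "-1" "1::real" b] by (intro Ck_mult) auto

lemma bump1_nonneg: "0 \<le> bump1 e a b x" and bump1_le_1: "0 \<le> e \<Longrightarrow> bump1 e a b x \<le> 1"
  by (auto simp: bump1_def flat_nonneg flat_le_1 intro: mult_le_one)

lemma bump1_pos_iff: "bump1 e a b x > 0 \<longleftrightarrow> a < x \<and> x < b"
  by (auto simp: bump1_def flat_def zero_less_mult_iff)

lemma bump1_eq_0_iff: "bump1 e a b x = 0 \<longleftrightarrow> \<not> (a < x \<and> x < b)"
  by (auto simp: bump1_def flat_def)

definition bump :: "real \<Rightarrow> 'a::euclidean_space \<Rightarrow> 'a \<Rightarrow> 'a \<Rightarrow> real" where
  "bump e a b x = (\<Prod>i\<in>Basis. bump1 e (a \<bullet> i) (b \<bullet> i) (x \<bullet> i))"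

lemma Ck_compose_inner:
  "Ck k \<theta> \<Longrightarrow> Ck k (\<lambda>x. \<theta> (x \<bullet> i))"
  using Ck_compose_affine[of k \<theta> 1 i 0] by simp

lemma Ck_bump: "e > 0 \<Longrightarrow> Ck k (bump e a b)"
  unfolding bump_def by (intro Ck_prod Ck_compose_inner Ck_bump1)

lemma bump_nonneg: "0 \<le> bump e a b x" and bump_le_1: "0 \<le> e \<Longrightarrow> bump e a b x \<le> 1"
  by (auto simp: bump_def bump1_nonneg bump1_le_1 intro!: prod_nonneg prod_le_1)

lemma bump_eq_0_iff: "bump e a b x = 0 \<longleftrightarrow> x \<notin> box a b"
  by (auto simp: bump_def bump1_eq_0_iff mem_box)

lemma tendsto_bump: "(\<lambda>n. bump (1 / Suc n) a b x) \<longlonglongrightarrow> indicator (box a b) x"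
proof -
  have "(\<lambda>n. bump (1 / Suc n) a b x) \<longlonglongrightarrow>
    (\<Prod>i\<in>Basis. indicator {0<..} (x \<bullet> i - a \<bullet> i) * indicator {0<..} (b \<bullet> i - x \<bullet> i))"
    unfolding bump_def bump1_def by (intro tendsto_prod tendsto_mult tendsto_flat)
  also have "(\<Prod>i\<in>Basis. indicator {0<..} (x \<bullet> i - a \<bullet> i) * indicator {0<..} (b \<bullet> i - x \<bullet> i)) =
      (indicator (box a b) x :: real)"
    by (auto simp: indicator_def mem_box)
  finally show ?thesis .
qed

section \<open>Test functions and integration by parts\<close>

lemma test_functionsI:
  assumes "\<And>k. Ck k \<phi>" "\<And>x. x \<notin> K \<Longrightarrow> \<phi> x = 0" "compact K" "K \<subseteq> S"
  shows "\<phi> \<in> test_functions S"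
proof -
  have "closure {x. \<phi> x \<noteq> 0} \<subseteq> K"
    using assms by (intro closure_minimal compact_imp_closed) auto
  moreover from this have "compact (closure {x. \<phi> x \<noteq> 0})"
    using assms(3) compact_Int_closed[of K "closure {x. \<phi> x \<noteq> 0}"] by (simp add: inf.absorb2)
  ultimately show ?thesis
    using assms by (auto simp: test_functions_def)
qed

text \<open>Some compact set off which the function vanishes replaces the closed support, which
  never has to be computed.\<close>

lemma test_functionsE:
  assumes "\<phi> \<in> test_functions S"
  obtains K where "\<And>k. Ck k \<phi>" "\<And>x. x \<notin> K \<Longrightarrow> \<phi> x = 0" "compact K" "K \<subseteq> S"
  by (rule that[of "closure {x. \<phi> x \<noteq> 0}"])
    (use assms closure_subset[of "{x. \<phi> x \<noteq> 0}"] in \<open>auto simp: test_functions_def\<close>)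

lemma bump_test_function: "e > 0 \<Longrightarrow> cbox a b \<subseteq> S \<Longrightarrow> bump e a b \<in> test_functions S"
  by (rule test_functionsI[where K = "cbox a b"])
    (use box_subset_cbox[of a b] in \<open>auto simp: Ck_bump bump_eq_0_iff\<close>)

lemma test_functions_add:
  assumes "\<phi> \<in> test_functions S" "\<psi> \<in> test_functions S"
  shows "(\<lambda>x. \<phi> x + \<psi> x) \<in> test_functions S"
proof -
  from assms obtain K L where "\<And>k. Ck k \<phi>" "\<And>x. x \<notin> K \<Longrightarrow> \<phi> x = 0" "compact K" "K \<subseteq> S"
    "\<And>k. Ck k \<psi>" "\<And>x. x \<notin> L \<Longrightarrow> \<psi> x = 0" "compact L" "L \<subseteq> S"
    by (metis test_functionsE)
  then show ?thesis
    by (intro test_functionsI[where K = "K \<union> L"]) (auto intro: Ck_add)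
qed

lemma test_functions_scale:
  assumes "\<phi> \<in> test_functions S"
  shows "(\<lambda>x. c * \<phi> x) \<in> test_functions S"
  using assms by (elim test_functionsE, intro test_functionsI) (auto intro: Ck_mult Ck_const)

lemma test_function_continuous: "\<phi> \<in> test_functions S \<Longrightarrow> continuous_on UNIV \<phi>"
  by (auto simp: test_functions_def dest: spec[of _ 0])

lemma test_function_has_derivative:
  "\<phi> \<in> test_functions S \<Longrightarrow> (\<phi> has_derivative frechet_derivative \<phi> (at x)) (at x)"
  using Ck_SucD(1)[of 0 \<phi> x] by (auto simp: test_functions_def simp del: Ck.simps(2))

lemma test_function_derivative_continuous:
  "\<phi> \<in> test_functions S \<Longrightarrow> i \<in> Basis \<Longrightarrow> continuous_on UNIV (\<lambda>x. frechet_derivative \<phi> (at x) i)"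
  using Ck_SucD(2)[of 0 \<phi> i] by (auto simp: test_functions_def simp del: Ck.simps(2))

lemma bounded_compact_support:
  fixes f :: "'a::euclidean_space \<Rightarrow> real"
  assumes "continuous_on UNIV f" "compact K" "\<And>x. x \<notin> K \<Longrightarrow> f x = 0"
  obtains B where "B > 0" "\<And>x. \<bar>f x\<bar> \<le> B"
proof -
  have "bounded (f ` K)"
    using assms by (intro compact_imp_bounded compact_continuous_image) (auto intro: continuous_on_subset)
  then obtain B where "B > 0" "\<forall>x\<in>K. \<bar>f x\<bar> \<le> B"
    by (auto simp: bounded_pos)
  then show ?thesis using assms(3) that[of B] by (metis abs_zero less_imp_le)
qed

text \<open>The complement of \<open>K\<close> is open and the function vanishes on it, so one
  compact set serves for the function and its first derivatives.\<close>

lemma test_function_derivative_support: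
  assumes "\<phi> \<in> test_functions S"
  obtains K where "compact K" "K \<subseteq> S" "\<And>x. x \<notin> K \<Longrightarrow> \<phi> x = 0"
    "\<And>x i. x \<notin> K \<Longrightarrow> frechet_derivative \<phi> (at x) i = 0"
proof -
  obtain K where K: "\<And>x. x \<notin> K \<Longrightarrow> \<phi> x = 0" "compact K" "K \<subseteq> S"
    using assms by (metis test_functionsE)
  have "frechet_derivative \<phi> (at x) i = 0" if "x \<notin> K" for x i
  proof -
    have "(\<phi> has_derivative (\<lambda>_. 0)) (at x)"
      by (rule has_derivative_transform_within_open[of "\<lambda>_. 0" "\<lambda>_. 0" x UNIV "- K"])
        (use that K compact_imp_closed in auto)
    then show ?thesis using frechet_derivative_at by metis
  qed
  then show ?thesis using that K by blast
qed

lemma test_function_bounded: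
  assumes "\<phi> \<in> test_functions S"
  obtains B where "B > 0" "\<And>x. \<bar>\<phi> x\<bar> \<le> B"
  using assms by (metis bounded_compact_support test_functionsE test_function_continuous)

lemma test_function_derivative_bounded:
  assumes "\<phi> \<in> test_functions S" "i \<in> Basis"
  obtains B where "B > 0" "\<And>x. \<bar>frechet_derivative \<phi> (at x) i\<bar> \<le> B"
  using assms by (metis (no_types, lifting) bounded_compact_support test_function_derivative_support
      test_function_derivative_continuous)

lemma test_function_mult:
  assumes "\<phi> \<in> test_functions S" "\<psi> \<in> test_functions S"
  shows "(\<lambda>x. \<phi> x * \<psi> x) \<in> test_functions S"
  using assms(1)
proof (rule test_functionsE)
  fix K assume "\<And>k. Ck k \<phi>" "\<And>x. x \<notin> K \<Longrightarrow> \<phi> x = 0" "compact K" "K \<subseteq> S"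
  moreover have "\<And>k. Ck k \<psi>" using assms(2) by (elim test_functionsE)
  ultimately show ?thesis by (intro test_functionsI[where K = K]) (auto intro: Ck_mult)
qed

lemma test_function_line_derivative:
  assumes "\<phi> \<in> test_functions S"
  shows "((\<lambda>s. \<phi> (s *\<^sub>R i + x)) has_real_derivative frechet_derivative \<phi> (at (s *\<^sub>R i + x)) i) (at s)"
proof -
  let ?D = "frechet_derivative \<phi> (at (s *\<^sub>R i + x))"
  have D: "(\<phi> has_derivative ?D) (at (s *\<^sub>R i + x))"
    by (rule test_function_has_derivative[OF assms])
  have "((\<lambda>s. \<phi> (s *\<^sub>R i + x)) has_derivative (\<lambda>h. ?D (h *\<^sub>R i))) (at s)"
    by (rule has_derivative_compose[of "\<lambda>s. s *\<^sub>R i + x" _ _ _ \<phi>, OF _ D]) (auto intro!: derivative_eq_intros)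
  moreover have "?D (h *\<^sub>R i) = ?D i * h" for h
    using has_derivative_linear[OF D] by (simp add: linear_scale)
  ultimately show ?thesis by (simp add: has_field_derivative_def fun_eq_iff)
qed

text \<open>By translation invariance every difference quotient has integral zero, and dominated
  convergence passes this on to the derivative.\<close>

lemma integral_test_function_derivative:
  fixes \<phi> :: "'a::euclidean_space \<Rightarrow> real"
  assumes \<phi>: "\<phi> \<in> test_functions UNIV" and i: "i \<in> Basis"
  shows "(\<integral>x. frechet_derivative \<phi> (at x) i \<partial>lborel) = 0"
proof -
  obtain K where K: "compact K" "\<And>x. x \<notin> K \<Longrightarrow> \<phi> x = 0"
    using \<phi> by (metis test_functionsE)
  obtain B where B: "B > 0" "\<And>x. \<bar>frechet_derivative \<phi> (at x) i\<bar> \<le> B"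
    using test_function_derivative_bounded[OF \<phi> i] by metis
  obtain r where r: "K \<subseteq> cball 0 r" using compact_imp_bounded[OF K(1)] unfolding bounded_iff by (auto simp: subset_iff)
  have cont: "continuous_on UNIV \<phi>" using \<phi> by (rule test_function_continuous)
  then have [measurable]: "\<phi> \<in> borel_measurable borel" by (rule borel_measurable_continuous_onI)
  have [measurable]: "(\<lambda>x. frechet_derivative \<phi> (at x) i) \<in> borel_measurable borel"
    by (rule borel_measurable_continuous_onI[OF test_function_derivative_continuous[OF \<phi> i]])
  define h where "h = (\<lambda>n::nat. 1 / Suc n :: real)"
  have h: "h n > 0" "h n \<le> 1" for n by (auto simp: h_def)
  have int: "integrable lborel \<phi>"
  proof -
    have "integrable lborel (\<lambda>x. indicator K x *\<^sub>R \<phi> x)"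
      by (rule borel_integrable_compact[OF K(1)]) (rule continuous_on_subset[OF cont], simp)
    moreover have "(\<lambda>x. indicator K x *\<^sub>R \<phi> x) = \<phi>"
      by (rule ext) (use K(2) in \<open>auto simp: indicator_def\<close>)
    ultimately show ?thesis by simp
  qed
  define q where "q = (\<lambda>n x. (\<phi> (h n *\<^sub>R i + x) - \<phi> x) / h n)"
  have "(\<lambda>n. \<integral>x. q n x \<partial>lborel) \<longlonglongrightarrow> (\<integral>x. frechet_derivative \<phi> (at x) i \<partial>lborel)"
  \<comment> \<open>The shifts have length at most \<open>1\<close>, so the quotients vanish off the
    ball of radius \<open>r + 1\<close>; on it the mean value theorem bounds them by
    \<open>B\<close>.\<close>
  proof (rule integral_dominated_convergence[where w = "\<lambda>x. B * indicator (cball 0 (r + 1)) x"])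
    show "integrable lborel (\<lambda>x::'a. B * indicator (cball 0 (r + 1)) x)"
      by (intro integrable_mult_right integrable_real_indicator) (use emeasure_lborel_cball_finite[of "0::'a" "r + 1"] in \<open>auto simp: infinity_ennreal_def\<close>)
    show "AE x in lborel. (\<lambda>n. q n x) \<longlonglongrightarrow> frechet_derivative \<phi> (at x) i"
    proof (rule AE_I2)
      fix x
      have "((\<lambda>s. \<phi> (s *\<^sub>R i + x)) has_real_derivative frechet_derivative \<phi> (at x) i) (at 0)"
        using test_function_line_derivative[OF \<phi>, of i x 0] by simp
      then have *: "((\<lambda>s. (\<phi> (s *\<^sub>R i + x) - \<phi> x) / s) \<longlongrightarrow> frechet_derivative \<phi> (at x) i) (at 0)"
        by (simp add: DERIV_def)
      have "filterlim h (at 0) sequentially"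
        unfolding filterlim_at using h LIMSEQ_Suc[OF lim_1_over_n[where 'a = real]] by (auto simp: h_def)
      from filterlim_compose[OF * this] show "(\<lambda>n. q n x) \<longlonglongrightarrow> frechet_derivative \<phi> (at x) i"
        by (simp add: q_def)
    qed
    show "AE x in lborel. norm (q n x) \<le> B * indicator (cball 0 (r + 1)) x" for n
    proof (rule AE_I2)
      fix x
      show "norm (q n x) \<le> B * indicator (cball 0 (r + 1)) x"
      proof (cases "x \<in> cball 0 (r + 1)")
        case False
        have "norm x \<le> norm (h n *\<^sub>R i + x) + norm (h n *\<^sub>R i)"
          by (metis add_diff_cancel_left' norm_triangle_ineq4 add.commute)
        then have "h n *\<^sub>R i + x \<notin> K" "x \<notin> K"
          using False r h[of n] i by auto
        then show ?thesis using B(1) by (simp add: q_def K)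
      next
        case True
        have "\<exists>z. 0 < z \<and> z < h n \<and> \<phi> (h n *\<^sub>R i + x) - \<phi> (0 *\<^sub>R i + x) =
          (h n - 0) * frechet_derivative \<phi> (at (z *\<^sub>R i + x)) i"
          by (rule MVT2[OF h(1)]) (rule test_function_line_derivative[OF \<phi>])
        then obtain z where "q n x = frechet_derivative \<phi> (at (z *\<^sub>R i + x)) i"
          using h[of n] by (auto simp: q_def)
        then show ?thesis using True B by simp
      qed
    qed
  qed (auto simp: q_def)
  moreover have "(\<integral>x. q n x \<partial>lborel) = 0" for n
  proof -
    have "integrable lborel (\<lambda>x. \<phi> (h n *\<^sub>R i + x))" "(\<integral>x. \<phi> (h n *\<^sub>R i + x) \<partial>lborel) = (\<integral>x. \<phi> x \<partial>lborel)"
      using int integrable_distr_eq[of "(+) (h n *\<^sub>R i)" lborel borel \<phi>]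
        integral_distr[of "(+) (h n *\<^sub>R i)" lborel borel \<phi>]
      unfolding lborel_distr_plus by simp_all
    then show ?thesis using int h[of n]
      by (simp add: q_def)
  qed
  ultimately show ?thesis by (simp add: LIMSEQ_const_iff)
qed

text \<open>The product of the two test functions has a derivative with integral zero. All
  integrands live on a compact subset of \<open>S\<close>, so integrals over \<open>S\<close> and
  over the whole space coincide.\<close>

lemma weak_partial_test_function:
  assumes S: "S \<in> sets lebesgue" and \<phi>: "\<phi> \<in> test_functions S" and i: "i \<in> Basis"
  shows "weak_partial S i \<phi> (\<lambda>x. frechet_derivative \<phi> (at x) i)"
  unfolding weak_partial_def
proof
  fix \<psi> assume \<psi>: "\<psi> \<in> test_functions S"
  let ?f = "\<lambda>x. \<phi> x * frechet_derivative \<psi> (at x) i" and ?g = "\<lambda>x. frechet_derivative \<phi> (at x) i * \<psi> x"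
  obtain K where K: "compact K" "K \<subseteq> S" "\<And>x. x \<notin> K \<Longrightarrow> \<phi> x = 0"
    "\<And>x. x \<notin> K \<Longrightarrow> frechet_derivative \<phi> (at x) i = 0"
    using test_function_derivative_support[OF \<phi>] by metis
  have cont: "continuous_on UNIV ?f" "continuous_on UNIV ?g"
    by (intro continuous_intros test_function_continuous[OF \<phi>] test_function_continuous[OF \<psi>]
        test_function_derivative_continuous[OF \<phi> i] test_function_derivative_continuous[OF \<psi> i])+
  have int: "integrable lborel f" if "continuous_on UNIV f" "\<And>x. x \<notin> K \<Longrightarrow> f x = 0" for f :: "'a \<Rightarrow> real"
  proof -
    have "integrable lborel (\<lambda>x. indicator K x *\<^sub>R f x)"
      by (rule borel_integrable_compact[OF K(1)]) (rule continuous_on_subset[OF that(1)], simp)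
    moreover have "(\<lambda>x. indicator K x *\<^sub>R f x) = f"
      by (rule ext) (use that(2) in \<open>auto simp: indicator_def\<close>)
    ultimately show ?thesis by simp
  qed
  have onS: "(\<integral>x. f x \<partial>lebesgue_on S) = (\<integral>x. f x \<partial>lborel)"
    if "continuous_on UNIV f" "\<And>x. x \<notin> K \<Longrightarrow> f x = 0" for f :: "'a \<Rightarrow> real"
  proof -
    have "(\<integral>x. f x \<partial>lebesgue_on S) = (\<integral>x. (if x \<in> S then f x else 0) \<partial>lebesgue)"
      using S by (simp add: Lebesgue_Measure.integral_restrict_UNIV)
    also have "(\<lambda>x. if x \<in> S then f x else 0) = f" using that(2) K(2) by (intro ext) auto
    finally show ?thesis
      using borel_measurable_continuous_onI[OF that(1)] by (simp add: integral_completion)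
  qed
  have prod: "frechet_derivative (\<lambda>x. \<phi> x * \<psi> x) (at x) i = ?f x + ?g x" for x
    using frechet_derivative_at[OF has_derivative_mult[OF test_function_has_derivative[OF \<phi>]
          test_function_has_derivative[OF \<psi>]], of x] by metis
  have "(\<lambda>x. \<phi> x * \<psi> x) \<in> test_functions UNIV"
    using test_function_mult[OF \<phi> \<psi>] by (auto simp: test_functions_def)
  from integral_test_function_derivative[OF this i] have "(\<integral>x. ?f x + ?g x \<partial>lborel) = 0"
    by (simp only: prod)
  then show "(\<integral>x. ?f x \<partial>lebesgue_on S) = - (\<integral>x. ?g x \<partial>lebesgue_on S)"
    using int cont K by (subst (1 2) onS) auto
qed

section \<open>Fundamental lemma of the calculus of variations\<close>

text \<open>Bumps with parameter \<open>1 / Suc n\<close> converge boundedly to the indicator of the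
  box, with \<open>\<bar>g\<bar>\<close> as dominating function.\<close>

lemma integral_box_nonneg:
  fixes g :: "'a::euclidean_space \<Rightarrow> real"
  assumes U: "U \<in> sets lebesgue" and g: "integrable (lebesgue_on U) g"
    and nn: "\<And>e. e > 0 \<Longrightarrow> 0 \<le> (\<integral>x. g x * bump e a b x \<partial>lebesgue_on U)"
  shows "0 \<le> (\<integral>x. g x * indicator (box a b) x \<partial>lebesgue_on U)"
proof -
  have meas: "bump e a b \<in> borel_measurable borel" if "e > 0" for e
    using Ck_bump[of e 0, OF that] by (auto intro: borel_measurable_continuous_onI)
  have "(\<lambda>n. \<integral>x. g x * bump (1 / Suc n) a b x \<partial>lebesgue_on U) \<longlonglongrightarrow> (\<integral>x. g x * indicator (box a b) x \<partial>lebesgue_on U)"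
  proof (rule integral_dominated_convergence[where w = "\<lambda>x. \<bar>g x\<bar>"])
    show "AE x in lebesgue_on U. (\<lambda>n. g x * bump (1 / Suc n) a b x) \<longlonglongrightarrow> g x * indicator (box a b) x"
      by (intro AE_I2 tendsto_intros tendsto_bump)
    show "AE x in lebesgue_on U. norm (g x * bump (1 / real (Suc n)) a b x) \<le> \<bar>g x\<bar>" for n
      using bump_le_1[of "1 / real (Suc n)" a b] bump_nonneg[of "1 / real (Suc n)" a b]
      by (intro AE_I2) (auto simp: abs_mult intro!: mult_left_le)
    show "(\<lambda>x. g x * bump (1 / Suc n) a b x) \<in> borel_measurable (lebesgue_on U)" for n
      using meas[of "1 / Suc n"]
      by (intro borel_measurable_times borel_measurable_integrable[OF g]
          measurable_restrict_space1[of "bump (1 / Suc n) a b"] measurable_completion) auto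
    show "(\<lambda>x. g x * indicator (box a b) x) \<in> borel_measurable (lebesgue_on U)"
      by (intro borel_measurable_times borel_measurable_integrable[OF g]
          measurable_restrict_space1[of "indicator (box a b)"] measurable_completion) auto
  qed (use g in auto)
  then show ?thesis
    by (rule LIMSEQ_le_const) (use nn in auto)
qed

text \<open>A negative value of \<open>g\<close> at a Lebesgue point would make the mean over small
  cubes negative. The one-sided form serves two purposes: applied to both signs it yields uniqueness
  of weak gradients, and it also turns integral inequalities into pointwise ones.\<close>

lemma AE_nonneg_if_bump_integrals_nonneg:
  fixes g :: "'a::euclidean_space \<Rightarrow> real"
  assumes U: "open U" and g: "integrable (lebesgue_on U) g"
    and nn: "\<And>e a b. e > 0 \<Longrightarrow> cbox a b \<subseteq> U \<Longrightarrow> 0 \<le> (\<integral>x. g x * bump e a b x \<partial>lebesgue_on U)"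
  shows "AE x in lebesgue_on U. 0 \<le> g x"
proof -
  have Ul: "U \<in> sets lebesgue" using U by simp
  define f where "f = (\<lambda>x. if x \<in> U then g x else 0)"
  have f: "integrable lebesgue f"
    unfolding f_def using g Lebesgue_Measure.integrable_restrict_UNIV[OF Ul] by blast
  have "f integrable_on cbox a b" for a b
    using integrable_on_lebesgue[OF f] by (rule integrable_on_subcbox) simp
  \<comment> \<open>Lebesgue differentiation along cubes that have \<open>x\<close> as their lower
    corner.\<close>
  then obtain N where N: "negligible N" "\<And>x e. x \<notin> N \<Longrightarrow> 0 < e \<Longrightarrow>
    \<exists>d>0. \<forall>h. 0 < h \<and> h < d \<longrightarrow> norm (integral (cbox x (x + h *\<^sub>R One)) f /\<^sub>R h ^ DIM('a) - f x) < e"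
    using integrable_ccontinuous_explicit by blast
  have box: "0 \<le> integral (cbox a b) f" if "cbox a b \<subseteq> U" for a b
  proof -
    have "(\<integral>x. g x * indicator (box a b) x \<partial>lebesgue_on U) = (\<integral>x. (if x \<in> box a b then f x else 0) \<partial>lebesgue)"
      unfolding Lebesgue_Measure.integral_restrict_UNIV[OF Ul, symmetric]
      by (intro Bochner_Integration.integral_cong) (auto simp: f_def indicator_def)
    also have "\<dots> = integral (box a b) f"
      unfolding Lebesgue_Measure.integral_restrict_UNIV[OF lmeasurable_box[THEN fmeasurableD]]
      by (rule lebesgue_integral_eq_integral)
        (use integrable_mult_indicator[OF _ f, of "box a b"] in
          \<open>auto simp: integrable_restrict_space\<close>)
    finally show ?thesis
      using integral_box_nonneg[OF Ul g nn[OF _ that]] by (simp add: integral_open_interval)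
  qed
  have "0 \<le> g x" if x: "x \<in> U" "x \<notin> N" for x
  proof (rule ccontr)
    assume "\<not> 0 \<le> g x"
    then obtain d where d: "d > 0" "\<And>h. 0 < h \<Longrightarrow> h < d \<Longrightarrow>
        norm (integral (cbox x (x + h *\<^sub>R One)) f /\<^sub>R h ^ DIM('a) - f x) < - g x"
      using N(2)[OF x(2), of "- g x"] by auto
    obtain r where r: "r > 0" "ball x r \<subseteq> U" using U x openE by blast
    \<comment> \<open>A cube of side \<open>h\<close> has points at distance up to
      \<open>DIM('a) * h\<close> in the \<open>l1\<close> norm, which dominates the Euclidean one;
      hence the division by the dimension to stay in the ball of radius \<open>r\<close>.\<close>
    define h where "h = min (d / 2) (r / (2 * DIM('a)))"
    have h: "0 < h" "h < d" "h * DIM('a) < r"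
    proof -
      show "0 < h" "h < d" using d r by (auto simp: h_def)
      have "h * DIM('a) \<le> r / (2 * DIM('a)) * DIM('a)"
        by (intro mult_right_mono) (auto simp: h_def)
      also have "\<dots> < r" using r by simp
      finally show "h * DIM('a) < r" .
    qed
    have "cbox x (x + h *\<^sub>R One) \<subseteq> U"
    proof
      fix y assume y: "y \<in> cbox x (x + h *\<^sub>R One)"
      have "norm (y - x) \<le> (\<Sum>i\<in>Basis. \<bar>(y - x) \<bullet> i\<bar>)" by (rule norm_le_l1)
      also have "\<dots> \<le> (\<Sum>i\<in>(Basis::'a set). h)"
        using y by (intro sum_mono) (auto simp: mem_box algebra_simps inner_diff_left)
      also have "\<dots> < r" using h by (simp add: mult.commute)
      finally show "y \<in> U" using r by (auto simp: dist_norm norm_minus_commute)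
    qed
    then have "0 \<le> integral (cbox x (x + h *\<^sub>R One)) f /\<^sub>R h ^ DIM('a)"
      using box h by simp
    then show False using d(2)[OF h(1,2)] x by (simp add: f_def)
  qed
  moreover have "N \<inter> U \<in> null_sets (lebesgue_on U)"
    using N(1) Ul null_set_Int1[of N lebesgue U] by (auto simp: Int_commute simp: null_sets_restrict_space negligible_iff_null_sets)
  ultimately show ?thesis
    by (intro AE_I'[of "N \<inter> U"]) auto
qed

section \<open>Primitives of bumps and the du Bois-Reymond lemma\<close>

definition bump_prim :: "real \<Rightarrow> real \<Rightarrow> real \<Rightarrow> real \<Rightarrow> real" where
  "bump_prim e a b x = integral {a - 1..x} (bump1 e a b)"

lemma continuous_on_bump1: "e > 0 \<Longrightarrow> continuous_on A (bump1 e a b)"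
  using Ck_bump1[of e 0 a b] by (auto intro: continuous_on_subset)

lemma bump_prim_eq_0: "x \<le> a \<Longrightarrow> bump_prim e a b x = 0"
  unfolding bump_prim_def
  by (subst integral_cong[where g = "\<lambda>_. 0"]) (auto simp: bump1_eq_0_iff)

lemma has_real_derivative_bump_prim:
  assumes e: "e > 0"
  shows "(bump_prim e a b has_real_derivative bump1 e a b x) (at x)"
proof (cases "x < a")
  case True
  have "((\<lambda>_. 0) has_real_derivative 0) (at x)" by simp
  then have "(bump_prim e a b has_real_derivative 0) (at x)"
    by (rule has_field_derivative_transform_within_open[where S = "{..<a}"]) (use True bump_prim_eq_0 in auto)
  then show ?thesis using True by (metis bump1_eq_0_iff not_less_iff_gr_or_eq)
next
  case False
  \<comment> \<open>With \<open>a - 1\<close> as lower limit, the point \<open>a\<close> and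
    everything to its right are interior to the interval of integration, so the derivative obtained
    is two-sided.\<close>
  have "((\<lambda>u. integral {a - 1..u} (bump1 e a b)) has_real_derivative bump1 e a b x) (at x within {a - 1..x + 1})"
    by (rule integral_has_real_derivative) (use False e continuous_on_bump1 in auto)
  then have "((\<lambda>u. integral {a - 1..u} (bump1 e a b)) has_real_derivative bump1 e a b x) (at x)"
    using False by (subst (asm) at_within_interior) auto
  then show ?thesis by (simp add: bump_prim_def[abs_def])
qed

lemma Ck_bump_prim: "e > 0 \<Longrightarrow> Ck k (bump_prim e a b)"
  by (rule Ck_Suc_imp, rule Ck_SucI_real[OF has_real_derivative_bump_prim Ck_bump1])

lemma bump_prim_diff:
  assumes "e > 0" "x \<le> y"
  shows "bump_prim e a b y - bump_prim e a b x = integral {x..y} (bump1 e a b)"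
  using fundamental_theorem_of_calculus[OF assms(2), of "bump_prim e a b" "bump1 e a b"]
    has_real_derivative_bump_prim[OF assms(1)]
  by (auto simp: has_real_derivative_iff_has_vector_derivative[symmetric] has_field_derivative_at_within
      intro!: integral_unique[symmetric])

lemma bump_prim_mono: "e > 0 \<Longrightarrow> x \<le> y \<Longrightarrow> bump_prim e a b x \<le> bump_prim e a b y"
  using bump_prim_diff[of e x y a b] integral_nonneg[of "bump1 e a b" "{x..y}"]
    integrable_continuous_interval[OF continuous_on_bump1, of e a b x y]
  by (auto simp: bump1_nonneg)

lemma bump_prim_const:
  assumes "e > 0" "b \<le> x"
  shows "bump_prim e a b x = bump_prim e a b b"
proof -
  have "integral {b..x} (bump1 e a b) = integral {b..x} (\<lambda>_. 0)"
    by (rule integral_cong) (auto simp: bump1_eq_0_iff)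
  then show ?thesis using bump_prim_diff[OF assms, of a b] by simp
qed

lemma bump_prim_nonneg: "e > 0 \<Longrightarrow> 0 \<le> bump_prim e a b x"
  using bump_prim_mono[of e "min x a" x a b] bump_prim_eq_0[of "min x a" a e b] by simp

lemma bump_prim_le: "e > 0 \<Longrightarrow> bump_prim e a b x \<le> bump_prim e a b b"
  by (metis bump_prim_const bump_prim_mono linorder_le_cases)

text \<open>This number is the mass of the bump, by which it is normalised below.\<close>

lemma bump_prim_pos:
  assumes e: "e > 0" and "a < b"
  shows "0 < bump_prim e a b b"
proof (rule ccontr)
  assume "\<not> 0 < bump_prim e a b b"
  then have "bump_prim e a b = (\<lambda>_. 0)"
    using bump_prim_nonneg[OF e, of a b] bump_prim_le[OF e, of a b] by (intro ext) (metis order.trans order.antisym not_less)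
  then have "(bump_prim e a b has_real_derivative 0) (at ((a + b) / 2))" by simp
  moreover have "bump1 e a b ((a + b) / 2) > 0"
    using assms by (auto simp: bump1_pos_iff field_simps)
  ultimately show False
    using has_real_derivative_bump_prim[OF e, of a b "(a + b) / 2"] DERIV_unique by fastforce
qed

text \<open>A dictionary between the Lebesgue integral over open intervals, in which the weak
  formulation is stated, and the gauge integral over closed ones, in which integrals are combined
  and shifted. The end points form a null set.\<close>

lemma integral_lebesgue_on_subinterval:
  fixes h :: "real \<Rightarrow> real"
  assumes h: "integrable (lebesgue_on {0<..<T}) h" and st: "0 \<le> s" "t \<le> T"
  shows "integrable (lebesgue_on {s<..<t}) h" "h absolutely_integrable_on {s..t}"
    "(\<integral>x. h x \<partial>lebesgue_on {s<..<t}) = integral {s..t} h"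
    "(\<integral>x. h x * indicator {s<..<t} x \<partial>lebesgue_on {0<..<T}) = integral {s..t} h"
proof -
  have i: "set_integrable lebesgue {s<..<t} h"
    by (rule set_integrable_subset[of lebesgue "{0<..<T}"])
      (use h st in \<open>auto simp: integrable_restrict_space set_integrable_def\<close>)
  then show "integrable (lebesgue_on {s<..<t}) h"
    by (simp add: integrable_restrict_space set_integrable_def)
  show "h absolutely_integrable_on {s..t}"
    using i by (rule absolutely_integrable_spike_set)
      (auto intro: negligible_subset[of "{s, t}"])
  show 1: "(\<integral>x. h x \<partial>lebesgue_on {s<..<t}) = integral {s..t} h"
    using lebesgue_integral_eq_integral[of "{s<..<t}" h] i
    by (simp add: integrable_restrict_space set_integrable_def integral_open_interval_real)
  have "(\<integral>x. h x * indicator {s<..<t} x \<partial>lebesgue_on {0<..<T}) = (\<integral>x. h x \<partial>lebesgue_on {s<..<t})"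
    using st by (auto simp: integral_restrict_space indicator_def intro!: Bochner_Integration.integral_cong)
  then show "(\<integral>x. h x * indicator {s<..<t} x \<partial>lebesgue_on {0<..<T}) = integral {s..t} h"
    using 1 by simp
qed

lemma integrable_lebesgue_on_open_interval:
  fixes h :: "real \<Rightarrow> real"
  assumes "continuous_on {0..T} h"
  shows "integrable (lebesgue_on {0<..<T}) h"
proof -
  have "h absolutely_integrable_on {0..T}"
    using absolutely_integrable_continuous_real assms by blast
  then have "h absolutely_integrable_on {0<..<T}"
    by (rule set_integrable_subset) auto
  then show ?thesis
    by (simp add: integrable_restrict_space set_integrable_def)
qed

text \<open>The quotient of the bump by its mass is a probability density carried by the interval
  from \<open>a\<close> to \<open>b\<close>.\<close>

lemma bump_average:
  fixes g :: "real \<Rightarrow> real"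
  assumes g: "continuous_on {0..T} g" and ab: "0 < a" "a < b" "b < T"
    and c: "\<And>x. a \<le> x \<Longrightarrow> x \<le> b \<Longrightarrow> \<bar>g x - c\<bar> \<le> \<epsilon>"
  shows "\<bar>(\<integral>x. bump1 1 a b x / bump_prim 1 a b b * g x \<partial>lebesgue_on {0<..<T}) - c\<bar> \<le> \<epsilon>"
proof -
  let ?m = "bump_prim 1 a b b" and ?M = "lebesgue_on {0<..<T}"
  define w where "w = (\<lambda>x. bump1 1 a b x / ?m)"
  have m: "?m > 0" using ab by (intro bump_prim_pos) auto
  have i: "integrable ?M (\<lambda>x. w x * k x)" if "continuous_on {0..T} k" for k
    unfolding w_def using m that
    by (intro integrable_lebesgue_on_open_interval continuous_intros continuous_on_bump1) auto
  have one: "(\<integral>x. w x \<partial>?M) = 1"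
  proof -
    have "(\<integral>x. bump1 1 a b x \<partial>?M) = integral {0..T} (bump1 1 a b)"
      by (rule integral_lebesgue_on_subinterval(3)[OF integrable_lebesgue_on_open_interval[OF continuous_on_bump1]]) auto
    also have "\<dots> = bump_prim 1 a b T - bump_prim 1 a b 0"
      using ab by (subst bump_prim_diff) auto
    also have "\<dots> = ?m" using ab bump_prim_const[of 1 b T a] bump_prim_eq_0[of 0 a 1 b] by simp
    finally show ?thesis using m by (simp add: w_def)
  qed
  have "(\<integral>x. w x * g x \<partial>?M) - c = (\<integral>x. w x * g x - w x * c \<partial>?M)"
    using i[OF g] i[of "\<lambda>_. 1"] one by simp
  also have "\<bar>\<dots>\<bar> \<le> (\<integral>x. w x * \<epsilon> \<partial>?M)"
  proof (rule integral_abs_bound[THEN order_trans], rule integral_mono)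
    show "integrable ?M (\<lambda>x. \<bar>w x * g x - w x * c\<bar>)"
      using g unfolding right_diff_distrib[symmetric] by (intro integrable_abs i continuous_intros)
    show "\<bar>w x * g x - w x * c\<bar> \<le> w x * \<epsilon>" for x
    proof (cases "a < x \<and> x < b")
      case True
      have "0 \<le> w x" using m bump1_nonneg[of 1 a b x] by (simp add: w_def)
      then show ?thesis using c[of x] True
        by (simp add: right_diff_distrib[symmetric] abs_mult mult_left_mono)
    qed (simp add: w_def bump1_eq_0_iff[THEN iffD2])
  qed (use i[of "\<lambda>_. \<epsilon>"] in simp)
  also have "\<dots> = \<epsilon>" using one by simp
  finally show ?thesis by (simp add: w_def)
qed

text \<open>Testing with a smoothed indicator of the interval from \<open>s\<close> to
  \<open>t\<close> turns the left side into averages of \<open>g\<close> near \<open>s\<close> and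
  \<open>t\<close> and the right side into nearly the integral of \<open>h\<close>. Continuity of
  \<open>g\<close> then covers the ends \<open>0\<close> and \<open>T\<close>.\<close>

lemma du_Bois_Reymond:
  fixes g h :: "real \<Rightarrow> real"
  assumes g: "continuous_on {0..T} g" and h: "integrable (lebesgue_on {0<..<T}) h"
    and eq: "\<And>\<phi>. \<phi> \<in> test_functions {0<..<T} \<Longrightarrow>
      (\<integral>x. deriv \<phi> x * g x \<partial>lebesgue_on {0<..<T}) = - (\<integral>x. \<phi> x * h x \<partial>lebesgue_on {0<..<T})"
    and st: "0 \<le> s" "s \<le> t" "t \<le> T"
  shows "g t - g s = integral {s..t} h"
proof -
  let ?M = "lebesgue_on {0<..<T}"
  have inner: "g t - g s = integral {s..t} h" if st: "0 < s" "s < t" "t < T" for s t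
  proof -
    \<comment> \<open>Half the distance to the nearer end of the time interval, shrunk to zero,
      keeps the smoothed indicator supported inside.\<close>
    define \<delta> where "\<delta> = (\<lambda>n::nat. (min s (T - t) / 2) * (1 / Suc n))"
    have \<delta>: "0 < \<delta> n" "\<delta> n < s" "\<delta> n < T - t" for n
    proof -
      show "0 < \<delta> n" using st by (simp add: \<delta>_def)
      have "\<delta> n \<le> min s (T - t) / 2" unfolding \<delta>_def using st by (intro mult_left_le) auto
      then show "\<delta> n < s" "\<delta> n < T - t" using st by auto
    qed
    have \<delta>0: "\<delta> \<longlonglongrightarrow> 0"
      unfolding \<delta>_def by (rule tendsto_mult_right_zero[OF LIMSEQ_Suc[OF lim_1_over_n]])
    \<comment> \<open>\<open>J p n\<close> is a mollifier concentrated at \<open>p\<close>, and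
      \<open>H p n\<close> is its primitive, a smoothed Heaviside function.\<close>
    define J where "J = (\<lambda>p n x. bump1 1 (p - \<delta> n) (p + \<delta> n) x / bump_prim 1 (p - \<delta> n) (p + \<delta> n) (p + \<delta> n))"
    define H where "H = (\<lambda>p n x. bump_prim 1 (p - \<delta> n) (p + \<delta> n) x / bump_prim 1 (p - \<delta> n) (p + \<delta> n) (p + \<delta> n))"
    have pos: "bump_prim 1 (p - \<delta> n) (p + \<delta> n) (p + \<delta> n) > 0" for p n
      using \<delta> by (intro bump_prim_pos) auto
    have H: "H p n x = 0" if "x \<le> p - \<delta> n" for p n x using that by (simp add: H_def bump_prim_eq_0)
    have H': "H p n x = 1" if "x \<ge> p + \<delta> n" for p n x
      using that pos[of p n] bump_prim_const[of 1 "p + \<delta> n" x "p - \<delta> n"] by (simp add: H_def)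
    have H01: "0 \<le> H p n x" "H p n x \<le> 1" for p n x
      using pos[of p n] bump_prim_nonneg[of 1] bump_prim_le[of 1] by (auto simp: H_def)
    have dH: "(H p n has_real_derivative J p n x) (at x)" for p n x
      unfolding H_def J_def by (rule DERIV_cdivide[OF has_real_derivative_bump_prim]) simp
    define \<phi> where "\<phi> = (\<lambda>n x. H s n x + - 1 * H t n x)"
    have test: "\<phi> n \<in> test_functions {0<..<T}" for n
    proof (rule test_functionsI[where K = "{s - \<delta> n..t + \<delta> n}"])
      have "Ck k (H p n)" for p k
        unfolding H_def divide_inverse by (intro Ck_mult Ck_bump_prim Ck_const) auto
      then show "Ck k (\<phi> n)" for k unfolding \<phi>_def by (intro Ck_add Ck_mult Ck_const)
      show "\<phi> n x = 0" if "x \<notin> {s - \<delta> n..t + \<delta> n}" for x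
        using that H[of x s n] H'[of s n x] H[of x t n] H'[of t n x] st by (auto simp: \<phi>_def)
    qed (use \<delta>[of n] st in auto)
    have deriv: "deriv (\<phi> n) x = J s n x - J t n x" for n x
      unfolding \<phi>_def using DERIV_diff[OF dH dH] by (auto intro: DERIV_imp_deriv)
    have lim1: "(\<lambda>n. \<integral>x. J p n x * g x \<partial>?M) \<longlonglongrightarrow> g p" if p: "p = s \<or> p = t" for p
    proof (rule LIMSEQ_I)
      fix r :: real assume r: "r > 0"
      have p': "0 < p" "p < T" using p st by auto
      then have "isCont g p" using g continuous_on_interior[of "{0..T}" g p] by auto
      then obtain d where d: "d > 0" "\<And>x. \<bar>x - p\<bar> < d \<Longrightarrow> \<bar>g x - g p\<bar> < r / 2"
        using r unfolding continuous_at_eps_delta dist_real_def by (metis half_gt_zero)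
      obtain N where N: "\<And>n. n \<ge> N \<Longrightarrow> \<delta> n < d"
        using order_tendstoD(2)[OF \<delta>0 d(1)] by (auto simp: eventually_sequentially)
      have "norm ((\<integral>x. J p n x * g x \<partial>?M) - g p) < r" if "n \<ge> N" for n
      proof -
        have "\<bar>(\<integral>x. J p n x * g x \<partial>?M) - g p\<bar> \<le> r / 2"
          unfolding J_def
          by (rule bump_average[OF g]) (use p \<delta>[of n] N[OF that] st d(2) in \<open>auto intro!: less_imp_le d(2)\<close>)
        then show ?thesis using r by simp
      qed
      then show "\<exists>N. \<forall>n\<ge>N. norm ((\<integral>x. J p n x * g x \<partial>?M) - g p) < r" by blast
    qed
    \<comment> \<open>At every point other than \<open>s\<close> and \<open>t\<close> the smoothed
      indicator is eventually equal to the exact one, and it is bounded by \<open>1\<close>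
      throughout.\<close>
    have lim2: "(\<lambda>n. \<integral>x. \<phi> n x * h x \<partial>?M) \<longlonglongrightarrow> (\<integral>x. h x * indicator {s<..<t} x \<partial>?M)"
    proof (rule integral_dominated_convergence[where w = "\<lambda>x. \<bar>h x\<bar>"])
      have "AE x in ?M. x \<noteq> s \<and> x \<noteq> t"
        using AE_not_in[of "{s, t}" lebesgue] by (auto simp: AE_restrict_space_iff)
      then show "AE x in ?M. (\<lambda>n. \<phi> n x * h x) \<longlonglongrightarrow> h x * indicator {s<..<t} x"
      proof eventually_elim
        case (elim x)
        define d where "d = min \<bar>x - s\<bar> \<bar>x - t\<bar>"
        have "d > 0" using elim by (auto simp: d_def)
        from order_tendstoD(2)[OF \<delta>0 this] have "\<forall>\<^sub>F n in sequentially. \<phi> n x * h x = h x * indicator {s<..<t} x"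
        proof eventually_elim
          case (elim n)
          then show ?case
            using st H[of x s n] H'[of s n x] H[of x t n] H'[of t n x]
            by (auto simp: d_def \<phi>_def indicator_def)
        qed
        then show ?case by (rule tendsto_eventually)
      qed
      have "\<phi> n \<in> borel_measurable ?M" for n
        using borel_measurable_continuous_onI[OF test_function_continuous[OF test]]
        by (intro measurable_restrict_space1 measurable_completion) auto
      then show "(\<lambda>x. \<phi> n x * h x) \<in> borel_measurable ?M" for n
        by (intro borel_measurable_times borel_measurable_integrable[OF h])
      show "(\<lambda>x. h x * indicator {s<..<t} x) \<in> borel_measurable ?M"
        by (intro borel_measurable_times borel_measurable_integrable[OF h]
          measurable_restrict_space1[of "indicator {s<..<t}"] measurable_completion) auto
      show "AE x in ?M. norm (\<phi> n x * h x) \<le> \<bar>h x\<bar>" for n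
      proof (intro AE_I2)
        fix x
        have "\<bar>\<phi> n x\<bar> \<le> 1" using H01[of s n x] H01[of t n x] by (auto simp: \<phi>_def abs_le_iff)
        then show "norm (\<phi> n x * h x) \<le> \<bar>h x\<bar>" by (simp add: abs_mult mult_left_le_one_le)
      qed
    qed (use h in auto)
    have i: "integrable ?M (\<lambda>x. J p n x * g x)" for p n
      unfolding J_def using pos[of p n] g
      by (intro integrable_lebesgue_on_open_interval continuous_intros continuous_on_bump1) auto
    have "(\<integral>x. J s n x * g x \<partial>?M) - (\<integral>x. J t n x * g x \<partial>?M) = - (\<integral>x. \<phi> n x * h x \<partial>?M)" for n
      using eq[OF test[of n]] i[of s n] i[of t n] by (simp add: deriv left_diff_distrib)
    then have "g s - g t = - (\<integral>x. h x * indicator {s<..<t} x \<partial>?M)"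
      using LIMSEQ_unique[OF tendsto_diff[OF lim1[of s] lim1[of t]]] tendsto_minus[OF lim2] by simp
    also have "\<dots> = - integral {s..t} h"
      using integral_lebesgue_on_subinterval(4)[OF h, of s t] st by simp
    finally show ?thesis by simp
  qed
  \<comment> \<open>The claim says that \<open>D\<close> is constant. The interior case shows it on
    the open interval, and continuity extends it to the closed one.\<close>
  define D where "D = (\<lambda>t. g t - integral {0..t} h)"
  have hi: "h integrable_on {a..b}" if "0 \<le> a" "b \<le> T" for a b
    using integral_lebesgue_on_subinterval(2)[OF h that] set_lebesgue_integral_eq_integral(1) by blast
  have comb: "integral {0..s} h + integral {s..t} h = integral {0..t} h" if "0 \<le> s" "s \<le> t" "t \<le> T" for s t
    using that by (intro Henstock_Kurzweil_Integration.integral_combine hi) auto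
  have "D t = D s"
  proof (cases "T > 0")
    case True
    have cont: "continuous_on {0..T} D"
      unfolding D_def using g hi[of 0 T] by (intro continuous_intros indefinite_integral_continuous_1) auto
    have const: "D x = D (T / 2)" if "x \<in> {0<..<T}" for x
      using inner[of x "T / 2"] inner[of "T / 2" x] comb[of x "T / 2"] comb[of "T / 2" x] that
      by (cases x "T / 2" rule: linorder_cases) (auto simp: D_def)
    have "D x = D (T / 2)" if "x \<in> {0..T}" for x
    proof (rule continuous_constant_on_closure[of "{0<..<T}" D "D (T / 2)" x])
      show "continuous_on (closure {0<..<T}) D" using cont True by simp
      show "x \<in> closure {0<..<T}" using that True by simp
    qed (rule const)
    from this[of s] this[of t] show ?thesis using st by auto
  next
    case False
    then have "t = s" using st by linarith
    then show ?thesis by simp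
  qed
  then show ?thesis using comb[OF st] by (simp add: D_def)
qed

text \<open>This rests on the completeness of Lebesgue measure. It makes membership in
  \<open>L2\<close> independent of the representative.\<close>

lemma borel_measurable_lebesgue_on_AE:
  fixes f g :: "'a::euclidean_space \<Rightarrow> 'b::euclidean_space"
  assumes S: "S \<in> sets lebesgue" and f: "f \<in> borel_measurable (lebesgue_on S)"
    and ae: "AE x in lebesgue_on S. f x = g x"
  shows "g \<in> borel_measurable (lebesgue_on S)"
proof -
  have "(\<lambda>x. if x \<in> S then f x else 0) \<in> borel_measurable lebesgue"
    using f S by (simp add: borel_measurable_if_I)
  moreover have "AE x in lebesgue. (if x \<in> S then f x else 0) = (if x \<in> S then g x else 0)"
    using ae S by (auto simp: AE_restrict_space_iff elim: eventually_mono)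
  ultimately have "(\<lambda>x. if x \<in> S then g x else 0) \<in> borel_measurable lebesgue"
    by (rule borel_measurable_AE)
  then show ?thesis by (rule borel_measurable_if_D)
qed

section \<open>Square-integrable functions\<close>

lemma discriminant_le:
  fixes A B C :: real
  assumes nn: "\<And>t. 0 \<le> A + 2 * t * B + t\<^sup>2 * C" and C: "0 \<le> C"
  shows "B\<^sup>2 \<le> A * C"
proof (cases "C = 0")
  case True
  have "B = 0"
  proof (rule ccontr)
    assume "B \<noteq> 0"
    \<comment> \<open>This argument makes the linear expression \<open>A + 2 t B\<close> equal to
      \<open>-1\<close>.\<close>
    then show False using nn[of "- (A + 1) / (2 * B)"] True by (simp add: field_simps)
  qed
  then show ?thesis using True by simp
next
  case False
  then have "0 \<le> (A + 2 * (- B / C) * B + (- B / C)\<^sup>2 * C) * C"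
    using nn[of "- B / C"] C by (intro mult_nonneg_nonneg) auto
  also have "\<dots> = A * C - B\<^sup>2"
    using False by (simp add: field_simps power2_eq_square)
  finally show ?thesis by simp
qed

locale bounded_open =
  fixes S :: "'a::euclidean_space set"
  assumes open_S: "open S" and bounded_S: "bounded S"
begin

abbreviation "M \<equiv> lebesgue_on S"

lemma S_lebesgue [simp]: "S \<in> sets lebesgue"
  using open_S by simp

lemma S_lmeasurable: "S \<in> lmeasurable"
  using bounded_set_imp_lmeasurable[OF bounded_S] by simp

sublocale fin: finite_measure "lebesgue_on S"
  by (rule finite_measure_lebesgue_on[OF S_lmeasurable])

lemma L2_measurable [dest]: "u \<in> L2 S \<Longrightarrow> u \<in> borel_measurable M"
  and L2_square_integrable: "u \<in> L2 S \<Longrightarrow> integrable M (\<lambda>x. (norm (u x))\<^sup>2)"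
  by (auto simp: L2_def)

lemma L2_bound:
  fixes u :: "'a \<Rightarrow> 'b::euclidean_space"
  assumes "u \<in> borel_measurable M" "integrable M w" "AE x in M. (norm (u x))\<^sup>2 \<le> w x"
  shows "u \<in> L2 S"
proof -
  have "integrable M (\<lambda>x. (norm (u x))\<^sup>2)"
    by (rule Bochner_Integration.integrable_bound[OF assms(2)])
      (use assms in \<open>auto elim!: eventually_mono\<close>)
  then show ?thesis using assms by (simp add: L2_def)
qed

lemma L2_zero [simp]: "(\<lambda>_. 0) \<in> L2 S"
  by (simp add: L2_def)

lemma L2_scaleR: "u \<in> L2 S \<Longrightarrow> (\<lambda>x. c *\<^sub>R u x) \<in> L2 S"
  by (auto simp: L2_def power_mult_distrib)

lemma L2_scale: "u \<in> L2 S \<Longrightarrow> (\<lambda>x. c * u x :: real) \<in> L2 S"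
  using L2_scaleR[of u c] by simp

lemma L2_add: "u \<in> L2 S \<Longrightarrow> v \<in> L2 S \<Longrightarrow> (\<lambda>x. u x + v x) \<in> L2 S"
proof (rule L2_bound[where w = "\<lambda>x. 2 * (norm (u x))\<^sup>2 + 2 * (norm (v x))\<^sup>2"])
  have "(norm (u x + v x))\<^sup>2 \<le> 2 * (norm (u x))\<^sup>2 + 2 * (norm (v x))\<^sup>2" for x
    by (rule order_trans[OF power_mono[OF norm_triangle_ineq norm_ge_zero]])
      (use sum_squares_bound[of "norm (u x)" "norm (v x)"] in \<open>simp add: power2_sum\<close>)
  then show "AE x in M. (norm (u x + v x))\<^sup>2 \<le> 2 * (norm (u x))\<^sup>2 + 2 * (norm (v x))\<^sup>2" by simp
qed (auto simp: L2_square_integrable intro: borel_measurable_add L2_measurable)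

lemma L2_diff: "u \<in> L2 S \<Longrightarrow> v \<in> L2 S \<Longrightarrow> (\<lambda>x. u x - v x) \<in> L2 S"
  using L2_add[of u "\<lambda>x. -1 *\<^sub>R v x"] L2_scaleR[of v "-1"] by simp

lemma L2_inner_integrable:
  assumes "u \<in> L2 S" "v \<in> L2 S"
  shows "integrable M (\<lambda>x. u x \<bullet> v x)"
proof (rule Bochner_Integration.integrable_bound[where f = "\<lambda>x. (norm (u x))\<^sup>2 + (norm (v x))\<^sup>2"])
  have "\<bar>u x \<bullet> v x\<bar> \<le> (norm (u x))\<^sup>2 + (norm (v x))\<^sup>2" for x
    using Cauchy_Schwarz_ineq2[of "u x" "v x"] sum_squares_bound[of "norm (u x)" "norm (v x)"]
      zero_le_power2[of "norm (u x)"] zero_le_power2[of "norm (v x)"] by linarith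
  then show "AE x in M. norm (u x \<bullet> v x) \<le> norm ((norm (u x))\<^sup>2 + (norm (v x))\<^sup>2)" by simp
qed (use assms in \<open>auto simp: L2_square_integrable intro: borel_measurable_inner L2_measurable\<close>)

lemma L2_inner_commute: "L2_inner S u v = L2_inner S v u"
  by (simp add: L2_inner_def inner_commute)

lemma L2_inner_add_left:
  "u \<in> L2 S \<Longrightarrow> v \<in> L2 S \<Longrightarrow> w \<in> L2 S \<Longrightarrow>
    L2_inner S (\<lambda>x. u x + v x) w = L2_inner S u w + L2_inner S v w"
  by (simp add: L2_inner_def inner_add_left L2_inner_integrable)

lemma L2_inner_diff_left:
  "u \<in> L2 S \<Longrightarrow> v \<in> L2 S \<Longrightarrow> w \<in> L2 S \<Longrightarrow>
    L2_inner S (\<lambda>x. u x - v x) w = L2_inner S u w - L2_inner S v w"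
  by (simp add: L2_inner_def inner_diff_left L2_inner_integrable)

lemma L2_inner_scaleR_left: "L2_inner S (\<lambda>x. c *\<^sub>R u x) w = c * L2_inner S u w"
  by (simp add: L2_inner_def)

lemma L2_inner_scale_left: "L2_inner S (\<lambda>x. c * u x :: real) w = c * L2_inner S u w"
  using L2_inner_scaleR_left[of c u w] by simp

lemma L2_inner_add_right:
  "u \<in> L2 S \<Longrightarrow> v \<in> L2 S \<Longrightarrow> w \<in> L2 S \<Longrightarrow>
    L2_inner S w (\<lambda>x. u x + v x) = L2_inner S w u + L2_inner S w v"
  by (simp add: L2_inner_commute[of w] L2_inner_add_left)

lemma L2_inner_diff_right:
  "u \<in> L2 S \<Longrightarrow> v \<in> L2 S \<Longrightarrow> w \<in> L2 S \<Longrightarrow>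
    L2_inner S w (\<lambda>x. u x - v x) = L2_inner S w u - L2_inner S w v"
  by (simp add: L2_inner_commute[of w] L2_inner_diff_left)

lemma L2_inner_nonneg: "0 \<le> L2_inner S u u"
  by (simp add: L2_inner_def)

lemma L2_norm_nonneg [simp]: "0 \<le> L2_norm S u"
  by (simp add: L2_norm_def L2_inner_nonneg)

lemma L2_norm_square: "(L2_norm S u)\<^sup>2 = L2_inner S u u"
  by (simp add: L2_norm_def L2_inner_nonneg)

lemma L2_norm_square_integral: "(L2_norm S u)\<^sup>2 = (\<integral>x. (norm (u x))\<^sup>2 \<partial>M)"
  by (simp add: L2_norm_square L2_inner_def power2_norm_eq_inner)

lemma L2_Cauchy_Schwarz:
  assumes "u \<in> L2 S" "v \<in> L2 S"
  shows "\<bar>L2_inner S u v\<bar> \<le> L2_norm S u * L2_norm S v"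
proof -
  have "(L2_inner S u v)\<^sup>2 \<le> L2_inner S u u * L2_inner S v v"
  proof (rule discriminant_le)
    fix t :: real
    have "0 \<le> L2_inner S (\<lambda>x. u x + t *\<^sub>R v x) (\<lambda>x. u x + t *\<^sub>R v x)" by (rule L2_inner_nonneg)
    also have "\<dots> = L2_inner S u u + 2 * t * L2_inner S u v + t\<^sup>2 * L2_inner S v v"
      using assms L2_scaleR[OF assms(2), of t] L2_add[OF assms(1) L2_scaleR[OF assms(2), of t]]
      by (simp add: L2_inner_add_left L2_inner_add_right L2_inner_scaleR_left
          L2_inner_commute[of _ "\<lambda>x. t *\<^sub>R v x"] L2_inner_commute[of v u] power2_eq_square algebra_simps)
    finally show "0 \<le> L2_inner S u u + 2 * t * L2_inner S u v + t\<^sup>2 * L2_inner S v v" .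
  qed (rule L2_inner_nonneg)
  then have "\<bar>L2_inner S u v\<bar>\<^sup>2 \<le> (L2_norm S u * L2_norm S v)\<^sup>2"
    by (simp add: power_mult_distrib L2_norm_square)
  then show ?thesis by (rule power2_le_imp_le) simp
qed

lemma L2_norm_scaleR: "L2_norm S (\<lambda>x. c *\<^sub>R u x) = \<bar>c\<bar> * L2_norm S u"
  by (simp add: L2_norm_def L2_inner_scaleR_left L2_inner_commute[of _ "\<lambda>x. c *\<^sub>R u x"] real_sqrt_mult
      flip: mult.assoc)

lemma L2_norm_scale: "L2_norm S (\<lambda>x. c * u x :: real) = \<bar>c\<bar> * L2_norm S u"
  using L2_norm_scaleR[of c u] by simp

lemma L2_norm_zero [simp]: "L2_norm S (\<lambda>_. 0) = 0"
  by (simp add: L2_norm_def L2_inner_def)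

lemma L2_norm_triangle:
  assumes "u \<in> L2 S" "v \<in> L2 S"
  shows "L2_norm S (\<lambda>x. u x + v x) \<le> L2_norm S u + L2_norm S v"
proof -
  have "(L2_norm S (\<lambda>x. u x + v x))\<^sup>2 = (L2_norm S u)\<^sup>2 + 2 * L2_inner S u v + (L2_norm S v)\<^sup>2"
    using assms L2_add[OF assms]
    by (simp add: L2_norm_square L2_inner_add_left L2_inner_add_right L2_inner_commute[of v u])
  also have "\<dots> \<le> (L2_norm S u + L2_norm S v)\<^sup>2"
    using L2_Cauchy_Schwarz[OF assms] by (simp add: power2_sum)
  finally show ?thesis by (rule power2_le_imp_le) simp
qed

lemma L2_norm_triangle_diff:
  assumes "u \<in> L2 S" "v \<in> L2 S"
  shows "L2_norm S (\<lambda>x. u x - v x) \<le> L2_norm S u + L2_norm S v"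
  using L2_norm_triangle[OF assms(1) L2_scaleR[OF assms(2), of "-1"]] L2_norm_scaleR[of "-1" v] by simp

lemma L2_norm_minus_commute: "L2_norm S (\<lambda>x. u x - v x) = L2_norm S (\<lambda>x. v x - u x)"
  using L2_norm_scaleR[of "-1" "\<lambda>x. v x - u x"] by simp

lemma L2_norm_diff_ineq:
  assumes "u \<in> L2 S" "v \<in> L2 S"
  shows "\<bar>L2_norm S u - L2_norm S v\<bar> \<le> L2_norm S (\<lambda>x. u x - v x)"
  using L2_norm_triangle[OF L2_diff[OF assms] assms(2)]
    L2_norm_triangle[OF L2_diff[OF assms(2,1)] assms(1)]
  by (simp add: L2_norm_minus_commute[of v u])

lemma L2_inner_cong_AE:
  assumes S: "u \<in> borel_measurable M" "v \<in> borel_measurable M"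
    "u' \<in> borel_measurable M" "v' \<in> borel_measurable M"
    and "AE x in M. u x = u' x" "AE x in M. v x = v' x"
  shows "L2_inner S u v = L2_inner S u' v'"
  unfolding L2_inner_def using assms by (intro integral_cong_AE) auto

lemma L2_AE_cong:
  assumes u: "u \<in> L2 S" and ae: "AE x in M. u x = v x"
  shows "v \<in> L2 S"
  by (rule L2_bound[OF borel_measurable_lebesgue_on_AE[OF _ _ ae] L2_square_integrable[OF u]])
    (use u ae in auto)

lemma L2_inner_AE_left:
  assumes u: "u \<in> L2 S" and ae: "AE x in M. u x = v x" and "w \<in> L2 S"
  shows "L2_inner S v w = L2_inner S u w"
  using assms L2_AE_cong[OF u ae] by (intro L2_inner_cong_AE) (auto elim: eventually_mono)

lemma L2_norm_AE:
  assumes u: "u \<in> L2 S" and ae: "AE x in M. u x = v x"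
  shows "L2_norm S v = L2_norm S u"
  unfolding L2_norm_def using assms L2_AE_cong[OF u ae]
  by (auto intro!: arg_cong[where f = sqrt] L2_inner_cong_AE elim: eventually_mono)

lemma L2_norm_eq_0_iff:
  assumes u: "u \<in> L2 S"
  shows "L2_norm S u = 0 \<longleftrightarrow> (AE x in M. u x = 0)"
proof -
  have "L2_norm S u = 0 \<longleftrightarrow> (\<integral>x. (norm (u x))\<^sup>2 \<partial>M) = 0"
    by (simp add: L2_norm_def L2_inner_def power2_norm_eq_inner)
  also have "\<dots> \<longleftrightarrow> (AE x in M. (norm (u x))\<^sup>2 = 0)"
    by (rule integral_nonneg_eq_0_iff_AE[OF L2_square_integrable[OF u]]) simp
  finally show ?thesis by simp
qed

lemma L2_bounded_mult:
  fixes u :: "'a \<Rightarrow> 'b::euclidean_space"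
  assumes b: "b \<in> borel_measurable M" "AE x in M. \<bar>b x\<bar> \<le> C" and u: "u \<in> L2 S"
  shows "(\<lambda>x. b x *\<^sub>R u x) \<in> L2 S" and "0 \<le> C \<Longrightarrow> L2_norm S (\<lambda>x. b x *\<^sub>R u x) \<le> C * L2_norm S u"
proof -
  have *: "AE x in M. (norm (b x *\<^sub>R u x))\<^sup>2 \<le> C\<^sup>2 * (norm (u x))\<^sup>2"
    using b(2)
  proof eventually_elim
    case (elim x)
    then have "\<bar>b x\<bar>\<^sup>2 \<le> C\<^sup>2" by (intro power_mono) auto
    then show ?case by (auto simp: power_mult_distrib intro!: mult_right_mono)
  qed
  show bu: "(\<lambda>x. b x *\<^sub>R u x) \<in> L2 S"
    by (rule L2_bound[OF _ _ *]) (use b u L2_square_integrable[OF u] in auto)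
  assume "0 \<le> C"
  have "(\<integral>x. (norm (b x *\<^sub>R u x))\<^sup>2 \<partial>M) \<le> (\<integral>x. C\<^sup>2 * (norm (u x))\<^sup>2 \<partial>M)"
    by (rule integral_mono_AE[OF L2_square_integrable[OF bu] integrable_mult_right[OF L2_square_integrable[OF u]] *])
  also have "\<dots> = (C * L2_norm S u)\<^sup>2"
    unfolding power_mult_distrib L2_norm_square_integral by (rule integral_mult_right_zero)
  finally have "(L2_norm S (\<lambda>x. b x *\<^sub>R u x))\<^sup>2 \<le> (C * L2_norm S u)\<^sup>2"
    by (simp only: L2_norm_square_integral)
  then show "L2_norm S (\<lambda>x. b x *\<^sub>R u x) \<le> C * L2_norm S u"
    by (rule power2_le_imp_le) (use \<open>0 \<le> C\<close> in simp)
qed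

lemma bounded_imp_L2:
  fixes b :: "'a \<Rightarrow> real"
  assumes "b \<in> borel_measurable M" "\<And>x. \<bar>b x\<bar> \<le> C"
  shows "b \<in> L2 S"
proof -
  have "(\<lambda>_. 1::real) \<in> L2 S" by (simp add: L2_def)
  then show ?thesis using L2_bounded_mult(1)[of b C "\<lambda>_. 1::real"] assms by simp
qed

text \<open>Cauchy-Schwarz against the constant \<open>1\<close>, which is square-integrable because
  \<open>S\<close> has finite measure.\<close>

lemma L2_imp_integrable:
  fixes u :: "'a \<Rightarrow> 'b::euclidean_space"
  assumes u: "u \<in> L2 S"
  shows "integrable M u" and "(\<integral>x. norm (u x) \<partial>M) \<le> sqrt (measure M S) * L2_norm S u"
proof -
  have 1: "(\<lambda>_. 1::real) \<in> L2 S" by (simp add: L2_def)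
  have n: "(\<lambda>x. norm (u x)) \<in> L2 S"
    using u by (auto simp: L2_def intro: borel_measurable_norm)
  show "integrable M u"
    using L2_inner_integrable[OF n 1] u by (auto intro: integrable_norm_cancel[of M u, OF _ L2_measurable])
  have "L2_norm S (\<lambda>_. 1::real) = sqrt (measure M S)" "L2_norm S (\<lambda>x. norm (u x)) = L2_norm S u"
    by (simp_all add: L2_norm_def L2_inner_def dot_square_norm power2_eq_square)
  then show "(\<integral>x. norm (u x) \<partial>M) \<le> sqrt (measure M S) * L2_norm S u"
    using L2_Cauchy_Schwarz[OF n 1] by (simp add: L2_inner_def mult.commute)
qed

text \<open>The Riesz-Fischer argument: a subsequence with geometrically small increments converges
  almost everywhere, and Fatou's lemma turns its pointwise limit into a limit in mean
  square.\<close>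

lemma L2_complete:
  fixes f :: "nat \<Rightarrow> 'a \<Rightarrow> 'b::euclidean_space"
  assumes f: "\<And>n. f n \<in> L2 S"
    and Cauchy: "\<And>e. e > 0 \<Longrightarrow> \<exists>N. \<forall>m\<ge>N. \<forall>n\<ge>N. L2_norm S (\<lambda>x. f m x - f n x) < e"
  obtains g where "g \<in> L2 S" "(\<lambda>n. L2_norm S (\<lambda>x. f n x - g x)) \<longlonglongrightarrow> 0"
proof -
  have "\<forall>i::nat. \<exists>N. \<forall>m\<ge>N. \<forall>n\<ge>N. L2_norm S (\<lambda>x. f m x - f n x) < (1/2) ^ i"
    using Cauchy by simp
  then obtain N where N: "\<And>i m n. N i \<le> m \<Longrightarrow> N i \<le> n \<Longrightarrow> L2_norm S (\<lambda>x. f m x - f n x) < (1/2) ^ i"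
    by metis
  \<comment> \<open>The running maximum makes the indices weakly increasing while each stays above
    its threshold \<open>N i\<close>.\<close>
  define k where "k = rec_nat (N 0) (\<lambda>i r. max r (N (Suc i)))"
  have k_mono: "k i \<le> k (Suc i)" and kN: "N i \<le> k i" for i
    by (cases i; simp add: k_def)+
  have mono_k: "incseq k" using k_mono by (rule incseq_SucI)
  define d where "d = (\<lambda>i x. norm (f (k (Suc i)) x - f (k i) x))"
  have d2: "(\<lambda>x. f (k (Suc i)) x - f (k i) x) \<in> L2 S" for i by (intro L2_diff f)
  have dint: "integrable M (d i)" for i
    unfolding d_def by (intro integrable_norm L2_imp_integrable(1) d2)
  have dle: "(\<integral>x. d i x \<partial>M) \<le> sqrt (measure M S) * (1/2) ^ i" for i
  proof -
    have "L2_norm S (\<lambda>x. f (k (Suc i)) x - f (k i) x) \<le> (1/2) ^ i"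
      using N[OF order_trans[OF kN k_mono] kN] by (intro less_imp_le)
    then show ?thesis
      using L2_imp_integrable(2)[OF d2[of i]] unfolding d_def
      by (meson mult_left_mono order_trans real_sqrt_ge_zero measure_nonneg)
  qed
  \<comment> \<open>The increments are summed in \<open>L1\<close>, where their norms are dominated
    by a geometric series; finiteness of the integral of the sum gives summability at almost every
    point.\<close>
  have "AE x in M. summable (\<lambda>i. d i x)"
  proof -
    have "(\<integral>\<^sup>+x. (\<Sum>i. ennreal (d i x)) \<partial>M) = (\<Sum>i. \<integral>\<^sup>+x. ennreal (d i x) \<partial>M)"
      using dint by (intro nn_integral_suminf) auto
    also have "\<dots> \<le> (\<Sum>i. ennreal (sqrt (measure M S) * (1/2) ^ i))"
      by (intro suminf_le) (use dle dint in \<open>auto simp: nn_integral_eq_integral d_def ennreal_leI\<close>)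
    also have "\<dots> < \<infinity>"
      by (subst suminf_ennreal2) (auto intro!: summable_mult summable_geometric simp: less_top)
    finally have "(\<integral>\<^sup>+x. (\<Sum>i. ennreal (d i x)) \<partial>M) \<noteq> \<infinity>" by simp
    then have "AE x in M. (\<Sum>i. ennreal (d i x)) \<noteq> \<infinity>"
      using dint by (intro nn_integral_noteq_infinite borel_measurable_suminf_order) auto
    then show ?thesis
      by eventually_elim (auto intro!: summable_suminf_not_top simp: d_def)
  qed
  then have conv: "AE x in M. convergent (\<lambda>i. f (k i) x)"
  proof eventually_elim
    case (elim x)
    have "summable (\<lambda>i. f (k (Suc i)) x - f (k i) x)"
      by (rule summable_norm_cancel) (use elim in \<open>simp add: d_def\<close>)
    then have "convergent (\<lambda>n. \<Sum>i<n. f (k (Suc i)) x - f (k i) x)"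
      by (simp add: summable_iff_convergent)
    then have "convergent (\<lambda>n. f (k n) x - f (k 0) x)"
      by (simp add: sum_lessThan_telescope[of "\<lambda>n. f (k n) x"])
    then have "convergent (\<lambda>n. (f (k n) x - f (k 0) x) + f (k 0) x)"
      by (rule convergent_add) (rule convergent_const)
    then show ?case by simp
  qed
  define g where "g = (\<lambda>x. lim (\<lambda>i. f (k i) x))"
  have [measurable]: "f n \<in> borel_measurable M" for n using f by auto
  have g[measurable]: "g \<in> borel_measurable M" unfolding g_def by measurable
  have lim: "AE x in M. (\<lambda>i. f (k i) x) \<longlonglongrightarrow> g x"
    using conv by eventually_elim (simp add: g_def convergent_LIMSEQ_iff)
  \<comment> \<open>The whole sequence is compared with the subsequence here, so the convergence
    obtained is not restricted to the subsequence. Membership of \<open>g\<close> in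
    \<open>L2\<close> is deduced from this bound and must not be presupposed.\<close>
  have Fatou: "(\<integral>\<^sup>+x. ennreal ((norm (f m x - g x))\<^sup>2) \<partial>M) \<le> ennreal (((1/2) ^ i)\<^sup>2)" if "N i \<le> m" for m i
  proof -
    have "(\<integral>\<^sup>+x. ennreal ((norm (f m x - g x))\<^sup>2) \<partial>M) =
        (\<integral>\<^sup>+x. liminf (\<lambda>j. ennreal ((norm (f m x - f (k j) x))\<^sup>2)) \<partial>M)"
    proof (rule nn_integral_cong_AE)
      show "AE x in M. ennreal ((norm (f m x - g x))\<^sup>2) = liminf (\<lambda>j. ennreal ((norm (f m x - f (k j) x))\<^sup>2))"
        using lim
      proof eventually_elim
        case (elim x)
        then have "(\<lambda>j. ennreal ((norm (f m x - f (k j) x))\<^sup>2)) \<longlonglongrightarrow> ennreal ((norm (f m x - g x))\<^sup>2)"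
          by (intro tendsto_intros)
        then show ?case by (intro lim_imp_Liminf[symmetric]) simp_all
      qed
    qed
    also have "\<dots> \<le> liminf (\<lambda>j. \<integral>\<^sup>+x. ennreal ((norm (f m x - f (k j) x))\<^sup>2) \<partial>M)"
      by (rule nn_integral_liminf) measurable
    also have "\<dots> \<le> liminf (\<lambda>j::nat. ennreal (((1/2) ^ i)\<^sup>2))"
    proof (rule Liminf_mono)
      show "\<forall>\<^sub>F j in sequentially. (\<integral>\<^sup>+x. ennreal ((norm (f m x - f (k j) x))\<^sup>2) \<partial>M) \<le> ennreal (((1/2) ^ i)\<^sup>2)"
        using eventually_ge_at_top[of i]
      proof eventually_elim
        case (elim j)
        have "N i \<le> k j" using kN[of i] mono_k elim by (meson incseq_def order_trans)
        then have "L2_norm S (\<lambda>x. f m x - f (k j) x) \<le> (1/2) ^ i"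
          using N[OF that] by (intro less_imp_le)
        then have "(L2_norm S (\<lambda>x. f m x - f (k j) x))\<^sup>2 \<le> ((1/2) ^ i)\<^sup>2"
          by (intro power_mono) auto
        moreover have "(\<integral>\<^sup>+x. ennreal ((norm (f m x - f (k j) x))\<^sup>2) \<partial>M) =
            ennreal ((L2_norm S (\<lambda>x. f m x - f (k j) x))\<^sup>2)"
          unfolding L2_norm_square_integral
          by (intro nn_integral_eq_integral L2_square_integrable L2_diff f) auto
        ultimately show ?case by (simp add: ennreal_leI)
      qed
    qed
    also have "\<dots> = ennreal (((1/2) ^ i)\<^sup>2)" by (simp add: Liminf_const)
    finally show ?thesis .
  qed
  have diff: "(\<lambda>x. f m x - g x) \<in> L2 S" and small: "L2_norm S (\<lambda>x. f m x - g x) \<le> (1/2) ^ i"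
    if "N i \<le> m" for m i
  proof -
    have "integrable M (\<lambda>x. (norm (f m x - g x))\<^sup>2)"
      by (rule integrableI_nonneg) (use Fatou[OF that] in \<open>auto simp: less_top[symmetric] top_unique\<close>)
    then show d: "(\<lambda>x. f m x - g x) \<in> L2 S" by (simp add: L2_def)
    have "ennreal ((L2_norm S (\<lambda>x. f m x - g x))\<^sup>2) \<le> ennreal (((1/2) ^ i)\<^sup>2)"
      using Fatou[OF that] nn_integral_eq_integral[OF L2_square_integrable[OF d]]
      by (simp add: L2_norm_square_integral)
    then have "(L2_norm S (\<lambda>x. f m x - g x))\<^sup>2 \<le> ((1/2) ^ i)\<^sup>2" by (subst (asm) ennreal_le_iff) auto
    then show "L2_norm S (\<lambda>x. f m x - g x) \<le> (1/2) ^ i" by (rule power2_le_imp_le) simp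
  qed
  have "g \<in> L2 S"
    using L2_diff[OF f[of "N 0"] diff[of 0 "N 0"]] by simp
  moreover have "(\<lambda>n. L2_norm S (\<lambda>x. f n x - g x)) \<longlonglongrightarrow> 0"
  proof (rule LIMSEQ_I)
    fix r :: real assume "r > 0"
    then obtain i where "(1/2) ^ i < r" using real_arch_pow_inv[of r "1/2"] by auto
    then show "\<exists>n0. \<forall>n\<ge>n0. norm (L2_norm S (\<lambda>x. f n x - g x) - 0) < r"
      using small by (intro exI[of _ "N i"]) (fastforce intro: le_less_trans)
  qed
  ultimately show ?thesis by (rule that)
qed

end

section \<open>Weak gradients and Sobolev spaces\<close>

context bounded_open
begin

lemma L2_inner_tendsto:
  assumes "\<And>n. f n \<in> L2 S" "g \<in> L2 S" "w \<in> L2 S"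
    and "(\<lambda>n. L2_norm S (\<lambda>x. f n x - g x)) \<longlonglongrightarrow> 0"
  shows "(\<lambda>n. L2_inner S (f n) w) \<longlonglongrightarrow> L2_inner S g w"
proof -
  have "(\<lambda>n. L2_inner S (f n) w - L2_inner S g w) \<longlonglongrightarrow> 0"
  proof (rule Lim_null_comparison)
    show "\<forall>\<^sub>F n in sequentially. norm (L2_inner S (f n) w - L2_inner S g w) \<le> L2_norm S (\<lambda>x. f n x - g x) * L2_norm S w"
      using assms L2_Cauchy_Schwarz[OF L2_diff[OF assms(1,2)] assms(3)]
      by (auto simp: L2_inner_diff_left)
    show "(\<lambda>n. L2_norm S (\<lambda>x. f n x - g x) * L2_norm S w) \<longlonglongrightarrow> 0"
      using tendsto_mult_left_zero[OF assms(4)] by simp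
  qed
  then show ?thesis by (simp add: LIM_zero_iff)
qed

lemma L2_component:
  assumes "g \<in> L2 S" "i \<in> Basis"
  shows "(\<lambda>x. g x \<bullet> i) \<in> L2 S" and "L2_norm S (\<lambda>x. g x \<bullet> i) \<le> L2_norm S g"
proof -
  have le: "(norm (g x \<bullet> i))\<^sup>2 \<le> (norm (g x))\<^sup>2" for x
    using Basis_le_norm[OF assms(2), of "g x"] by (simp add: abs_le_square_iff[symmetric])
  show 1: "(\<lambda>x. g x \<bullet> i) \<in> L2 S"
    by (rule L2_bound[OF _ L2_square_integrable[OF assms(1)]])
      (use assms le in \<open>auto intro: borel_measurable_inner\<close>)
  have "(L2_norm S (\<lambda>x. g x \<bullet> i))\<^sup>2 \<le> (L2_norm S g)\<^sup>2"
    unfolding L2_norm_square_integral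
    by (intro integral_mono L2_square_integrable 1 assms le)
  then show "L2_norm S (\<lambda>x. g x \<bullet> i) \<le> L2_norm S g" by (rule power2_le_imp_le) simp
qed

lemma continuous_measurable: "continuous_on UNIV (f :: 'a \<Rightarrow> real) \<Longrightarrow> f \<in> borel_measurable M"
  by (intro measurable_restrict_space1 measurable_completion)
    (simp add: borel_measurable_continuous_onI)

lemma test_function_L2: "\<phi> \<in> test_functions S \<Longrightarrow> \<phi> \<in> L2 S"
  by (metis bounded_imp_L2 continuous_measurable test_function_continuous test_function_bounded)

lemma test_function_derivative_L2:
  "\<phi> \<in> test_functions S \<Longrightarrow> i \<in> Basis \<Longrightarrow> (\<lambda>x. frechet_derivative \<phi> (at x) i) \<in> L2 S"
  by (rule test_function_derivative_bounded, assumption+)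
    (auto intro: bounded_imp_L2 continuous_measurable test_function_derivative_continuous)

lemma weak_gradient_iff:
  "weak_gradient S u g \<longleftrightarrow> (\<forall>i\<in>Basis. \<forall>\<phi>\<in>test_functions S.
    L2_inner S u (\<lambda>x. frechet_derivative \<phi> (at x) i) = - L2_inner S (\<lambda>x. g x \<bullet> i) \<phi>)"
  by (simp add: weak_gradient_def weak_partial_def L2_inner_def)

text \<open>Each component of the difference integrates to zero against all bumps; the one-sided
  fundamental lemma is applied to it and to its negative.\<close>

lemma weak_gradient_unique:
  assumes g: "g \<in> L2 S" "g' \<in> L2 S" and "weak_gradient S u g" "weak_gradient S u g'"
  shows "AE x in M. g x = g' x"
proof -
  have "AE x in M. g x \<bullet> i = g' x \<bullet> i" if i: "i \<in> Basis" for i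
  proof -
    let ?d = "\<lambda>x. g x \<bullet> i - g' x \<bullet> i"
    have d: "?d \<in> L2 S" using g i by (intro L2_diff L2_component)
    have z: "(\<integral>x. ?d x * bump e a b x \<partial>M) = 0" if "e > 0" "cbox a b \<subseteq> S" for e a b
    proof -
      have t: "bump e a b \<in> test_functions S" using that by (rule bump_test_function)
      have "(\<integral>x. ?d x * bump e a b x \<partial>M) = L2_inner S ?d (bump e a b)"
        by (simp add: L2_inner_def)
      also have "\<dots> = L2_inner S (\<lambda>x. g x \<bullet> i) (bump e a b) - L2_inner S (\<lambda>x. g' x \<bullet> i) (bump e a b)"
        using g i by (intro L2_inner_diff_left L2_component test_function_L2 t)
      also have "\<dots> = 0"
        using assms(3,4) i t unfolding weak_gradient_iff by (metis cancel_comm_monoid_add_class.diff_cancel neg_equal_iff_equal)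
      finally show ?thesis .
    qed
    have z': "(\<integral>x. - ?d x * bump e a b x \<partial>M) = 0" if "e > 0" "cbox a b \<subseteq> S" for e a b
      using z[OF that] by (simp only: mult_minus_left Bochner_Integration.integral_minus)
    have "AE x in M. 0 \<le> ?d x"
      using L2_imp_integrable(1)[OF d] z by (intro AE_nonneg_if_bump_integrals_nonneg open_S) auto
    moreover have "AE x in M. 0 \<le> - ?d x"
      using L2_imp_integrable(1)[OF d] z'
      by (intro AE_nonneg_if_bump_integrals_nonneg[OF open_S] Bochner_Integration.integrable_minus) (auto simp only:)
    ultimately show ?thesis by eventually_elim simp
  qed
  then have "AE x in M. \<forall>i\<in>Basis. g x \<bullet> i = g' x \<bullet> i"
    by (intro AE_finite_allI) auto
  then show ?thesis by eventually_elim (auto intro: euclidean_eqI)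
qed

lemma weak_gradient_add:
  assumes "u \<in> L2 S" "v \<in> L2 S" "g \<in> L2 S" "h \<in> L2 S" "weak_gradient S u g" "weak_gradient S v h"
  shows "weak_gradient S (\<lambda>x. u x + v x) (\<lambda>x. g x + h x)"
  using assms unfolding weak_gradient_iff
  by (auto simp: inner_add_left L2_inner_add_left L2_component test_function_L2 test_function_derivative_L2)

lemma weak_gradient_scale:
  assumes "weak_gradient S u g"
  shows "weak_gradient S (\<lambda>x. c * u x) (\<lambda>x. c *\<^sub>R g x)"
  using assms unfolding weak_gradient_iff by (simp add: L2_inner_scale_left)

lemma weak_gradient_AE:
  assumes "u \<in> L2 S" "AE x in M. u x = v x" "weak_gradient S u g"
  shows "weak_gradient S v g"
  using assms L2_inner_AE_left[OF assms(1,2)] unfolding weak_gradient_iff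
  by (auto simp: test_function_derivative_L2)

text \<open>The weak gradient is a closed operator: both sides of its defining identity are
  continuous in mean square for a fixed test function.\<close>

lemma weak_gradient_limit:
  assumes "\<And>n. u n \<in> L2 S" "v \<in> L2 S" "\<And>n. g n \<in> L2 S" "h \<in> L2 S" "\<And>n. weak_gradient S (u n) (g n)"
    and "(\<lambda>n. L2_norm S (\<lambda>x. u n x - v x)) \<longlonglongrightarrow> 0" "(\<lambda>n. L2_norm S (\<lambda>x. g n x - h x)) \<longlonglongrightarrow> 0"
  shows "weak_gradient S v h"
  unfolding weak_gradient_iff
proof (intro ballI)
  fix i :: 'a and \<phi> assume i: "i \<in> Basis" and \<phi>: "\<phi> \<in> test_functions S"
  have "(\<lambda>n. L2_inner S (u n) (\<lambda>x. frechet_derivative \<phi> (at x) i)) \<longlonglongrightarrow> L2_inner S v (\<lambda>x. frechet_derivative \<phi> (at x) i)"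
    by (intro L2_inner_tendsto assms test_function_derivative_L2 \<phi> i)
  moreover have "(\<lambda>n. L2_norm S (\<lambda>x. g n x \<bullet> i - h x \<bullet> i)) \<longlonglongrightarrow> 0"
    by (rule tendsto_sandwich[OF _ _ tendsto_const assms(7)])
      (use L2_component(2)[OF L2_diff[OF assms(3,4)] i] in \<open>auto simp: inner_diff_left\<close>)
  then have "(\<lambda>n. L2_inner S (\<lambda>x. g n x \<bullet> i) \<phi>) \<longlonglongrightarrow> L2_inner S (\<lambda>x. h x \<bullet> i) \<phi>"
    by (intro L2_inner_tendsto L2_component assms test_function_L2 \<phi> i)
  then have "(\<lambda>n. - L2_inner S (\<lambda>x. g n x \<bullet> i) \<phi>) \<longlonglongrightarrow> - L2_inner S (\<lambda>x. h x \<bullet> i) \<phi>"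
    by (rule tendsto_minus)
  moreover have "L2_inner S (u n) (\<lambda>x. frechet_derivative \<phi> (at x) i) = - L2_inner S (\<lambda>x. g n x \<bullet> i) \<phi>" for n
    using assms(5) i \<phi> unfolding weak_gradient_iff by blast
  ultimately show "L2_inner S v (\<lambda>x. frechet_derivative \<phi> (at x) i) = - L2_inner S (\<lambda>x. h x \<bullet> i) \<phi>"
    using LIMSEQ_unique by simp
qed

lemma H1_imp_L2: "u \<in> H1 S \<Longrightarrow> u \<in> L2 S"
  by (simp add: H1_def)

lemma H1I: "u \<in> L2 S \<Longrightarrow> g \<in> L2 S \<Longrightarrow> weak_gradient S u g \<Longrightarrow> u \<in> H1 S"
  by (auto simp: H1_def)

lemma grad_weak_gradient:
  assumes "u \<in> H1 S"
  shows "grad S u \<in> L2 S" "weak_gradient S u (grad S u)"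
  using someI_ex[of "\<lambda>g. g \<in> L2 S \<and> weak_gradient S u g"] assms
  by (auto simp: H1_def grad_def)

text \<open>\<open>grad\<close> is a choice among representatives, so identities for it hold only
  almost everywhere. This lemma is the way to replace the chosen gradient by a known one.\<close>

lemma grad_AE:
  assumes "u \<in> L2 S" "g \<in> L2 S" "weak_gradient S u g"
  shows "AE x in M. grad S u x = g x"
  by (rule weak_gradient_unique) (use grad_weak_gradient[OF H1I[OF assms]] assms in auto)

lemma H1_add:
  assumes "u \<in> H1 S" "v \<in> H1 S"
  shows "(\<lambda>x. u x + v x) \<in> H1 S" "AE x in M. grad S (\<lambda>x. u x + v x) x = grad S u x + grad S v x"
proof -
  note g = grad_weak_gradient[OF assms(1)] grad_weak_gradient[OF assms(2)]
  note w = weak_gradient_add[OF H1_imp_L2[OF assms(1)] H1_imp_L2[OF assms(2)] g(1,3,2,4)]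
  show "(\<lambda>x. u x + v x) \<in> H1 S" "AE x in M. grad S (\<lambda>x. u x + v x) x = grad S u x + grad S v x"
    by (intro H1I[OF _ _ w] grad_AE[OF _ _ w] L2_add H1_imp_L2 assms g)+
qed

lemma H1_scale:
  assumes "u \<in> H1 S"
  shows "(\<lambda>x. c * u x) \<in> H1 S" "AE x in M. grad S (\<lambda>x. c * u x) x = c *\<^sub>R grad S u x"
proof -
  note g = grad_weak_gradient[OF assms(1)]
  note w = weak_gradient_scale[OF g(2), of c]
  show "(\<lambda>x. c * u x) \<in> H1 S" "AE x in M. grad S (\<lambda>x. c * u x) x = c *\<^sub>R grad S u x"
    by (intro H1I[OF _ _ w] grad_AE[OF _ _ w] L2_scale L2_scaleR H1_imp_L2 assms g)+
qed

lemma H1_diff: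
  assumes "u \<in> H1 S" "v \<in> H1 S"
  shows "(\<lambda>x. u x - v x) \<in> H1 S" "AE x in M. grad S (\<lambda>x. u x - v x) x = grad S u x - grad S v x"
proof -
  note m = H1_scale[OF assms(2), of "-1"] and a = H1_add[OF assms(1) H1_scale(1)[OF assms(2), of "-1"]]
  show "(\<lambda>x. u x - v x) \<in> H1 S" using a(1) by simp
  show "AE x in M. grad S (\<lambda>x. u x - v x) x = grad S u x - grad S v x"
    using a(2) m(2) by eventually_elim simp
qed

lemma H1_norm_nonneg [simp]: "0 \<le> H1_norm S u"
  by (simp add: H1_norm_def)

lemma L2_norm_le_H1_norm: "L2_norm S u \<le> H1_norm S u"
  and grad_norm_le_H1_norm: "L2_norm S (grad S u) \<le> H1_norm S u"
  by (auto simp: H1_norm_def intro!: real_le_rsqrt)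

lemma H1_norm_le_sum: "H1_norm S u \<le> L2_norm S u + L2_norm S (grad S u)"
  unfolding H1_norm_def by (rule sqrt_sum_squares_le_sum) auto

lemma H1_norm_triangle:
  assumes "u \<in> H1 S" "v \<in> H1 S"
  shows "H1_norm S (\<lambda>x. u x + v x) \<le> H1_norm S u + H1_norm S v"
proof -
  have g: "L2_norm S (grad S (\<lambda>x. u x + v x)) \<le> L2_norm S (grad S u) + L2_norm S (grad S v)"
    using L2_norm_triangle[OF grad_weak_gradient(1)[OF assms(1)] grad_weak_gradient(1)[OF assms(2)]]
      L2_norm_AE[OF grad_weak_gradient(1)[OF H1_add(1)[OF assms]] H1_add(2)[OF assms]] by simp
  have "H1_norm S (\<lambda>x. u x + v x) \<le> sqrt ((L2_norm S u + L2_norm S v)\<^sup>2 + (L2_norm S (grad S u) + L2_norm S (grad S v))\<^sup>2)"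
    unfolding H1_norm_def using assms
    by (intro real_sqrt_le_mono add_mono power_mono L2_norm_triangle g) (auto intro: H1_imp_L2)
  also have "\<dots> \<le> H1_norm S u + H1_norm S v"
    unfolding H1_norm_def by (rule real_sqrt_sum_squares_triangle_ineq)
  finally show ?thesis .
qed

lemma H1_norm_scale:
  assumes "u \<in> H1 S"
  shows "H1_norm S (\<lambda>x. c * u x) = \<bar>c\<bar> * H1_norm S u"
proof -
  have g: "L2_norm S (grad S (\<lambda>x. c * u x)) = \<bar>c\<bar> * L2_norm S (grad S u)"
    using L2_norm_AE[OF grad_weak_gradient(1)[OF H1_scale(1)[OF assms]] H1_scale(2)[OF assms]]
    by (simp add: L2_norm_scaleR)
  show ?thesis
    by (simp add: H1_norm_def g L2_norm_scale power_mult_distrib real_sqrt_mult flip: distrib_left)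
qed

lemma test_function_H1:
  assumes "\<phi> \<in> test_functions S"
  shows "\<phi> \<in> H1 S"
proof (rule H1I)
  let ?g = "\<lambda>x. \<Sum>j\<in>Basis. frechet_derivative \<phi> (at x) j *\<^sub>R j"
  show "\<phi> \<in> L2 S" using assms by (rule test_function_L2)
  have comp: "?g x \<bullet> i = frechet_derivative \<phi> (at x) i" if "i \<in> Basis" for x i
    using that by simp
  have sum: "(\<lambda>x. \<Sum>j\<in>B. frechet_derivative \<phi> (at x) j *\<^sub>R j) \<in> L2 S" if "finite B" "B \<subseteq> Basis" for B :: "'a set"
    using that
  proof (induction B)
    case (insert i B)
    have "(\<lambda>x. frechet_derivative \<phi> (at x) i *\<^sub>R i) \<in> L2 S"
      using test_function_derivative_L2[OF assms, of i] insert.prems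
      by (auto simp: L2_def power_mult_distrib intro: borel_measurable_scaleR)
    then show ?case using insert L2_add by auto
  qed simp
  show "?g \<in> L2 S" by (rule sum) auto
  show "weak_gradient S \<phi> ?g"
    unfolding weak_gradient_def using weak_partial_test_function[OF S_lebesgue assms] by (simp add: comp)
qed

lemma H10_imp_H1: "u \<in> H10 S \<Longrightarrow> u \<in> H1 S"
  by (simp add: H10_def)

lemma H10_imp_L2: "u \<in> H10 S \<Longrightarrow> u \<in> L2 S"
  by (simp add: H10_imp_H1 H1_imp_L2)

lemma H10I:
  assumes u: "u \<in> H1 S" and ap: "\<And>e. e > 0 \<Longrightarrow> \<exists>\<phi>\<in>test_functions S. H1_norm S (\<lambda>x. \<phi> x - u x) < e"
  shows "u \<in> H10 S"
proof -
  have "\<forall>n::nat. \<exists>\<phi>\<in>test_functions S. H1_norm S (\<lambda>x. \<phi> x - u x) < 1 / Suc n" using ap by simp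
  then obtain \<phi> where \<phi>: "\<And>n. \<phi> n \<in> test_functions S" "\<And>n. H1_norm S (\<lambda>x. \<phi> n x - u x) < 1 / Suc n"
    by metis
  have "(\<lambda>n. H1_norm S (\<lambda>x. \<phi> n x - u x)) \<longlonglongrightarrow> 0"
    by (rule tendsto_sandwich[OF _ _ tendsto_const LIMSEQ_Suc[OF lim_1_over_n]])
      (auto intro!: always_eventually less_imp_le[OF \<phi>(2)[simplified]])
  then show ?thesis using u \<phi> by (auto simp: H10_def)
qed

lemma H10_approx:
  assumes "u \<in> H10 S" "e > 0"
  obtains \<phi> where "\<phi> \<in> test_functions S" "H1_norm S (\<lambda>x. \<phi> x - u x) < e"
proof -
  obtain \<phi> where \<phi>: "\<And>n. \<phi> n \<in> test_functions S" "(\<lambda>n. H1_norm S (\<lambda>x. \<phi> n x - u x)) \<longlonglongrightarrow> 0"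
    using assms(1) by (auto simp: H10_def)
  obtain n where "H1_norm S (\<lambda>x. \<phi> n x - u x) < e"
    using order_tendstoD(2)[OF \<phi>(2) assms(2)] by (auto simp: eventually_sequentially)
  then show ?thesis using \<phi>(1) that by blast
qed

lemma H10_zero: "(\<lambda>_. 0) \<in> H10 S"
proof (rule H10I)
  have t: "(\<lambda>_. 0) \<in> test_functions S" by (rule test_functionsI[where K = "{}"]) (auto intro: Ck_const)
  then show "(\<lambda>_. 0) \<in> H1 S" by (rule test_function_H1)
  then have "H1_norm S (\<lambda>x. 0) = 0" using H1_norm_scale[of "\<lambda>_. 0" 0] by simp
  then show "\<exists>\<phi>\<in>test_functions S. H1_norm S (\<lambda>x. \<phi> x - 0) < e" if "e > 0" for e
    using t that by (intro bexI[of _ "\<lambda>_. 0"]) auto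
qed

lemma H10_add:
  assumes "u \<in> H10 S" "v \<in> H10 S"
  shows "(\<lambda>x. u x + v x) \<in> H10 S"
proof (rule H10I)
  show "(\<lambda>x. u x + v x) \<in> H1 S" using assms by (intro H1_add H10_imp_H1)
  fix e :: real assume "e > 0"
  then obtain \<phi> \<psi> where \<phi>: "\<phi> \<in> test_functions S" "H1_norm S (\<lambda>x. \<phi> x - u x) < e / 2"
    and \<psi>: "\<psi> \<in> test_functions S" "H1_norm S (\<lambda>x. \<psi> x - v x) < e / 2"
    using H10_approx[OF assms(1), of "e / 2"] H10_approx[OF assms(2), of "e / 2"] by (metis half_gt_zero)
  have "H1_norm S (\<lambda>x. (\<phi> x - u x) + (\<psi> x - v x)) < e"
    using H1_norm_triangle[OF H1_diff(1)[OF test_function_H1[OF \<phi>(1)] H10_imp_H1[OF assms(1)]]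
        H1_diff(1)[OF test_function_H1[OF \<psi>(1)] H10_imp_H1[OF assms(2)]]] \<phi>(2) \<psi>(2) by linarith
  then show "\<exists>\<phi>\<in>test_functions S. H1_norm S (\<lambda>x. \<phi> x - (u x + v x)) < e"
    by (intro bexI[OF _ test_functions_add[OF \<phi>(1) \<psi>(1)]]) (simp add: algebra_simps)
qed

lemma H10_scale:
  assumes "u \<in> H10 S"
  shows "(\<lambda>x. c * u x) \<in> H10 S"
proof (rule H10I)
  show "(\<lambda>x. c * u x) \<in> H1 S" using assms by (intro H1_scale H10_imp_H1)
  fix e :: real assume e: "e > 0"
  obtain \<phi> where \<phi>: "\<phi> \<in> test_functions S" "H1_norm S (\<lambda>x. \<phi> x - u x) < e / (\<bar>c\<bar> + 1)"
    using H10_approx[OF assms, of "e / (\<bar>c\<bar> + 1)"] e by auto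
  have "H1_norm S (\<lambda>x. c * (\<phi> x - u x)) = \<bar>c\<bar> * H1_norm S (\<lambda>x. \<phi> x - u x)"
    by (rule H1_norm_scale[OF H1_diff(1)[OF test_function_H1[OF \<phi>(1)] H10_imp_H1[OF assms(1)]]])
  also have "\<dots> \<le> \<bar>c\<bar> * (e / (\<bar>c\<bar> + 1))" using \<phi>(2) by (intro mult_left_mono) auto
  also have "\<dots> < e" using e by (simp add: field_simps)
  finally show "\<exists>\<phi>\<in>test_functions S. H1_norm S (\<lambda>x. \<phi> x - c * u x) < e"
    by (intro bexI[OF _ test_functions_scale[OF \<phi>(1), of c]]) (simp add: algebra_simps)
qed

lemma H10_diff: "u \<in> H10 S \<Longrightarrow> v \<in> H10 S \<Longrightarrow> (\<lambda>x. u x - v x) \<in> H10 S"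
  using H10_add[of u "\<lambda>x. -1 * v x"] H10_scale[of v "-1"] by simp

text \<open>Values and gradients converge separately in \<open>L2\<close>, closedness of the weak
  gradient ties the limits together, and approximability by test functions survives the limit.
  Completeness is what lets the velocity be integrated in \<open>H10\<close>.\<close>

lemma H10_complete:
  assumes u: "\<And>n. u n \<in> H10 S"
    and Cauchy: "\<And>e. e > 0 \<Longrightarrow> \<exists>N. \<forall>m\<ge>N. \<forall>n\<ge>N. H1_norm S (\<lambda>x. u m x - u n x) < e"
  obtains v where "v \<in> H10 S" "(\<lambda>n. H1_norm S (\<lambda>x. u n x - v x)) \<longlonglongrightarrow> 0"
proof -
  note uH = H10_imp_H1[OF u] and uL = H10_imp_L2[OF u]
  note g = grad_weak_gradient[OF uH]
  have C1: "\<exists>N. \<forall>m\<ge>N. \<forall>n\<ge>N. L2_norm S (\<lambda>x. u m x - u n x) < e" if "e > 0" for e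
    using Cauchy[OF that] le_less_trans[OF L2_norm_le_H1_norm] by blast
  obtain v where v: "v \<in> L2 S" "(\<lambda>n. L2_norm S (\<lambda>x. u n x - v x)) \<longlonglongrightarrow> 0"
    using L2_complete[OF uL C1] by blast
  have gdiff: "L2_norm S (\<lambda>x. grad S (u m) x - grad S (u n) x) \<le> H1_norm S (\<lambda>x. u m x - u n x)" for m n
    using L2_norm_AE[OF grad_weak_gradient(1)[OF H1_diff(1)[OF uH uH]] H1_diff(2)[OF uH uH], of m n]
      grad_norm_le_H1_norm[of "\<lambda>x. u m x - u n x"] by simp
  have C2: "\<exists>N. \<forall>m\<ge>N. \<forall>n\<ge>N. L2_norm S (\<lambda>x. grad S (u m) x - grad S (u n) x) < e" if "e > 0" for e
    using Cauchy[OF that] le_less_trans[OF gdiff] by blast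
  obtain h where h: "h \<in> L2 S" "(\<lambda>n. L2_norm S (\<lambda>x. grad S (u n) x - h x)) \<longlonglongrightarrow> 0"
    using L2_complete[OF g(1) C2] by blast
  have wg: "weak_gradient S v h"
    by (rule weak_gradient_limit[OF uL v(1) g(1) h(1) g(2) v(2) h(2)])
  have vH: "v \<in> H1 S" using v(1) h(1) wg by (rule H1I)
  have "L2_norm S (grad S (\<lambda>x. u n x - v x)) = L2_norm S (\<lambda>x. grad S (u n) x - h x)" for n
  proof -
    have "AE x in M. grad S (\<lambda>x. u n x - v x) x = grad S (u n) x - h x"
      using H1_diff(2)[OF uH[of n] vH] grad_AE[OF v(1) h(1) wg] by eventually_elim simp
    from L2_norm_AE[OF grad_weak_gradient(1)[OF H1_diff(1)[OF uH[of n] vH]] this]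
    show ?thesis by (rule sym)
  qed
  note gn = this
  have lim: "(\<lambda>n. H1_norm S (\<lambda>x. u n x - v x)) \<longlonglongrightarrow> 0"
  proof (rule tendsto_sandwich[OF _ _ tendsto_const])
    show "(\<lambda>n. L2_norm S (\<lambda>x. u n x - v x) + L2_norm S (\<lambda>x. grad S (u n) x - h x)) \<longlonglongrightarrow> 0"
      using tendsto_add[OF v(2) h(2)] by simp
    show "\<forall>\<^sub>F n in sequentially. H1_norm S (\<lambda>x. u n x - v x)
        \<le> L2_norm S (\<lambda>x. u n x - v x) + L2_norm S (\<lambda>x. grad S (u n) x - h x)"
      using H1_norm_le_sum[of "\<lambda>x. u n x - v x" for n] by (simp add: gn)
  qed simp
  have "v \<in> H10 S"
  proof (rule H10I[OF vH])
    fix e :: real assume "e > 0"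
    then obtain n where n: "H1_norm S (\<lambda>x. u n x - v x) < e / 2"
      using order_tendstoD(2)[OF lim, of "e / 2"] by (auto simp: eventually_sequentially)
    obtain \<phi> where \<phi>: "\<phi> \<in> test_functions S" "H1_norm S (\<lambda>x. \<phi> x - u n x) < e / 2"
      using H10_approx[OF u, of "e / 2" n] \<open>e > 0\<close> by auto
    have "H1_norm S (\<lambda>x. (\<phi> x - u n x) + (u n x - v x)) < e"
      using H1_norm_triangle[OF H1_diff(1)[OF test_function_H1[OF \<phi>(1)] uH[of n]] H1_diff(1)[OF uH[of n] vH]] n \<phi>(2)
      by linarith
    then show "\<exists>\<phi>\<in>test_functions S. H1_norm S (\<lambda>x. \<phi> x - v x) < e"
      using \<phi>(1) by auto
  qed
  then show ?thesis using lim by (rule that)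
qed

end

section \<open>Integrals in function spaces\<close>

text \<open>The linear structure is kept apart from the seminorm. Functionals are built on it alone,
  and for \<open>H10_dual\<close> it is all that gets established.\<close>

locale fun_space =
  fixes V :: "('x \<Rightarrow> real) set"
  assumes zero_mem: "(\<lambda>_. 0) \<in> V"
    and add_mem: "u \<in> V \<Longrightarrow> v \<in> V \<Longrightarrow> (\<lambda>x. u x + v x) \<in> V"
    and scale_mem: "u \<in> V \<Longrightarrow> (\<lambda>x. c * u x) \<in> V"
begin

lemma diff_mem: "u \<in> V \<Longrightarrow> v \<in> V \<Longrightarrow> (\<lambda>x. u x - v x) \<in> V"
  using add_mem[of u "\<lambda>x. -1 * v x"] scale_mem[of v "-1"] by simp

lemma sum_mem: "finite I \<Longrightarrow> (\<And>i. i \<in> I \<Longrightarrow> u i \<in> V) \<Longrightarrow> (\<lambda>x. \<Sum>i\<in>I. u i x) \<in> V"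
  by (induction I rule: finite_induct) (auto intro: zero_mem add_mem)

end

locale seminormed_space = fun_space V for V :: "('x \<Rightarrow> real) set" +
  fixes N :: "('x \<Rightarrow> real) \<Rightarrow> real"
  assumes norm_nonneg: "0 \<le> N u"
    and norm_triangle: "u \<in> V \<Longrightarrow> v \<in> V \<Longrightarrow> N (\<lambda>x. u x + v x) \<le> N u + N v"
    and norm_scale: "u \<in> V \<Longrightarrow> N (\<lambda>x. c * u x) = \<bar>c\<bar> * N u"
begin

lemma norm_zero: "N (\<lambda>_. 0) = 0"
  using norm_scale[OF zero_mem, of 0] by simp

lemma norm_minus_commute:
  assumes "u \<in> V" "v \<in> V"
  shows "N (\<lambda>x. u x - v x) = N (\<lambda>x. v x - u x)"
  using norm_scale[OF diff_mem[OF assms(2,1)], of "-1"] by simp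

lemma norm_diff_triangle:
  assumes "u \<in> V" "v \<in> V" "w \<in> V"
  shows "N (\<lambda>x. u x - w x) \<le> N (\<lambda>x. u x - v x) + N (\<lambda>x. v x - w x)"
  using norm_triangle[OF diff_mem[OF assms(1,2)] diff_mem[OF assms(2,3)]] by simp

lemma norm_triangle_diff:
  assumes "u \<in> V" "v \<in> V"
  shows "N (\<lambda>x. u x - v x) \<le> N u + N v"
  using norm_diff_triangle[OF assms(1) zero_mem assms(2)] norm_minus_commute[OF zero_mem assms(2)] by simp

lemma norm_sum_le:
  "finite I \<Longrightarrow> (\<And>i. i \<in> I \<Longrightarrow> u i \<in> V) \<Longrightarrow> N (\<lambda>x. \<Sum>i\<in>I. u i x) \<le> (\<Sum>i\<in>I. N (u i))"
proof (induction I rule: finite_induct)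
  case (insert i I)
  then show ?case
    using norm_triangle[of "u i" "\<lambda>x. \<Sum>i\<in>I. u i x"] sum_mem[of I u] by fastforce
qed (simp add: norm_zero)

end

text \<open>A simple function has finitely many values, so \<open>G\<close> may be arbitrary. It is
  used with point evaluations, seminorms and functionals.\<close>

lemma integral_simple_function_image:
  fixes G :: "'c \<Rightarrow> real"
  assumes M: "finite_measure M" and s: "simple_function M s"
  shows "integrable M (\<lambda>t. G (s t))"
    and "(\<integral>t. G (s t) \<partial>M) = (\<Sum>c\<in>s ` space M. measure M (s -` {c} \<inter> space M) * G c)"
proof -
  interpret finite_measure M by fact
  have fin: "finite (s ` space M)" using s by (rule simple_functionD)
  have sets: "s -` {c} \<inter> space M \<in> sets M" for c using s by (rule simple_functionD)
  have eq: "G (s t) = (\<Sum>c\<in>s ` space M. indicator (s -` {c} \<inter> space M) t * G c)" if "t \<in> space M" for t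
  proof -
    have "(\<Sum>c\<in>s ` space M. indicator (s -` {c} \<inter> space M) t * G c) = (\<Sum>c\<in>s ` space M. if c = s t then G c else 0)"
      using that by (intro sum.cong) (auto simp: indicator_def)
    then show ?thesis using fin that by simp
  qed
  have i: "integrable M (\<lambda>t. indicator (s -` {c} \<inter> space M) t * G c)" for c
    using sets[of c] by (intro integrable_mult_left integrable_real_indicator) (auto simp: less_top[symmetric])
  show "integrable M (\<lambda>t. G (s t))"
    by (subst Bochner_Integration.integrable_cong[OF refl eq]) (auto intro: Bochner_Integration.integrable_sum i)
  show "(\<integral>t. G (s t) \<partial>M) = (\<Sum>c\<in>s ` space M. measure M (s -` {c} \<inter> space M) * G c)"
    by (subst Bochner_Integration.integral_cong[OF refl eq]) (use i sets in \<open>auto simp: Bochner_Integration.integral_sum\<close>)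
qed

section \<open>Bounded functionals under the Bochner integral\<close>

locale linear_functional = fun_space V for V :: "('x \<Rightarrow> real) set" +
  fixes \<Lambda> :: "('x \<Rightarrow> real) \<Rightarrow> real"
  assumes functional_add: "u \<in> V \<Longrightarrow> v \<in> V \<Longrightarrow> \<Lambda> (\<lambda>x. u x + v x) = \<Lambda> u + \<Lambda> v"
    and functional_scale: "u \<in> V \<Longrightarrow> \<Lambda> (\<lambda>x. c * u x) = c * \<Lambda> u"
begin

lemma functional_zero: "\<Lambda> (\<lambda>_. 0) = 0"
  using functional_scale[OF zero_mem, of 0] by simp

lemma functional_diff: "u \<in> V \<Longrightarrow> v \<in> V \<Longrightarrow> \<Lambda> (\<lambda>x. u x - v x) = \<Lambda> u - \<Lambda> v"
  using functional_add[of u "\<lambda>x. -1 * v x"] scale_mem[of v "-1"] functional_scale[of v "-1"] by simp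

lemma functional_sum:
  "finite I \<Longrightarrow> (\<And>i. i \<in> I \<Longrightarrow> u i \<in> V) \<Longrightarrow> \<Lambda> (\<lambda>x. \<Sum>i\<in>I. u i x) = (\<Sum>i\<in>I. \<Lambda> (u i))"
  by (induction I rule: finite_induct) (auto simp: functional_zero functional_add sum_mem)

lemma functional_simple_integral:
  assumes M: "finite_measure M" and s: "simple_function M s" "s ` space M \<subseteq> V"
  shows "(\<lambda>x. \<integral>t. s t x \<partial>M) \<in> V" "\<Lambda> (\<lambda>x. \<integral>t. s t x \<partial>M) = (\<integral>t. \<Lambda> (s t) \<partial>M)"
proof -
  have fin: "finite (s ` space M)" using s(1) by (rule simple_functionD)
  have eq: "(\<lambda>x. \<integral>t. s t x \<partial>M) = (\<lambda>x. \<Sum>c\<in>s ` space M. measure M (s -` {c} \<inter> space M) * c x)"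
    using integral_simple_function_image(2)[OF M s(1), of "\<lambda>c. c _"] by (rule ext)
  show "(\<lambda>x. \<integral>t. s t x \<partial>M) \<in> V" unfolding eq by (intro sum_mem fin scale_mem) (use s in auto)
  show "\<Lambda> (\<lambda>x. \<integral>t. s t x \<partial>M) = (\<integral>t. \<Lambda> (s t) \<partial>M)"
    unfolding eq integral_simple_function_image(2)[OF M s(1)]
    using s(2) by (subst functional_sum[OF fin]) (auto intro!: scale_mem sum.cong functional_scale)
qed

text \<open>Along simple functions the values of the functional are measurable, and by boundedness
  they converge almost everywhere.\<close>

lemma functional_measurable:
  fixes A :: "'t::euclidean_space set"
  assumes A: "A \<in> sets lebesgue" and u: "strongly_measurable (lebesgue_on A) V N u"
    and bound: "\<And>u. u \<in> V \<Longrightarrow> \<bar>\<Lambda> u\<bar> \<le> C * N u"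
  shows "(\<lambda>t. \<Lambda> (u t)) \<in> borel_measurable (lebesgue_on A)"
proof -
  obtain s where s: "\<And>n. simple_function (lebesgue_on A) (s n)" "\<And>n. s n ` A \<subseteq> V"
    and lim: "AE t in lebesgue_on A. (\<lambda>n. N (\<lambda>x. s n t x - u t x)) \<longlonglongrightarrow> 0"
    and uV: "AE t in lebesgue_on A. u t \<in> V"
    using u by (auto simp: strongly_measurable_def)
  have meas: "(\<lambda>t. \<Lambda> (s n t)) \<in> borel_measurable (lebesgue_on A)" for n
    using simple_function_compose[OF s(1), of \<Lambda> n] by (auto simp: comp_def intro: borel_measurable_simple_function)
  have "AE t in lebesgue_on A. t \<in> A" by (rule AE_I2) simp
  then have "AE t in lebesgue_on A. (\<lambda>n. \<Lambda> (s n t)) \<longlonglongrightarrow> \<Lambda> (u t)"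
    using lim uV
  proof eventually_elim
    case (elim t)
    have "\<Lambda> (s n t) - \<Lambda> (u t) = \<Lambda> (\<lambda>x. s n t x - u t x)" for n
      using s(2)[of n] elim by (intro functional_diff[symmetric]) auto
    moreover have "\<bar>\<Lambda> (\<lambda>x. s n t x - u t x)\<bar> \<le> C * N (\<lambda>x. s n t x - u t x)" for n
      using s(2)[of n] elim by (intro bound diff_mem) auto
    ultimately have "norm (\<Lambda> (s n t) - \<Lambda> (u t)) \<le> C * N (\<lambda>x. s n t x - u t x)" for n
      by simp
    from Lim_null_comparison[OF always_eventually[OF allI[OF this]] tendsto_mult_right_zero[OF elim(2)]]
    have "(\<lambda>n. \<Lambda> (s n t) - \<Lambda> (u t)) \<longlonglongrightarrow> 0" .
    then show ?case by (simp add: LIM_zero_iff)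
  qed
  then have lim_eq: "AE t in lebesgue_on A. lim (\<lambda>n. \<Lambda> (s n t)) = \<Lambda> (u t)"
    by eventually_elim (rule limI)
  show ?thesis
    by (rule borel_measurable_lebesgue_on_AE[OF A borel_measurable_lim_metric[OF meas] lim_eq])
qed

text \<open>All vector-valued integrals are exploited through this exchange: a suitable functional
  turns each statement about them into one about real integrals.\<close>

lemma functional_bochner_integral:
  fixes A :: "'t::euclidean_space set"
  assumes A: "A \<in> lmeasurable" and u: "has_bochner_integral_in (lebesgue_on A) V N u I"
    and bound: "\<And>u. u \<in> V \<Longrightarrow> \<bar>\<Lambda> u\<bar> \<le> C * N u" and C: "0 < C"
  shows "integrable (lebesgue_on A) (\<lambda>t. \<Lambda> (u t))" "(\<integral>t. \<Lambda> (u t) \<partial>lebesgue_on A) = \<Lambda> I"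
proof -
  let ?M = "lebesgue_on A"
  have fin: "finite_measure ?M" using A by (rule finite_measure_lebesgue_on)
  have sm: "strongly_measurable ?M V N u" and I: "I \<in> V" using u by (auto simp: has_bochner_integral_in_def)
  obtain s where s: "\<And>n. simple_function ?M (s n)" "\<And>n. s n ` space ?M \<subseteq> V"
    and l1: "(\<lambda>n. \<integral>\<^sup>+t. ennreal (N (\<lambda>x. s n t x - u t x)) \<partial>?M) \<longlonglongrightarrow> 0"
    and l2: "(\<lambda>n. N (\<lambda>x. (\<integral>t. s n t x \<partial>?M) - I x)) \<longlonglongrightarrow> 0"
    using u unfolding has_bochner_integral_in_def by blast
  note sint = functional_simple_integral[OF fin s(1) s(2)]
  have [measurable]: "(\<lambda>t. \<Lambda> (u t)) \<in> borel_measurable ?M"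
    using functional_measurable[OF _ sm bound] A by auto
  have si: "integrable ?M (\<lambda>t. \<Lambda> (s n t))" for n using integral_simple_function_image(1)[OF fin s(1)] .
  then have [measurable]: "(\<lambda>t. \<Lambda> (s n t)) \<in> borel_measurable ?M" for n by auto
  have uV: "AE t in ?M. u t \<in> V" using sm by (simp add: strongly_measurable_def)
  have le: "(\<integral>\<^sup>+t. ennreal (norm (\<Lambda> (s n t) - \<Lambda> (u t))) \<partial>?M) \<le> ennreal C * (\<integral>\<^sup>+t. ennreal (N (\<lambda>x. s n t x - u t x)) \<partial>?M)" for n
  proof -
    have "AE t in ?M. t \<in> A" by (rule AE_I2) simp
    \<comment> \<open>The constant is divided out on the left because measurability is known for the
      functional, not for the seminorm of the error; only a factor of a measurable integrand is
      pulled out of the integral afterwards.\<close>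
    then have "AE t in ?M. ennreal (\<bar>\<Lambda> (s n t) - \<Lambda> (u t)\<bar> / C) \<le> ennreal (N (\<lambda>x. s n t x - u t x))"
      using uV
    proof eventually_elim
      case (elim t)
      then have "s n t \<in> V" using s(2)[of n] by auto
      then have "\<bar>\<Lambda> (s n t) - \<Lambda> (u t)\<bar> \<le> C * N (\<lambda>x. s n t x - u t x)"
        using bound[OF diff_mem, of "s n t" "u t"] elim by (simp add: functional_diff)
      then have "\<bar>\<Lambda> (s n t) - \<Lambda> (u t)\<bar> / C \<le> N (\<lambda>x. s n t x - u t x)"
        using C by (simp add: field_simps)
      then show ?case by (simp add: ennreal_leI)
    qed
    then have "(\<integral>\<^sup>+t. ennreal (\<bar>\<Lambda> (s n t) - \<Lambda> (u t)\<bar> / C) \<partial>?M) \<le> (\<integral>\<^sup>+t. ennreal (N (\<lambda>x. s n t x - u t x)) \<partial>?M)"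
      by (rule nn_integral_mono_AE)
    then have "ennreal C * (\<integral>\<^sup>+t. ennreal (\<bar>\<Lambda> (s n t) - \<Lambda> (u t)\<bar> / C) \<partial>?M) \<le> ennreal C * (\<integral>\<^sup>+t. ennreal (N (\<lambda>x. s n t x - u t x)) \<partial>?M)"
      by (rule mult_left_mono) simp
    moreover have "ennreal C * (\<integral>\<^sup>+t. ennreal (\<bar>\<Lambda> (s n t) - \<Lambda> (u t)\<bar> / C) \<partial>?M) = (\<integral>\<^sup>+t. ennreal (norm (\<Lambda> (s n t) - \<Lambda> (u t))) \<partial>?M)"
      using C by (subst nn_integral_cmult[symmetric]) (auto simp flip: ennreal_mult')
    ultimately show ?thesis by simp
  qed
  have l1': "(\<lambda>n. ennreal C * (\<integral>\<^sup>+t. ennreal (N (\<lambda>x. s n t x - u t x)) \<partial>?M)) \<longlonglongrightarrow> 0"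
    using ennreal_tendsto_cmult[OF _ l1, of "ennreal C"] by simp
  have d0: "(\<lambda>n. \<integral>\<^sup>+t. ennreal (norm (\<Lambda> (s n t) - \<Lambda> (u t))) \<partial>?M) \<longlonglongrightarrow> 0"
    by (rule tendsto_sandwich[OF _ _ tendsto_const l1']) (use le in auto)
  obtain n where "(\<integral>\<^sup>+t. ennreal (norm (\<Lambda> (s n t) - \<Lambda> (u t))) \<partial>?M) < 1"
    using order_tendstoD(2)[OF d0, of 1] by (auto simp: eventually_sequentially)
  then have "integrable ?M (\<lambda>t. \<Lambda> (s n t) - \<Lambda> (u t))"
    by (intro integrableI_bounded) (auto intro: less_trans simp: ennreal_one_less_top)
  from Bochner_Integration.integrable_diff[OF si[of n] this]
  show ui: "integrable ?M (\<lambda>t. \<Lambda> (u t))" by simp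
  have "(\<lambda>n. ennreal (norm ((\<integral>t. \<Lambda> (s n t) \<partial>?M) - (\<integral>t. \<Lambda> (u t) \<partial>?M)))) \<longlonglongrightarrow> 0"
  proof (rule tendsto_sandwich[OF _ _ tendsto_const d0])
    have "ennreal (norm ((\<integral>t. \<Lambda> (s n t) \<partial>?M) - (\<integral>t. \<Lambda> (u t) \<partial>?M))) \<le> (\<integral>\<^sup>+t. ennreal (norm (\<Lambda> (s n t) - \<Lambda> (u t))) \<partial>?M)" for n
      using integral_norm_bound_ennreal[OF Bochner_Integration.integrable_diff[OF si[of n] ui]]
      by (simp add: si ui)
    then show "\<forall>\<^sub>F n in sequentially. ennreal (norm ((\<integral>t. \<Lambda> (s n t) \<partial>?M) - (\<integral>t. \<Lambda> (u t) \<partial>?M)))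
        \<le> (\<integral>\<^sup>+t. ennreal (norm (\<Lambda> (s n t) - \<Lambda> (u t))) \<partial>?M)" by simp
  qed simp
  then have "(\<lambda>n. norm ((\<integral>t. \<Lambda> (s n t) \<partial>?M) - (\<integral>t. \<Lambda> (u t) \<partial>?M))) \<longlonglongrightarrow> 0"
    by (subst (asm) ennreal_0[symmetric], subst (asm) tendsto_ennreal_iff) auto
  then have a: "(\<lambda>n. \<integral>t. \<Lambda> (s n t) \<partial>?M) \<longlonglongrightarrow> (\<integral>t. \<Lambda> (u t) \<partial>?M)"
    by (simp add: tendsto_rabs_zero_iff LIM_zero_iff)
  have "(\<lambda>n. (\<integral>t. \<Lambda> (s n t) \<partial>?M) - \<Lambda> I) \<longlonglongrightarrow> 0"
  proof (rule Lim_null_comparison)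
    show "(\<lambda>n. C * N (\<lambda>x. (\<integral>t. s n t x \<partial>?M) - I x)) \<longlonglongrightarrow> 0"
      using tendsto_mult_right_zero[OF l2] .
    show "\<forall>\<^sub>F n in sequentially. norm ((\<integral>t. \<Lambda> (s n t) \<partial>?M) - \<Lambda> I) \<le> C * N (\<lambda>x. (\<integral>t. s n t x \<partial>?M) - I x)"
      using bound[OF diff_mem[OF sint(1) I]]
      by (simp add: functional_diff[OF sint(1) I] sint(2))
  qed
  then have "(\<lambda>n. \<integral>t. \<Lambda> (s n t) \<partial>?M) \<longlonglongrightarrow> \<Lambda> I" by (simp add: LIM_zero_iff)
  with a show "(\<integral>t. \<Lambda> (u t) \<partial>?M) = \<Lambda> I" by (rule LIMSEQ_unique)
qed

end

section \<open>Existence of Bochner integrals\<close>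

context seminormed_space
begin

lemma norm_simple_integral_le:
  assumes M: "finite_measure M" and s: "simple_function M s" "s ` space M \<subseteq> V"
  shows "(\<lambda>x. \<integral>t. s t x \<partial>M) \<in> V" "N (\<lambda>x. \<integral>t. s t x \<partial>M) \<le> (\<integral>t. N (s t) \<partial>M)"
proof -
  have fin: "finite (s ` space M)" using s(1) by (rule simple_functionD)
  have eq: "(\<lambda>x. \<integral>t. s t x \<partial>M) = (\<lambda>x. \<Sum>c\<in>s ` space M. measure M (s -` {c} \<inter> space M) * c x)"
    using integral_simple_function_image(2)[OF M s(1), of "\<lambda>c. c _"] by (rule ext)
  show "(\<lambda>x. \<integral>t. s t x \<partial>M) \<in> V" unfolding eq by (intro sum_mem fin scale_mem) (use s in auto)
  have "N (\<lambda>x. \<integral>t. s t x \<partial>M) \<le> (\<Sum>c\<in>s ` space M. N (\<lambda>x. measure M (s -` {c} \<inter> space M) * c x))"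
    unfolding eq by (intro norm_sum_le fin scale_mem) (use s in auto)
  also have "\<dots> = (\<integral>t. N (s t) \<partial>M)"
    unfolding integral_simple_function_image(2)[OF M s(1)]
    using s(2) by (intro sum.cong) (auto simp: norm_scale)
  finally show "N (\<lambda>x. \<integral>t. s t x \<partial>M) \<le> (\<integral>t. N (s t) \<partial>M)" .
qed

text \<open>Almost-everywhere approximants are truncated where their norm exceeds twice that of the
  limit. They still converge, and \<open>3 N u\<close> now dominates the error. The modification
  \<open>u'\<close> on a null set gives measurable norms over a measure that may be
  incomplete.\<close>

lemma strongly_measurable_L1_approx:
  assumes u: "strongly_measurable M V N u" and fin: "(\<integral>\<^sup>+t. ennreal (N (u t)) \<partial>M) < \<infinity>"
  obtains s u' where "\<And>n. simple_function M (s n)" "\<And>n. s n ` space M \<subseteq> V"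
    "AE t in M. u t = u' t" "\<And>n. (\<lambda>t. N (\<lambda>x. s n t x - u' t x)) \<in> borel_measurable M"
    "(\<lambda>n. \<integral>\<^sup>+t. ennreal (N (\<lambda>x. s n t x - u t x)) \<partial>M) \<longlonglongrightarrow> 0"
proof -
  obtain s where s: "\<And>n. simple_function M (s n)" "\<And>n. s n ` space M \<subseteq> V"
    and lim: "AE t in M. (\<lambda>n. N (\<lambda>x. s n t x - u t x)) \<longlonglongrightarrow> 0"
    and uV: "AE t in M. u t \<in> V"
    using u by (auto simp: strongly_measurable_def)
  from lim uV have "AE t in M. u t \<in> V \<and> (\<lambda>n. N (\<lambda>x. s n t x - u t x)) \<longlonglongrightarrow> 0"
    by eventually_elim simp
  then obtain Z where Z: "Z \<in> null_sets M" "\<And>t. t \<in> space M \<Longrightarrow> t \<notin> Z \<Longrightarrow> u t \<in> V \<and> (\<lambda>n. N (\<lambda>x. s n t x - u t x)) \<longlonglongrightarrow> 0"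
    by (auto elim!: AE_E3)
  define s' where "s' = (\<lambda>n t. if t \<in> Z then (\<lambda>_. 0) else s n t)"
  define u' where "u' = (\<lambda>t. if t \<in> Z then (\<lambda>_. 0) else u t)"
  have s'V: "s' n t \<in> V" if "t \<in> space M" for n t using s(2)[of n] that by (auto simp: s'_def zero_mem)
  have u'V: "u' t \<in> V" if "t \<in> space M" for t using Z(2) that by (auto simp: u'_def zero_mem)
  have s'simple: "simple_function M (s' n)" for n
    unfolding s'_def using Z(1) by (intro simple_function_If_set s) auto
  have lim': "(\<lambda>n. N (\<lambda>x. s' n t x - u' t x)) \<longlonglongrightarrow> 0" if "t \<in> space M" for t
    using Z(2)[OF that] by (auto simp: s'_def u'_def norm_zero)
  have limN: "(\<lambda>n. N (\<lambda>x. v x - s' n t x)) \<longlonglongrightarrow> N (\<lambda>x. v x - u' t x)" if t: "t \<in> space M" and v: "v \<in> V" for t v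
  proof -
    have "(\<lambda>n. N (\<lambda>x. v x - s' n t x) - N (\<lambda>x. v x - u' t x)) \<longlonglongrightarrow> 0"
    proof (rule Lim_null_comparison[OF _ lim'[OF t]])
      have "\<bar>N (\<lambda>x. v x - s' n t x) - N (\<lambda>x. v x - u' t x)\<bar> \<le> N (\<lambda>x. s' n t x - u' t x)" for n
        using norm_diff_triangle[OF v s'V[OF t, of n] u'V[OF t]] norm_diff_triangle[OF v u'V[OF t] s'V[OF t, of n]]
          norm_minus_commute[OF u'V[OF t] s'V[OF t, of n]] by linarith
      then show "\<forall>\<^sub>F n in sequentially. norm (N (\<lambda>x. v x - s' n t x) - N (\<lambda>x. v x - u' t x)) \<le> N (\<lambda>x. s' n t x - u' t x)"
        by simp
    qed
    then show ?thesis by (simp add: LIM_zero_iff)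
  qed
  have limNu: "(\<lambda>n. N (s' n t)) \<longlonglongrightarrow> N (u' t)" if t: "t \<in> space M" for t
    using limN[OF t zero_mem] norm_scale[OF s'V[OF t], of "-1"] norm_scale[OF u'V[OF t], of "-1"] by simp
  have s'N: "(\<lambda>t. N (s' n t)) \<in> borel_measurable M" for n
    using simple_function_compose[OF s'simple, of N n] by (auto simp: comp_def intro: borel_measurable_simple_function)
  have u'N[measurable]: "(\<lambda>t. N (u' t)) \<in> borel_measurable M"
    by (rule borel_measurable_LIMSEQ_real[OF limNu s'N])
  \<comment> \<open>Where the limit has positive norm the truncation is eventually inactive; where
    its norm is zero every truncated value has norm zero, so the error vanishes.\<close>
  define a where "a = (\<lambda>n t. if N (s' n t) \<le> 2 * N (u' t) then s' n t else (\<lambda>_. 0))"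
  have aV: "a n t \<in> V" if "t \<in> space M" for n t using s'V[OF that] by (auto simp: a_def zero_mem)
  have asimple: "simple_function M (a n)" for n
    unfolding a_def using s'N u'N by (intro simple_function_If s'simple) measurable
  have ale: "N (a n t) \<le> 2 * N (u' t)" for n t
    using norm_nonneg[of "u' t"] by (auto simp: a_def norm_zero)
  have adiff: "N (\<lambda>x. a n t x - u' t x) \<le> 3 * N (u' t)" if "t \<in> space M" for n t
    using norm_triangle_diff[OF aV[OF that] u'V[OF that], of n] ale[of n t] by simp
  have alim: "(\<lambda>n. N (\<lambda>x. a n t x - u' t x)) \<longlonglongrightarrow> 0" if t: "t \<in> space M" for t
  proof (cases "N (u' t) = 0")
    case True
    then have "N (\<lambda>x. a n t x - u' t x) = 0" for n
      using adiff[OF t, of n] norm_nonneg[of "\<lambda>x. a n t x - u' t x"] by simp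
    then show ?thesis by simp
  next
    case False
    then have "N (u' t) < 2 * N (u' t)" using norm_nonneg[of "u' t"] by simp
    from order_tendstoD(2)[OF limNu[OF t] this]
    have "\<forall>\<^sub>F n in sequentially. N (\<lambda>x. s' n t x - u' t x) = N (\<lambda>x. a n t x - u' t x)"
      by eventually_elim (simp add: a_def)
    then show ?thesis by (rule Lim_transform_eventually[OF lim'[OF t]])
  qed
  have ameas: "(\<lambda>t. N (\<lambda>x. a n t x - u' t x)) \<in> borel_measurable M" for n
  proof (rule borel_measurable_LIMSEQ_real)
    show "(\<lambda>m. N (\<lambda>x. a n t x - s' m t x)) \<longlonglongrightarrow> N (\<lambda>x. a n t x - u' t x)" if "t \<in> space M" for t
      by (rule limN[OF that aV[OF that]])
    show "(\<lambda>t. N (\<lambda>x. a n t x - s' m t x)) \<in> borel_measurable M" for m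
      using simple_function_compose[OF simple_function_Pair[OF asimple s'simple], of "\<lambda>p. N (\<lambda>x. fst p x - snd p x)" n m]
      by (auto simp: comp_def intro: borel_measurable_simple_function)
  qed
  have uu': "AE t in M. u t = u' t"
    using AE_not_in[OF Z(1)] by eventually_elim (simp add: u'_def)
  have "(\<lambda>n. \<integral>\<^sup>+t. ennreal (N (\<lambda>x. a n t x - u' t x)) \<partial>M) \<longlonglongrightarrow> (\<integral>\<^sup>+t. 0 \<partial>M)"
  proof (rule nn_integral_dominated_convergence[where w = "\<lambda>t. ennreal (3 * N (u' t))"])
    show "(\<lambda>t. ennreal (N (\<lambda>x. a n t x - u' t x))) \<in> borel_measurable M" for n using ameas by measurable
    have "(\<integral>\<^sup>+t. ennreal (N (u' t)) \<partial>M) = (\<integral>\<^sup>+t. ennreal (N (u t)) \<partial>M)"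
      using uu' by (intro nn_integral_cong_AE) (auto elim: eventually_mono)
    then show "(\<integral>\<^sup>+t. ennreal (3 * N (u' t)) \<partial>M) < \<infinity>"
      using fin by (simp add: ennreal_mult' nn_integral_cmult ennreal_mult_less_top)
    show "AE t in M. ennreal (N (\<lambda>x. a n t x - u' t x)) \<le> ennreal (3 * N (u' t))" for n
      by (intro AE_I2 ennreal_leI adiff)
    show "AE t in M. (\<lambda>n. ennreal (N (\<lambda>x. a n t x - u' t x))) \<longlonglongrightarrow> 0"
      using alim by (intro AE_I2) (auto simp flip: ennreal_0 intro!: tendsto_ennrealI)
  qed auto
  moreover have "(\<integral>\<^sup>+t. ennreal (N (\<lambda>x. a n t x - u' t x)) \<partial>M) = (\<integral>\<^sup>+t. ennreal (N (\<lambda>x. a n t x - u t x)) \<partial>M)" for n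
    using uu' by (intro nn_integral_cong_AE) (auto elim: eventually_mono)
  ultimately show ?thesis using asimple aV uu' ameas by (intro that[of a u']) auto
qed

text \<open>The integrals of simple functions converging in mean form a Cauchy sequence.
  Completeness is a hypothesis of the lemma because it is supplied for \<open>L2\<close> and for
  \<open>H10\<close> by separate arguments.\<close>

lemma has_bochner_integral_in_exists:
  assumes complete: "\<And>f. (\<And>n. f n \<in> V) \<Longrightarrow>
      (\<And>e. e > 0 \<Longrightarrow> \<exists>k. \<forall>m\<ge>k. \<forall>n\<ge>k. N (\<lambda>x. f m x - f n x) < e) \<Longrightarrow>
      \<exists>g\<in>V. (\<lambda>n. N (\<lambda>x. f n x - g x)) \<longlonglongrightarrow> 0"
    and M: "finite_measure M"
    and u: "strongly_measurable M V N u" and fin: "(\<integral>\<^sup>+t. ennreal (N (u t)) \<partial>M) < \<infinity>"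
  shows "\<exists>I. has_bochner_integral_in M V N u I"
proof -
  interpret finite_measure M by fact
  obtain s u' where s: "\<And>n. simple_function M (s n)" "\<And>n. s n ` space M \<subseteq> V"
    and u': "AE t in M. u t = u' t" "\<And>n. (\<lambda>t. N (\<lambda>x. s n t x - u' t x)) \<in> borel_measurable M"
    and lim: "(\<lambda>n. \<integral>\<^sup>+t. ennreal (N (\<lambda>x. s n t x - u t x)) \<partial>M) \<longlonglongrightarrow> 0"
    by (rule strongly_measurable_L1_approx[OF u fin]) blast
  define F where "F = (\<lambda>n x. \<integral>t. s n t x \<partial>M)"
  have FV: "F n \<in> V" for n unfolding F_def using norm_simple_integral_le(1)[OF M s(1) s(2)] .
  have "\<exists>k. \<forall>m\<ge>k. \<forall>n\<ge>k. N (\<lambda>x. F m x - F n x) < e" if e: "e > 0" for e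
  proof -
    from order_tendstoD(2)[OF lim, of "ennreal (e / 2)"] e
    obtain k where k: "\<And>n. n \<ge> k \<Longrightarrow> (\<integral>\<^sup>+t. ennreal (N (\<lambda>x. s n t x - u t x)) \<partial>M) < ennreal (e / 2)"
      by (auto simp: eventually_sequentially)
    have "N (\<lambda>x. F m x - F n x) < e" if "m \<ge> k" "n \<ge> k" for m n
    proof -
      define p where "p = (\<lambda>t x. s m t x - s n t x)"
      have pair: "simple_function M (\<lambda>t. (s m t, s n t))" by (intro simple_function_Pair s)
      have p: "simple_function M p" "p ` space M \<subseteq> V"
        using simple_function_compose[OF pair, of "\<lambda>q x. fst q x - snd q x"] s(2)[of m] s(2)[of n]
        by (auto simp: p_def comp_def intro!: diff_mem)
      have int: "integrable M (\<lambda>t. s i t x)" for i x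
        by (rule integral_simple_function_image(1)[OF M s(1), of "\<lambda>c. c x"])
      have Fp: "(\<lambda>x. F m x - F n x) = (\<lambda>x. \<integral>t. p t x \<partial>M)"
        by (simp add: F_def p_def int)
      have "ennreal (N (\<lambda>x. F m x - F n x)) \<le> ennreal (\<integral>t. N (p t) \<partial>M)"
        unfolding Fp by (rule ennreal_leI) (rule norm_simple_integral_le(2)[OF M p])
      also have "\<dots> = (\<integral>\<^sup>+t. ennreal (N (p t)) \<partial>M)"
        by (rule nn_integral_eq_integral[symmetric])
          (auto intro: integral_simple_function_image(1)[OF M p(1)] simp: norm_nonneg)
      also have "\<dots> \<le> (\<integral>\<^sup>+t. ennreal (N (\<lambda>x. s m t x - u t x)) + ennreal (N (\<lambda>x. s n t x - u t x)) \<partial>M)"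
      proof (rule nn_integral_mono_AE)
        have "AE t in M. u t \<in> V" using u by (simp add: strongly_measurable_def)
        moreover have "AE t in M. t \<in> space M" by simp
        ultimately show "AE t in M. ennreal (N (p t)) \<le> ennreal (N (\<lambda>x. s m t x - u t x)) + ennreal (N (\<lambda>x. s n t x - u t x))"
        proof eventually_elim
          case (elim t)
          then have "s m t \<in> V" "s n t \<in> V" using s(2)[of m] s(2)[of n] by auto
          then have "N (p t) \<le> N (\<lambda>x. s m t x - u t x) + N (\<lambda>x. s n t x - u t x)"
            using norm_diff_triangle[of "s m t" "u t" "s n t"] norm_minus_commute[of "u t" "s n t"] elim
            by (simp add: p_def)
          then show ?case by (simp add: norm_nonneg ennreal_leI flip: ennreal_plus)
        qed
      qed
      \<comment> \<open>Splitting the integral of a sum needs measurable summands, which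
        \<open>u'\<close> provides; the next steps return to \<open>u\<close>.\<close>
      also have "\<dots> = (\<integral>\<^sup>+t. ennreal (N (\<lambda>x. s m t x - u' t x)) + ennreal (N (\<lambda>x. s n t x - u' t x)) \<partial>M)"
        using u'(1) by (intro nn_integral_cong_AE) (auto elim: eventually_mono)
      also have "\<dots> = (\<integral>\<^sup>+t. ennreal (N (\<lambda>x. s m t x - u' t x)) \<partial>M) + (\<integral>\<^sup>+t. ennreal (N (\<lambda>x. s n t x - u' t x)) \<partial>M)"
        using u'(2)[of m] u'(2)[of n] by (intro nn_integral_add) auto
      also have "\<dots> = (\<integral>\<^sup>+t. ennreal (N (\<lambda>x. s m t x - u t x)) \<partial>M) + (\<integral>\<^sup>+t. ennreal (N (\<lambda>x. s n t x - u t x)) \<partial>M)"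
        using u'(1) by (intro arg_cong2[where f = "(+)"] nn_integral_cong_AE) (auto elim: eventually_mono)
      also have "\<dots> < ennreal (e / 2) + ennreal (e / 2)"
        by (intro add_strict_mono k that)
      also have "\<dots> = ennreal e" using e by (simp flip: ennreal_plus)
      finally show ?thesis using norm_nonneg by (simp add: ennreal_less_iff)
    qed
    then show ?thesis by blast
  qed
  from complete[OF FV this] obtain I where "I \<in> V" "(\<lambda>n. N (\<lambda>x. F n x - I x)) \<longlonglongrightarrow> 0"
    by blast
  then have "has_bochner_integral_in M V N u I"
    unfolding has_bochner_integral_in_def F_def
    by (intro conjI exI[of _ s] u allI s lim) (auto simp: less_top[symmetric])
  then show ?thesis by (rule exI[of _ I])
qed

text \<open>The simple approximants evaluate \<open>u\<close> at grid points of ever finer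
  meshes.\<close>

lemma strongly_measurable_continuous:
  fixes u :: "real \<Rightarrow> 'x \<Rightarrow> real"
  assumes uV: "\<And>t. a < t \<Longrightarrow> t < b \<Longrightarrow> u t \<in> V"
    and cont: "\<And>t e. a < t \<Longrightarrow> t < b \<Longrightarrow> e > 0 \<Longrightarrow>
      \<exists>d>0. \<forall>r. a < r \<and> r < b \<and> \<bar>r - t\<bar> < d \<longrightarrow> N (\<lambda>x. u r x - u t x) < e"
  shows "strongly_measurable (lebesgue_on {a<..<b}) V N u"
proof -
  \<comment> \<open>Rounding down to multiples of \<open>1 / Suc n\<close> takes finitely many
    values on a bounded interval.\<close>
  define g :: "nat \<Rightarrow> real \<Rightarrow> real" where "g = (\<lambda>n t. of_int \<lfloor>real (Suc n) * t\<rfloor> / real (Suc n))"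
  \<comment> \<open>A rounded time may fall below \<open>a\<close>; the extension by zero covers the
    finitely many \<open>n\<close> for which it does.\<close>
  define G where "G = (\<lambda>t. if a < t \<and> t < b then u t else (\<lambda>_. 0))"
  have g: "g n t \<le> t" "t - g n t \<le> 1 / Suc n" for n :: nat and t :: real
  proof -
    have "of_int \<lfloor>real (Suc n) * t\<rfloor> / real (Suc n) \<le> real (Suc n) * t / real (Suc n)"
      "(real (Suc n) * t - 1) / real (Suc n) \<le> of_int \<lfloor>real (Suc n) * t\<rfloor> / real (Suc n)"
      by (intro divide_right_mono; linarith)+
    then show "g n t \<le> t" "t - g n t \<le> 1 / Suc n"
      by (simp_all add: g_def diff_divide_distrib del: of_nat_Suc)
  qed
  have "simple_function (lebesgue_on {a<..<b}) (g n)" for n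
  proof (rule simple_function_borel_measurable)
    show "g n \<in> borel_measurable (lebesgue_on {a<..<b})"
      unfolding g_def by (intro measurable_restrict_space1 measurable_completion) measurable
    have "g n ` {a<..<b} \<subseteq> (\<lambda>k. of_int k / Suc n) ` {\<lfloor>real (Suc n) * a\<rfloor>..\<lfloor>real (Suc n) * b\<rfloor>}"
      by (auto simp: g_def intro!: imageI floor_mono mult_left_mono)
    then show "finite (g n ` space (lebesgue_on {a<..<b}))"
      by (simp add: finite_subset)
  qed
  then have "simple_function (lebesgue_on {a<..<b}) (\<lambda>t. G (g n t))" for n
    using simple_function_compose[of "lebesgue_on {a<..<b}" "g n" G] by (simp add: comp_def)
  moreover have "(\<lambda>t. G (g n t)) ` space (lebesgue_on {a<..<b}) \<subseteq> V" for n
    using uV by (auto simp: G_def zero_mem)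
  moreover have "(\<lambda>n. N (\<lambda>x. G (g n t) x - u t x)) \<longlonglongrightarrow> 0" if t: "a < t" "t < b" for t
  proof (rule LIMSEQ_I)
    fix e :: real assume "e > 0"
    then obtain d where d: "d > 0" "\<And>r. a < r \<Longrightarrow> r < b \<Longrightarrow> \<bar>r - t\<bar> < d \<Longrightarrow> N (\<lambda>x. u r x - u t x) < e"
      using cont[OF t] by blast
    have "(\<lambda>n. 1 / Suc n) \<longlonglongrightarrow> (0::real)" by (rule LIMSEQ_Suc[OF lim_1_over_n])
    from order_tendstoD(2)[OF this, of "min d (t - a)"] obtain k where
      k: "\<And>n. n \<ge> k \<Longrightarrow> 1 / Suc n < min d (t - a)" using d t by (auto simp: eventually_sequentially)
    have "norm (N (\<lambda>x. G (g n t) x - u t x) - 0) < e" if "n \<ge> k" for n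
      using k[OF that] g(1)[of n t] g(2)[of t n] t d(2)[of "g n t"] norm_nonneg by (auto simp: G_def)
    then show "\<exists>k. \<forall>n\<ge>k. norm (N (\<lambda>x. G (g n t) x - u t x) - 0) < e" by blast
  qed
  ultimately show ?thesis
    unfolding strongly_measurable_def using uV
    by (intro conjI exI[of _ "\<lambda>n t. G (g n t)"]) (auto intro!: AE_I2)
qed

end

section \<open>Lipschitz continuity from a bounded weak time derivative\<close>

text \<open>Fubini for null sets. Lebesgue measure on the product is the completion of a product
  measure, so the exceptional set is first enlarged to a Borel null set.\<close>

lemma AE_lebesgue_on_Times:
  fixes P :: "'a::euclidean_space \<times> 'b::euclidean_space \<Rightarrow> bool"
  assumes S: "S \<in> sets lebesgue" and A: "A \<in> sets lebesgue" and SA: "S \<times> A \<in> sets lebesgue"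
    and ae: "AE p in lebesgue_on (S \<times> A). P p"
  shows "AE t in lebesgue_on A. AE x in lebesgue_on S. P (x, t)"
proof -
  have "AE p in lborel. p \<in> S \<times> A \<longrightarrow> P p"
    using ae SA by (simp add: AE_restrict_space_iff AE_completion_iff)
  then obtain N where N: "N \<in> null_sets lborel" "\<And>p. p \<notin> N \<Longrightarrow> p \<in> S \<times> A \<longrightarrow> P p"
    by (auto elim!: AE_E3)
  have [measurable]: "N \<in> sets (lborel \<Otimes>\<^sub>M lborel)" and Nn: "N \<in> null_sets (lborel \<Otimes>\<^sub>M lborel)"
    using N(1) unfolding lborel_prod by auto
  have "AE p in lborel \<Otimes>\<^sub>M lborel. p \<notin> N" by (rule AE_not_in[OF Nn])
  then have "AE x in lborel. AE t in lborel. (x, t) \<notin> N"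
    by (rule lborel_pair.AE_pair)
  then have "AE t in lborel. AE x in lborel. (x, t) \<notin> N"
    by (subst (asm) lborel_pair.AE_commute) measurable
  then have "AE t in lborel. t \<in> A \<longrightarrow> (AE x in lborel. x \<in> S \<longrightarrow> P (x, t))"
  proof eventually_elim
    case (elim t)
    then show ?case
      by (auto elim!: eventually_mono dest: N(2))
  qed
  then show ?thesis
    using S A by (simp add: AE_restrict_space_iff AE_completion_iff)
qed

text \<open>Clamping keeps the bounds at every point. A Borel representative has measurable sections
  at every time and measurable time shifts, whereas a Lebesgue measurable function has measurable
  sections only at almost every time.\<close>

lemma borel_version:
  fixes u :: "'a::euclidean_space \<Rightarrow> real"
  assumes A: "A \<in> sets lebesgue" and u: "u \<in> borel_measurable (lebesgue_on A)"
    and bounds: "AE p in lebesgue_on A. lo \<le> u p \<and> u p \<le> hi" and "lo \<le> hi"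
  obtains b where "b \<in> borel_measurable borel" "\<And>p. lo \<le> b p" "\<And>p. b p \<le> hi"
    "AE p in lebesgue_on A. u p = b p"
proof -
  have "(\<lambda>x. if x \<in> A then u x else 0) \<in> borel_measurable lebesgue"
    using u A by (simp add: borel_measurable_if_I)
  from completion_ex_borel_measurable_real[OF this]
  obtain c where c: "c \<in> borel_measurable lborel" "AE x in lborel. (if x \<in> A then u x else 0) = c x"
    by auto
  have "AE x in lebesgue_on A. u x = c x"
    using c(2) A by (auto simp: AE_restrict_space_iff AE_completion_iff elim: eventually_mono)
  then have "AE x in lebesgue_on A. u x = max lo (min hi (c x))"
    using bounds by eventually_elim auto
  then show ?thesis
    using c(1) \<open>lo \<le> hi\<close> by (intro that[of "\<lambda>x. max lo (min hi (c x))"]) auto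
qed

lemma integrable_bounded_compact_support:
  fixes f :: "'a::euclidean_space \<Rightarrow> real"
  assumes f: "f \<in> borel_measurable borel" and B: "\<And>x. \<bar>f x\<bar> \<le> B"
    and K: "compact K" "\<And>x. x \<notin> K \<Longrightarrow> f x = 0"
  shows "integrable lborel f"
proof (rule Bochner_Integration.integrable_bound[where f = "\<lambda>x. B * indicator K x"])
  show "integrable lborel (\<lambda>x. B * indicator K x)"
    using compact_imp_bounded[OF K(1)] compact_imp_closed[OF K(1)] emeasure_bounded_finite[of K]
    by (intro integrable_mult_right integrable_real_indicator) auto
  have "\<bar>f x\<bar> \<le> \<bar>B * indicator K x\<bar>" for x
    using B[of x] K(2)[of x] by (cases "x \<in> K") auto
  then show "AE x in lborel. norm (f x) \<le> norm (B * indicator K x)" by simp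
qed (use f in simp)

lemma integral_lebesgue_on_compact_support:
  fixes f :: "'a::euclidean_space \<Rightarrow> real"
  assumes f: "f \<in> borel_measurable borel" and A: "A \<in> sets lebesgue" and 0: "\<And>x. x \<notin> A \<Longrightarrow> f x = 0"
  shows "(\<integral>x. f x \<partial>lebesgue_on A) = (\<integral>x. f x \<partial>lborel)"
proof -
  have "(\<integral>x. f x \<partial>lebesgue_on A) = (\<integral>x. (if x \<in> A then f x else 0) \<partial>lebesgue)"
    using A by (simp add: Lebesgue_Measure.integral_restrict_UNIV)
  also have "(\<lambda>x. if x \<in> A then f x else 0) = f" using 0 by (intro ext) auto
  finally show ?thesis using f by (simp add: integral_completion)
qed

lemma integral_lborel_shift:
  fixes f :: "'a::euclidean_space \<Rightarrow> real"
  shows "(\<integral>x. f (x + c) \<partial>lborel) = (\<integral>x. f x \<partial>lborel)"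
proof (cases "f \<in> borel_measurable borel")
  case True
  have "(\<integral>x. f (c + x) \<partial>lborel) = (\<integral>x. f x \<partial>distr lborel borel ((+) c))"
    using True by (subst integral_distr) auto
  then show ?thesis by (simp only: lborel_distr_plus add.commute)
next
  case False
  have "\<not> (\<lambda>x. f (x + c)) \<in> borel_measurable borel"
  proof
    assume "(\<lambda>x. f (x + c)) \<in> borel_measurable borel"
    then have "(\<lambda>x. f (x + c)) \<circ> (\<lambda>x. x - c) \<in> borel_measurable borel"
      by (intro measurable_comp[where N = borel]) auto
    with False show False by (simp add: comp_def)
  qed
  \<comment> \<open>Without measurability both integrals take the default value
    \<open>0\<close>.\<close>
  then have "\<not> integrable lborel (\<lambda>x. f (x + c))" "\<not> integrable lborel f"
    using False borel_measurable_integrable by force+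
  then show ?thesis by (simp add: not_integrable_integral_eq)
qed

lemma bump_Pair:
  fixes a c x :: "'a::euclidean_space"
  shows "bump e (a, a') (c, c') (x, t) = bump e a c x * bump e a' c' (t::'b::euclidean_space)"
  unfolding bump_def Basis_prod_def
  by (subst prod.union_disjoint) (auto simp: prod.reindex inj_on_def)

text \<open>The test function is the time primitive of \<open>B (x, t) - B (x, t - h)\<close>, so that testing with it
  turns the weak time derivative into a difference quotient.\<close>
lemma weak_time_derivative_shift:
  fixes b :: "'a::euclidean_space \<times> real \<Rightarrow> real"
  assumes S: "open S" and T: "0 < h"
    and b: "b \<in> borel_measurable borel" "\<And>p. \<bar>b p\<bar> \<le> C"
    and d: "d \<in> borel_measurable borel" "\<And>p. \<bar>d p\<bar> \<le> L"
    and wp: "weak_partial (S \<times> {0<..<T}) (0, 1) b d"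
    and e: "e > 0" and sub: "cbox a c \<subseteq> S \<times> {0<..<T - h}"
  shows "\<bar>\<integral>p. (b (p + (0, h)) - b p) * bump e a c p \<partial>lborel\<bar> \<le> L * h * (\<integral>p. bump e a c p \<partial>lborel)"
proof (cases "cbox a c = {}")
  case True
  then have "bump e a c p = 0" for p
    using box_subset_cbox[of a c] by (auto simp: bump_eq_0_iff)
  then show ?thesis by simp
next
  case False
  obtain a1 a2 c1 c2 where ac: "a = (a1, a2)" "c = (c1, c2)" by (metis surj_pair)
  have ne: "cbox a1 c1 \<noteq> {}" "a2 \<le> c2" using False by (auto simp: ac cbox_Pair_eq)
  then have in1: "cbox a1 c1 \<subseteq> S" and in2: "0 < a2" "c2 < T - h"
    using sub by (auto simp: ac cbox_Pair_eq subset_iff)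
  \<comment> \<open>Unlike the primitive itself, the difference of two translates returns to zero,
    so it has compact support in \<open>{a2..c2 + h}\<close>. It is nonnegative by monotonicity of
    the primitive.\<close>
  define \<psi> where "\<psi> = (\<lambda>t. bump_prim e a2 c2 t - bump_prim e a2 c2 (t - h))"
  define \<Psi> where "\<Psi> = (\<lambda>p::'a \<times> real. bump e a1 c1 (fst p) * \<psi> (snd p))"
  define B where "B = bump e a c"
  define K where "K = cbox a1 c1 \<times> {a2..c2 + h}"
  have K: "compact K" "K \<subseteq> S \<times> {0<..<T}"
    using in1 in2 T by (auto simp: K_def intro: compact_Times)
  have KnotA: "p \<notin> K" if "p \<notin> S \<times> {0<..<T}" for p using K(2) that by blast
  have \<psi>0: "\<psi> t = 0" if "t \<notin> {a2..c2 + h}" for t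
    using that T e bump_prim_eq_0[of t a2 e c2] bump_prim_eq_0[of "t - h" a2 e c2]
      bump_prim_const[OF e, of c2 t a2] bump_prim_const[OF e, of c2 "t - h" a2] by (auto simp: \<psi>_def)
  have \<psi>nn: "0 \<le> \<psi> t" for t
    using bump_prim_mono[OF e, of "t - h" t a2 c2] T by (simp add: \<psi>_def)
  have \<Psi>nn: "0 \<le> \<Psi> p" for p unfolding \<Psi>_def by (intro mult_nonneg_nonneg \<psi>nn bump_nonneg)
  have B0: "B p = 0" if "p \<notin> K" for p
    using that T box_subset_cbox[of a1 c1] by (cases p) (auto simp: B_def K_def ac bump_Pair bump_eq_0_iff)
  have Bh0: "B (p - (0, h)) = 0" if "p \<notin> K" for p
    using that T box_subset_cbox[of a1 c1] by (cases p) (auto simp: B_def K_def ac bump_Pair bump_eq_0_iff)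
  have \<Psi>test: "\<Psi> \<in> test_functions (S \<times> {0<..<T})"
  proof (rule test_functionsI[OF _ _ K])
    fix k
    have 1: "Ck k (\<lambda>p::'a \<times> real. bump e a1 c1 (fst p))"
      unfolding bump_def
    proof (rule Ck_prod)
      fix i :: 'a assume "i \<in> Basis"
      have "Ck k (\<lambda>p::'a \<times> real. bump1 e (a1 \<bullet> i) (c1 \<bullet> i) (p \<bullet> (i, 0)))"
        by (rule Ck_compose_inner[OF Ck_bump1[OF e]])
      then show "Ck k (\<lambda>p::'a \<times> real. bump1 e (a1 \<bullet> i) (c1 \<bullet> i) (fst p \<bullet> i))"
        by (simp add: inner_prod_def)
    qed
    have 2: "Ck k (\<lambda>p::'a \<times> real. \<psi> (snd p))"
    proof -
      have "Ck k (\<lambda>p::'a \<times> real. bump_prim e a2 c2 (1 * (p \<bullet> (0, 1)) + 0)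
          + - 1 * bump_prim e a2 c2 (1 * (p \<bullet> (0, 1)) + - h))"
        by (intro Ck_add Ck_mult Ck_const Ck_compose_affine Ck_bump_prim e)
      then show ?thesis by (simp add: \<psi>_def inner_prod_def)
    qed
    show "Ck k \<Psi>" unfolding \<Psi>_def using 1 2 by (rule Ck_mult)
  next
    fix p assume "p \<notin> K"
    then show "\<Psi> p = 0"
      using \<psi>0 box_subset_cbox[of a1 c1] by (cases p) (auto simp: K_def \<Psi>_def bump_eq_0_iff)
  qed
  have dline: "((\<lambda>s. \<Psi> (s *\<^sub>R (0, 1) + p)) has_real_derivative B p - B (p - (0, h))) (at 0)" for p
  proof -
    obtain x t where p: "p = (x, t)" by (cases p)
    have P: "((\<lambda>s. bump_prim e a2 c2 (s + u)) has_real_derivative bump1 e a2 c2 (0 + u)) (at 0)" for u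
      by (rule DERIV_shift[THEN iffD1, OF has_real_derivative_bump_prim[OF e]])
    have "((\<lambda>s. bump e a1 c1 x * (bump_prim e a2 c2 (s + t) - bump_prim e a2 c2 (s + (t - h)))) has_real_derivative
        bump e a1 c1 x * (bump1 e a2 c2 (0 + t) - bump1 e a2 c2 (0 + (t - h)))) (at 0)"
      by (intro DERIV_cmult DERIV_diff P)
    then show ?thesis
      by (simp add: p \<Psi>_def \<psi>_def B_def ac bump_Pair right_diff_distrib add_diff_eq)
        (simp add: bump_def right_diff_distrib)
  qed
  have d\<Psi>: "frechet_derivative \<Psi> (at p) (0, 1) = B p - B (p - (0, h))" for p
    using DERIV_unique[OF test_function_line_derivative[OF \<Psi>test, of "(0, 1)" p 0]] dline[of p]
    by (simp flip: zero_prod_def)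
  have basis: "(0, 1) \<in> (Basis :: ('a \<times> real) set)" by (simp add: Basis_prod_def)
  have SA: "S \<times> {0<..<T} \<in> sets lebesgue" using S by (simp add: open_Times)
  have Bm [measurable]: "B \<in> borel_measurable borel"
    unfolding B_def using Ck_bump[OF e, of 0] by (intro borel_measurable_continuous_onI) simp
  have \<Psi>m [measurable]: "\<Psi> \<in> borel_measurable borel"
    by (rule borel_measurable_continuous_onI[OF test_function_continuous[OF \<Psi>test]])
  note [measurable] = b(1) d(1)
  obtain D where D: "D > 0" "\<And>p. \<bar>\<Psi> p\<bar> \<le> D" using test_function_bounded[OF \<Psi>test] by metis
  have B1: "\<bar>B p\<bar> \<le> 1" for p using bump_nonneg[of e a c p] bump_le_1[of e a c p] e by (simp add: B_def)
  obtain R where R: "\<And>p. p \<in> K \<Longrightarrow> \<bar>snd p\<bar> \<le> R"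
    using in2 T by (intro that[of T]) (auto simp: K_def)
  have \<Psi>0: "\<Psi> p = 0" if "p \<notin> K" for p
    using that \<psi>0 box_subset_cbox[of a1 c1] by (cases p) (auto simp: K_def \<Psi>_def bump_eq_0_iff)
  \<comment> \<open>The first factor is bounded only on \<open>K\<close> because one application has
    the unbounded function \<open>snd p\<close> in its place.\<close>
  have ib: "integrable lborel (\<lambda>p. f p * g p)"
    if "f \<in> borel_measurable borel" "g \<in> borel_measurable borel" "\<And>p. p \<in> K \<Longrightarrow> \<bar>f p\<bar> \<le> F" "\<And>p. \<bar>g p\<bar> \<le> G"
      "\<And>p. p \<notin> K \<Longrightarrow> g p = 0" "0 \<le> F" "0 \<le> G" for f g :: "'a \<times> real \<Rightarrow> real" and F G
  proof (rule integrable_bounded_compact_support[where B = "F * G", OF _ _ K(1)])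
    show "\<bar>f p * g p\<bar> \<le> F * G" for p
      using that(3)[of p] that(4)[of p] that(5)[of p] that(6,7)
      by (cases "p \<in> K") (auto simp: abs_mult intro!: mult_mono)
  qed (use that in auto)
  have Bh1: "\<bar>B (p - (0, h))\<bar> \<le> 1" for p using B1 .
  have mh: "(\<lambda>p. B (p - (0, h))) \<in> borel_measurable borel" by measurable
  have C0: "0 \<le> C" using b(2)[of undefined] by linarith
  have L0: "0 \<le> L" using d(2)[of undefined] by linarith
  have R0: "0 \<le> max R 0" by simp
  have ms: "(\<lambda>p::'a \<times> real. snd p) \<in> borel_measurable borel" by (simp add: borel_measurable_continuous_onI continuous_on_snd)
  have Rm: "\<And>p. p \<in> K \<Longrightarrow> \<bar>snd p\<bar> \<le> max R 0" using R by fastforce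
  text \<open>Integrating \<open>t \<Psi>\<close> by parts in time.\<close>
  have mass: "(\<integral>p. \<Psi> p \<partial>lborel) = h * (\<integral>p. B p \<partial>lborel)"
  proof -
    let ?\<Xi> = "\<lambda>p::'a \<times> real. \<Psi> p * (p \<bullet> (0, 1))"
    have "?\<Xi> \<in> test_functions UNIV"
    proof (rule test_functionsI[OF _ _ K(1)])
      have "Ck k \<Psi>" for k using \<Psi>test by (auto simp: test_functions_def)
      moreover have "Ck k (\<lambda>x::real. x)" for k
      proof (cases k)
        case (Suc k)
        then show ?thesis using Ck_SucI_real[of "\<lambda>x. x" "\<lambda>_. 1" k] Ck_const by auto
      qed simp
      ultimately show "Ck k ?\<Xi>" for k by (intro Ck_mult Ck_compose_inner)
    qed (auto simp: \<Psi>0)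
    from integral_test_function_derivative[OF this basis]
    have "(\<integral>p. frechet_derivative ?\<Xi> (at p) (0, 1) \<partial>lborel) = 0" .
    moreover have "frechet_derivative ?\<Xi> (at p) (0, 1) = \<Psi> p + (snd p * B p - snd p * B (p - (0, h)))" for p
    proof -
      have "(?\<Xi> has_derivative (\<lambda>v. \<Psi> p * (v \<bullet> (0, 1)) + frechet_derivative \<Psi> (at p) v * (p \<bullet> (0, 1)))) (at p)"
        by (intro has_derivative_mult test_function_has_derivative[OF \<Psi>test] has_derivative_inner_left has_derivative_ident)
      from fun_cong[OF frechet_derivative_at[OF this], of "(0, 1)"] show ?thesis
        by (simp add: d\<Psi> inner_prod_def right_diff_distrib mult.commute)
    qed
    ultimately have "0 = (\<integral>p. \<Psi> p + (snd p * B p - snd p * B (p - (0, h))) \<partial>lborel)" by simp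
    also have "\<dots> = (\<integral>p. \<Psi> p \<partial>lborel) + ((\<integral>p. snd p * B p \<partial>lborel) - (\<integral>p. snd p * B (p - (0, h)) \<partial>lborel))"
    proof -
      have "integrable lborel \<Psi>" by (rule integrable_bounded_compact_support[OF \<Psi>m D(2) K(1) \<Psi>0])
      moreover have "integrable lborel (\<lambda>p. snd p * B p)"
        by (rule ib[OF ms Bm Rm B1 B0 R0]) auto
      moreover have "integrable lborel (\<lambda>p. snd p * B (p - (0, h)))"
        by (rule ib[OF ms mh Rm Bh1 Bh0 R0]) auto
      ultimately show ?thesis by simp
    qed
    also have "(\<integral>p. snd p * B (p - (0, h)) \<partial>lborel) = (\<integral>p. (snd p + h) * B p \<partial>lborel)"
      using integral_lborel_shift[of "\<lambda>p. snd p * B (p - (0, h))" "(0, h)"] by simp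
    also have "\<dots> = (\<integral>p. snd p * B p \<partial>lborel) + h * (\<integral>p. B p \<partial>lborel)"
    proof -
      have "integrable lborel (\<lambda>p. snd p * B p)"
        by (rule ib[OF ms Bm Rm B1 B0 R0]) auto
      moreover have "integrable lborel B" by (rule integrable_bounded_compact_support[OF Bm B1 K(1) B0])
      ultimately show ?thesis by (simp add: distrib_right)
    qed
    finally show ?thesis by simp
  qed
  have z1: "b p * (B p - B (p - (0, h))) = 0" and z2: "d p * \<Psi> p = 0" if "p \<notin> S \<times> {0<..<T}" for p
    using B0[OF KnotA[OF that]] Bh0[OF KnotA[OF that]] \<Psi>0[OF KnotA[OF that]] by simp_all
  \<comment> \<open>Translation invariance moves the time shift from \<open>b\<close> to the bump
    and reverses its sign.\<close>
  have "(\<integral>p. (b (p + (0, h)) - b p) * B p \<partial>lborel) = - (\<integral>p. b p * (B p - B (p - (0, h))) \<partial>lborel)"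
  proof -
    have i1: "integrable lborel (\<lambda>p. b p * B p)"
      by (rule ib[OF b(1) Bm b(2) B1 B0 C0]) auto
    have i2: "integrable lborel (\<lambda>p. b p * B (p - (0, h)))"
      by (rule ib[OF b(1) mh b(2) Bh1 Bh0 C0]) auto
    have i3: "integrable lborel (\<lambda>p. b (p + (0, h)) * B p)"
      by (rule ib[OF _ Bm b(2) B1 B0 C0]) auto
    have "(\<integral>p. b p * B (p - (0, h)) \<partial>lborel) = (\<integral>p. b (p + (0, h)) * B p \<partial>lborel)"
      using integral_lborel_shift[of "\<lambda>p. b p * B (p - (0, h))" "(0, h)"] by simp
    then show ?thesis using i1 i2 i3 by (simp add: left_diff_distrib right_diff_distrib)
  qed
  also have "(\<integral>p. b p * (B p - B (p - (0, h))) \<partial>lborel) = (\<integral>p. b p * (B p - B (p - (0, h))) \<partial>lebesgue_on (S \<times> {0<..<T}))"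
    by (rule integral_lebesgue_on_compact_support[symmetric, OF borel_measurable_times[OF b(1) borel_measurable_diff[OF Bm mh]] SA z1])
  also have "\<dots> = - (\<integral>p. d p * \<Psi> p \<partial>lebesgue_on (S \<times> {0<..<T}))"
    using bspec[OF wp[unfolded weak_partial_def] \<Psi>test] by (simp only: d\<Psi>)
  also have "(\<integral>p. d p * \<Psi> p \<partial>lebesgue_on (S \<times> {0<..<T})) = (\<integral>p. d p * \<Psi> p \<partial>lborel)"
    by (rule integral_lebesgue_on_compact_support[OF borel_measurable_times[OF d(1) \<Psi>m] SA z2])
  finally have "\<bar>\<integral>p. (b (p + (0, h)) - b p) * B p \<partial>lborel\<bar> = \<bar>\<integral>p. d p * \<Psi> p \<partial>lborel\<bar>" by simp
  also have "\<dots> \<le> (\<integral>p. \<bar>d p * \<Psi> p\<bar> \<partial>lborel)" by (rule integral_abs_bound)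
  also have "\<dots> \<le> (\<integral>p. L * \<Psi> p \<partial>lborel)"
  proof (rule integral_mono)
    show "integrable lborel (\<lambda>p. \<bar>d p * \<Psi> p\<bar>)"
      by (intro integrable_abs ib[OF d(1) \<Psi>m d(2) D(2) \<Psi>0 L0]) (use D in auto)
    show "integrable lborel (\<lambda>p. L * \<Psi> p)"
      by (intro integrable_mult_right integrable_bounded_compact_support[OF \<Psi>m D(2) K(1) \<Psi>0])
    show "\<bar>d p * \<Psi> p\<bar> \<le> L * \<Psi> p" for p
      using d(2)[of p] \<Psi>nn[of p] by (simp add: abs_mult mult_right_mono)
  qed
  also have "\<dots> = L * h * (\<integral>p. B p \<partial>lborel)" by (simp add: mass)
  finally show ?thesis by (simp add: B_def)
qed

text \<open>The fundamental lemma is applied to \<open>L h\<close> minus and plus the increment of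
  \<open>b\<close>, with nonnegativity against bumps from the preceding estimate. The exceptional
  null set may depend on \<open>h\<close>.\<close>

lemma AE_Lipschitz_in_time:
  fixes b :: "'a::euclidean_space \<times> real \<Rightarrow> real"
  assumes S: "open S" "bounded S" and T: "0 < h"
    and b: "b \<in> borel_measurable borel" "\<And>p. \<bar>b p\<bar> \<le> C"
    and d: "d \<in> borel_measurable borel" "\<And>p. \<bar>d p\<bar> \<le> L"
    and wp: "weak_partial (S \<times> {0<..<T}) (0, 1) b d"
  shows "AE p in lebesgue_on (S \<times> {0<..<T - h}). \<bar>b (p + (0, h)) - b p\<bar> \<le> L * h"
proof -
  let ?U = "S \<times> {0<..<T - h}"
  have U: "open ?U" "bounded ?U" using S by (auto intro: open_Times bounded_Times)
  interpret U: bounded_open ?U using U by unfold_locales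
  note [measurable] = b(1)
  have "AE p in lebesgue_on ?U. 0 \<le> L * h - s * (b (p + (0, h)) - b p)" if s: "\<bar>s\<bar> = 1" for s :: real
  proof (rule AE_nonneg_if_bump_integrals_nonneg[OF U(1)])
    let ?g = "\<lambda>p. L * h - s * (b (p + (0, h)) - b p)"
    have gm: "?g \<in> borel_measurable borel" by measurable
    have gb: "\<bar>?g p\<bar> \<le> \<bar>L * h\<bar> + 2 * C" for p
      using b(2)[of p] b(2)[of "p + (0, h)"] s by (auto simp: abs_if split: if_splits)
    show "integrable (lebesgue_on ?U) ?g"
      by (intro U.L2_imp_integrable(1) U.bounded_imp_L2[OF _ gb] measurable_restrict_space1 measurable_completion)
        (use gm in simp)
    fix e a c assume e: "(e::real) > 0" and sub: "cbox a c \<subseteq> ?U"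
    have Bm [measurable]: "bump e a c \<in> borel_measurable borel"
      using Ck_bump[OF e, of 0] by (intro borel_measurable_continuous_onI) simp
    have B0: "bump e a c p = 0" if "p \<notin> cbox a c" for p
      using that box_subset_cbox[of a c] by (auto simp: bump_eq_0_iff)
    have B1: "\<bar>bump e a c p\<bar> \<le> 1" for p using bump_nonneg[of e a c p] bump_le_1[of e a c p] e by simp
    have i1: "integrable lborel (bump e a c)"
      by (rule integrable_bounded_compact_support[OF Bm B1 compact_cbox B0])
    have i2: "integrable lborel (\<lambda>p. (b (p + (0, h)) - b p) * bump e a c p)"
    proof (rule integrable_bounded_compact_support[where B = "2 * C", OF _ _ compact_cbox])
      show "\<bar>(b (p + (0, h)) - b p) * bump e a c p\<bar> \<le> 2 * C" for p
        using mult_mono[of "\<bar>b (p + (0, h)) - b p\<bar>" "2 * C" "\<bar>bump e a c p\<bar>" 1] B1[of p] b(2)[of p] b(2)[of "p + (0, h)"]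
        by (simp add: abs_mult)
    qed (use B0 in auto)
    have "(\<integral>p. ?g p * bump e a c p \<partial>lebesgue_on ?U) = (\<integral>p. ?g p * bump e a c p \<partial>lborel)"
      using B0 sub by (intro integral_lebesgue_on_compact_support U.S_lebesgue) (measurable, auto)
    also have "\<dots> = (\<integral>p. L * h * bump e a c p - s * ((b (p + (0, h)) - b p) * bump e a c p) \<partial>lborel)"
      by (simp add: algebra_simps)
    also have "\<dots> = L * h * (\<integral>p. bump e a c p \<partial>lborel) - s * (\<integral>p. (b (p + (0, h)) - b p) * bump e a c p \<partial>lborel)"
      using i1 i2 by (subst Bochner_Integration.integral_diff) auto
    also have "\<dots> \<ge> 0"
      using weak_time_derivative_shift[OF S(1) T b d wp e sub] s
      by (auto simp: abs_if split: if_splits)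
    finally show "0 \<le> (\<integral>p. ?g p * bump e a c p \<partial>lebesgue_on ?U)" .
  qed
  from this[of 1] this[of "-1"]
  have "AE p in lebesgue_on ?U. 0 \<le> L * h - 1 * (b (p + (0, h)) - b p)"
    "AE p in lebesgue_on ?U. 0 \<le> L * h - (- 1) * (b (p + (0, h)) - b p)" by simp_all
  then show ?thesis by eventually_elim (simp add: abs_le_iff)
qed

lemma abs_integral_le:
  fixes f :: "real \<Rightarrow> real"
  assumes "f integrable_on {a..b}" "a \<le> b" "0 \<le> c" "\<And>x. x \<in> {a..b} \<Longrightarrow> \<bar>f x\<bar> \<le> c"
  shows "\<bar>integral {a..b} f\<bar> \<le> c * (b - a)"
  using has_integral_bound[of c f _ a b] integrable_integral[OF assms(1)] assms by simp

lemma AE_lebesgue_on_subset: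
  assumes "AE x in lebesgue_on B. P x" "A \<subseteq> B" "A \<in> sets lebesgue" "B \<in> sets lebesgue"
  shows "AE x in lebesgue_on A. P x"
  using assms by (auto simp: AE_restrict_space_iff elim: eventually_mono)

text \<open>Monotonicity is taken from the Lebesgue integral over the open interval, where an
  exceptional null set is harmless.\<close>

lemma integral_le_AE:
  fixes f g :: "real \<Rightarrow> real"
  assumes f: "f absolutely_integrable_on {s..t}" and g: "g absolutely_integrable_on {s..t}"
    and le: "AE x in lebesgue_on {s<..<t}. f x \<le> g x"
  shows "integral {s..t} f \<le> integral {s..t} g"
proof -
  have *: "integrable (lebesgue_on {s<..<t}) k" "(\<integral>x. k x \<partial>lebesgue_on {s<..<t}) = integral {s..t} k"
    if "k absolutely_integrable_on {s..t}" for k :: "real \<Rightarrow> real"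
  proof -
    have k: "k absolutely_integrable_on {s<..<t}"
      using that by (rule set_integrable_subset) auto
    then show i: "integrable (lebesgue_on {s<..<t}) k"
      by (simp add: integrable_restrict_space set_integrable_def)
    show "(\<integral>x. k x \<partial>lebesgue_on {s<..<t}) = integral {s..t} k"
      using lebesgue_integral_eq_integral[OF i] by (simp add: integral_open_interval_real)
  qed
  show ?thesis
    using integral_mono_AE[OF *(1)[OF f] *(1)[OF g] le] by (simp add: *(2)[OF f] *(2)[OF g])
qed

section \<open>Time averages of the elliptic form\<close>

text \<open>\<open>b\<close> stands for a Borel representative of \<beta>, bounded at every point.
  Only its Lipschitz bound in time carries a null set, one for each step \<open>h\<close>, since it
  comes from a weak derivative.\<close>

locale coefficient = bounded_open S for S :: "'a::euclidean_space set" +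
  fixes b :: "'a \<times> real \<Rightarrow> real" and lo hi L T :: real
  assumes b_measurable [measurable]: "b \<in> borel_measurable borel"
    and b_bounds: "lo \<le> b p" "b p \<le> hi" and lo: "0 \<le> lo" and L: "0 \<le> L"
    and b_Lipschitz: "0 < h \<Longrightarrow> AE p in lebesgue_on (S \<times> {0<..<T - h}). \<bar>b (p + (0, h)) - b p\<bar> \<le> L * h"
begin

lemma hi: "0 \<le> hi" using b_bounds[of undefined] lo by simp

lemma b_abs: "\<bar>b p\<bar> \<le> hi" using b_bounds[of p] lo by simp

text \<open>Both fields are frozen, so time enters through the coefficient alone and its Lipschitz
  bound carries over.\<close>

definition form :: "('a \<Rightarrow> 'b::euclidean_space) \<Rightarrow> ('a \<Rightarrow> 'b) \<Rightarrow> real \<Rightarrow> real" where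
  "form \<xi> \<zeta> t = L2_inner S (\<lambda>x. b (x, t) *\<^sub>R \<xi> x) \<zeta>"

lemma section_measurable: "(\<lambda>x. b (x, t)) \<in> borel_measurable M"
  by (intro measurable_restrict_space1 measurable_completion) measurable

lemma b_mult:
  assumes "\<xi> \<in> L2 S"
  shows "(\<lambda>x. b (x, t) *\<^sub>R \<xi> x) \<in> L2 S" "L2_norm S (\<lambda>x. b (x, t) *\<^sub>R \<xi> x) \<le> hi * L2_norm S \<xi>"
  using L2_bounded_mult[OF section_measurable, of t hi \<xi>] assms b_abs hi by auto

lemma form_bound:
  assumes "\<xi> \<in> L2 S" "\<zeta> \<in> L2 S"
  shows "\<bar>form \<xi> \<zeta> t\<bar> \<le> hi * L2_norm S \<xi> * L2_norm S \<zeta>"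
  unfolding form_def
  by (rule order_trans[OF L2_Cauchy_Schwarz[OF b_mult(1)[OF assms(1)] assms(2)]])
    (intro mult_right_mono b_mult assms, simp)

lemma form_commute: "form \<xi> \<zeta> t = form \<zeta> \<xi> t"
  by (simp add: form_def L2_inner_def inner_commute)

lemma form_diff_right:
  assumes "\<xi> \<in> L2 S" "\<zeta> \<in> L2 S" "\<zeta>' \<in> L2 S"
  shows "form \<xi> (\<lambda>x. \<zeta> x - \<zeta>' x) t = form \<xi> \<zeta> t - form \<xi> \<zeta>' t"
  using assms b_mult(1)[OF assms(1), of t] by (simp add: form_def L2_inner_diff_right)

lemma form_coercive:
  assumes "\<xi> \<in> L2 S"
  shows "lo * (L2_norm S \<xi>)\<^sup>2 \<le> form \<xi> \<xi> t"
proof -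
  have "lo * (L2_norm S \<xi>)\<^sup>2 = (\<integral>x. lo * (\<xi> x \<bullet> \<xi> x) \<partial>M)"
    by (simp add: L2_norm_square L2_inner_def)
  also have "\<dots> \<le> (\<integral>x. b (x, t) *\<^sub>R \<xi> x \<bullet> \<xi> x \<partial>M)"
    using L2_inner_integrable[OF assms assms] L2_inner_integrable[OF b_mult(1)[OF assms] assms]
    by (intro integral_mono) (auto intro!: mult_right_mono b_bounds)
  finally show ?thesis by (simp add: form_def L2_inner_def)
qed

text \<open>Once the scalar product of the two fields has been replaced by a Borel function
  \<open>k\<close>, this is measurability of a parameter integral over
  \<open>lborel\<close>.\<close>

lemma form_measurable:
  assumes "\<xi> \<in> L2 S" "\<zeta> \<in> L2 S"
  shows "form \<xi> \<zeta> \<in> borel_measurable borel"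
proof -
  have "integrable M (\<lambda>x. \<xi> x \<bullet> \<zeta> x)" using assms by (rule L2_inner_integrable)
  then have "(\<lambda>x. if x \<in> S then \<xi> x \<bullet> \<zeta> x else 0) \<in> borel_measurable lebesgue"
    by (intro borel_measurable_if_I) auto
  from completion_ex_borel_measurable_real[OF this] obtain k where
    k: "k \<in> borel_measurable lborel" "AE x in lborel. (if x \<in> S then \<xi> x \<bullet> \<zeta> x else 0) = k x"
    by auto
  then have [measurable]: "k \<in> borel_measurable borel" by simp
  have "form \<xi> \<zeta> t = (\<integral>x. b (x, t) * k x \<partial>lborel)" for t
  proof -
    have "form \<xi> \<zeta> t = (\<integral>x. (if x \<in> S then b (x, t) * (\<xi> x \<bullet> \<zeta> x) else 0) \<partial>lebesgue)"
      unfolding form_def L2_inner_def by (subst Lebesgue_Measure.integral_restrict_UNIV) auto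
    also have "\<dots> = (\<integral>x. b (x, t) * k x \<partial>lebesgue)"
    proof (rule integral_cong_AE)
      have "(\<lambda>x. b (x, t) * (if x \<in> S then \<xi> x \<bullet> \<zeta> x else 0)) \<in> borel_measurable lebesgue"
        by (intro borel_measurable_times \<open>(\<lambda>x. if x \<in> S then \<xi> x \<bullet> \<zeta> x else 0) \<in> borel_measurable lebesgue\<close>
          measurable_completion) measurable
      then show "(\<lambda>x. if x \<in> S then b (x, t) * (\<xi> x \<bullet> \<zeta> x) else 0) \<in> borel_measurable lebesgue"
        by (rule back_subst[of "\<lambda>f. f \<in> borel_measurable lebesgue"]) auto
      show "(\<lambda>x. b (x, t) * k x) \<in> borel_measurable lebesgue"
        by (intro measurable_completion) measurable
      show "AE x in lebesgue. (if x \<in> S then b (x, t) * (\<xi> x \<bullet> \<zeta> x) else 0) = b (x, t) * k x"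
        using k(2) by (auto simp: AE_completion_iff elim!: eventually_mono)
    qed
    also have "\<dots> = (\<integral>x. b (x, t) * k x \<partial>lborel)"
      by (rule integral_completion) measurable
    finally show ?thesis .
  qed
  then have "form \<xi> \<zeta> = (\<lambda>t. \<integral>x. b (x, t) * k x \<partial>lborel)" by auto
  then show ?thesis by simp
qed

lemma form_Lipschitz:
  assumes \<xi>: "\<xi> \<in> L2 S" and \<zeta>: "\<zeta> \<in> L2 S" and h: "0 < h"
  shows "AE t in lebesgue_on {0<..<T - h}. \<bar>form \<xi> \<zeta> (t + h) - form \<xi> \<zeta> t\<bar> \<le> L * h * L2_norm S \<xi> * L2_norm S \<zeta>"
proof -
  have "AE t in lebesgue_on {0<..<T - h}. AE x in M. \<bar>b ((x, t) + (0, h)) - b (x, t)\<bar> \<le> L * h"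
    by (rule AE_lebesgue_on_Times[OF _ _ _ b_Lipschitz[OF h]]) (use open_S in \<open>auto simp: open_Times\<close>)
  then show ?thesis
  proof eventually_elim
    case (elim t)
    let ?d = "\<lambda>x. b (x, t + h) - b (x, t)"
    have m: "?d \<in> borel_measurable M" by (intro borel_measurable_diff section_measurable)
    have ae: "AE x in M. \<bar>?d x\<bar> \<le> L * h" using elim by simp
    note d = L2_bounded_mult[OF m ae \<xi>]
    have "form \<xi> \<zeta> (t + h) - form \<xi> \<zeta> t = L2_inner S (\<lambda>x. ?d x *\<^sub>R \<xi> x) \<zeta>"
      unfolding form_def L2_inner_diff_left[OF b_mult(1)[OF \<xi>] b_mult(1)[OF \<xi>] \<zeta>, symmetric]
      by (simp add: scaleR_diff_left)
    also have "\<bar>\<dots>\<bar> \<le> L2_norm S (\<lambda>x. ?d x *\<^sub>R \<xi> x) * L2_norm S \<zeta>"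
      by (rule L2_Cauchy_Schwarz[OF d(1) \<zeta>])
    also have "\<dots> \<le> L * h * L2_norm S \<xi> * L2_norm S \<zeta>"
      using d(2) L h by (intro mult_right_mono) auto
    finally show ?case .
  qed
qed

lemma form_integrable:
  assumes "\<xi> \<in> L2 S" "\<zeta> \<in> L2 S"
  shows "form \<xi> \<zeta> absolutely_integrable_on {s..t}" "form \<xi> \<zeta> integrable_on {s..t}"
proof -
  show "form \<xi> \<zeta> absolutely_integrable_on {s..t}"
  proof (rule measurable_bounded_by_integrable_imp_absolutely_integrable)
    show "form \<xi> \<zeta> \<in> borel_measurable (lebesgue_on {s..t})"
      using form_measurable[OF assms] by (intro measurable_restrict_space1 measurable_completion) simp
    show "norm (form \<xi> \<zeta> x) \<le> hi * L2_norm S \<xi> * L2_norm S \<zeta>" for x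
      using form_bound[OF assms] by simp
  qed auto
  then show "form \<xi> \<zeta> integrable_on {s..t}"
    using set_lebesgue_integral_eq_integral(1) by blast
qed

text \<open>The Lipschitz bound for \<open>form\<close> holds at almost every time; integrating it
  over a window gives an estimate for every window.\<close>

lemma form_shift:
  assumes \<xi>: "\<xi> \<in> L2 S" and \<zeta>: "\<zeta> \<in> L2 S" and h: "0 < h" and st: "0 \<le> s" "s \<le> t" "t + h \<le> T"
  shows "\<bar>integral {s + h..t + h} (form \<xi> \<zeta>) - integral {s..t} (form \<xi> \<zeta>)\<bar>
    \<le> (t - s) * (L * h * L2_norm S \<xi> * L2_norm S \<zeta>)"
proof -
  let ?f = "form \<xi> \<zeta>" and ?c = "L * h * L2_norm S \<xi> * L2_norm S \<zeta>"
  have sh: "integral {s..t} (\<lambda>r. ?f (r + h)) = integral {s + h..t + h} ?f"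
    using integral_shift_Icc_real[of s t ?f h] by (simp add: comp_def add.commute)
  have shi: "(\<lambda>r. ?f (r + h)) absolutely_integrable_on {s..t}"
  proof (rule measurable_bounded_by_integrable_imp_absolutely_integrable)
    show "(\<lambda>r. ?f (r + h)) \<in> borel_measurable (lebesgue_on {s..t})"
      using measurable_compose[OF _ form_measurable[OF \<xi> \<zeta>], of "\<lambda>r. r + h" borel]
      by (intro measurable_restrict_space1 measurable_completion) simp
    show "norm (?f (r + h)) \<le> hi * L2_norm S \<xi> * L2_norm S \<zeta>" for r
      using form_bound[OF \<xi> \<zeta>] by simp
  qed auto
  have d: "(\<lambda>r. ?f (r + h) - ?f r) absolutely_integrable_on {s..t}"
    by (intro set_integral_diff shi form_integrable \<xi> \<zeta>)
  have ae: "AE r in lebesgue_on {s<..<t}. \<bar>?f (r + h) - ?f r\<bar> \<le> ?c"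
    by (rule AE_lebesgue_on_subset[OF form_Lipschitz[OF \<xi> \<zeta> h]]) (use st in auto)
  have "integral {s..t} (\<lambda>r. ?f (r + h)) - integral {s..t} ?f = integral {s..t} (\<lambda>r. ?f (r + h) - ?f r)"
    using shi form_integrable[OF \<xi> \<zeta>] set_lebesgue_integral_eq_integral(1)
    by (intro Henstock_Kurzweil_Integration.integral_diff[symmetric]) blast+
  moreover have "integral {s..t} (\<lambda>r. ?f (r + h) - ?f r) \<le> integral {s..t} (\<lambda>_. ?c)"
    by (rule integral_le_AE[OF d]) (use ae in \<open>auto elim: eventually_mono\<close>)
  moreover have "integral {s..t} (\<lambda>_. - ?c) \<le> integral {s..t} (\<lambda>r. ?f (r + h) - ?f r)"
    by (rule integral_le_AE[OF _ d]) (use ae in \<open>auto elim: eventually_mono\<close>)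
  ultimately show ?thesis using st by (simp add: sh abs_le_iff mult_ac)
qed

text \<open>The mean of \<open>form\<close> against the hat function supported on the interval from \<open>a\<close> to \<open>a + 2 h\<close>.\<close>
definition hat_mean :: "real \<Rightarrow> ('a \<Rightarrow> 'b::euclidean_space) \<Rightarrow> ('a \<Rightarrow> 'b) \<Rightarrow> real \<Rightarrow> real" where
  "hat_mean h \<xi> \<zeta> a = integral {0..h} (\<lambda>\<sigma>. integral {a + \<sigma>..a + \<sigma> + h} (form \<xi> \<zeta>)) / h\<^sup>2"

lemma window_continuous:
  assumes "\<xi> \<in> L2 S" "\<zeta> \<in> L2 S" "0 \<le> h"
  shows "continuous_on {0..h} (\<lambda>\<sigma>. integral {a + \<sigma>..a + \<sigma> + h} (form \<xi> \<zeta>))"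
proof -
  define F where "F = (\<lambda>u. integral {a..u} (form \<xi> \<zeta>))"
  note int = form_integrable(2)[OF assms(1,2)]
  have F: "continuous_on {a..a + 2 * h} F"
    unfolding F_def by (rule indefinite_integral_continuous_1[OF int])
  have eq: "integral {a + \<sigma>..a + \<sigma> + h} (form \<xi> \<zeta>) = F (a + \<sigma> + h) - F (a + \<sigma>)" if "\<sigma> \<in> {0..h}" for \<sigma>
    unfolding F_def using Henstock_Kurzweil_Integration.integral_combine[of a "a + \<sigma>" "a + \<sigma> + h" "form \<xi> \<zeta>"] int that assms(3)
    by simp
  have "continuous_on {0..h} (\<lambda>\<sigma>. F (a + \<sigma> + h) - F (a + \<sigma>))"
    by (intro continuous_on_diff continuous_on_compose2[OF F] continuous_intros) auto
  then show ?thesis by (rule continuous_on_eq) (simp add: eq)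
qed

lemma window_integrable:
  assumes "\<xi> \<in> L2 S" "\<zeta> \<in> L2 S" "0 \<le> h"
  shows "(\<lambda>\<sigma>. integral {a + \<sigma>..a + \<sigma> + h} (form \<xi> \<zeta>)) integrable_on {0..h}"
  by (rule integrable_continuous_interval[OF window_continuous[OF assms]])

lemma hat_mean_commute: "hat_mean h \<xi> \<zeta> a = hat_mean h \<zeta> \<xi> a"
proof -
  have "form \<xi> \<zeta> = form \<zeta> \<xi>" using form_commute by (intro ext)
  then show ?thesis by (simp add: hat_mean_def)
qed

lemma hat_mean_diff_right:
  assumes "\<xi> \<in> L2 S" "\<zeta> \<in> L2 S" "\<zeta>' \<in> L2 S" "0 \<le> h"
  shows "hat_mean h \<xi> (\<lambda>x. \<zeta> x - \<zeta>' x) a = hat_mean h \<xi> \<zeta> a - hat_mean h \<xi> \<zeta>' a"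
proof -
  have "form \<xi> (\<lambda>x. \<zeta> x - \<zeta>' x) = (\<lambda>t. form \<xi> \<zeta> t - form \<xi> \<zeta>' t)"
    by (rule ext) (rule form_diff_right[OF assms(1-3)])
  then show ?thesis
    using assms by (simp add: hat_mean_def diff_divide_distrib window_integrable form_integrable
        Henstock_Kurzweil_Integration.integral_diff)
qed

text \<open>Two integrations over intervals of length \<open>h\<close>, divided by
  \<open>h\<^sup>2\<close>, form a mean of total weight \<open>1\<close>, so the lower bound keeps
  its constant.\<close>

lemma hat_mean_coercive:
  assumes "\<xi> \<in> L2 S" "0 < h"
  shows "lo * (L2_norm S \<xi>)\<^sup>2 \<le> hat_mean h \<xi> \<xi> a"
proof -
  let ?c = "lo * (L2_norm S \<xi>)\<^sup>2"
  have "integral {u..u + h} (\<lambda>_. ?c) \<le> integral {u..u + h} (form \<xi> \<xi>)" for u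
    by (intro integral_le form_integrable assms form_coercive) auto
  then have 1: "h * ?c \<le> integral {u..u + h} (form \<xi> \<xi>)" for u using assms by (simp add: mult_ac)
  have "integral {0..h} (\<lambda>_. h * ?c) \<le> integral {0..h} (\<lambda>\<sigma>. integral {a + \<sigma>..a + \<sigma> + h} (form \<xi> \<xi>))"
    using assms by (intro integral_le window_integrable 1) auto
  then have "h\<^sup>2 * ?c \<le> integral {0..h} (\<lambda>\<sigma>. integral {a + \<sigma>..a + \<sigma> + h} (form \<xi> \<xi>))"
    using assms by (simp add: power2_eq_square mult_ac)
  then show ?thesis using assms by (simp add: hat_mean_def field_simps)
qed

lemma hat_mean_bound:
  assumes "\<xi> \<in> L2 S" "\<zeta> \<in> L2 S" "0 < h"
  shows "\<bar>hat_mean h \<xi> \<zeta> a\<bar> \<le> hi * L2_norm S \<xi> * L2_norm S \<zeta>"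
proof -
  let ?c = "hi * L2_norm S \<xi> * L2_norm S \<zeta>"
  have 1: "\<bar>integral {u..u + h} (form \<xi> \<zeta>)\<bar> \<le> ?c * h" for u
    using abs_integral_le[OF form_integrable(2)[OF assms(1,2)], of u "u + h" ?c]
      form_bound[OF assms(1,2)] hi assms(3) by simp
  have "\<bar>integral {0..h} (\<lambda>\<sigma>. integral {a + \<sigma>..a + \<sigma> + h} (form \<xi> \<zeta>))\<bar> \<le> (?c * h) * h"
    using abs_integral_le[OF window_integrable[OF assms(1,2)], of h "?c * h" a] 1 hi assms(3) by simp
  then show ?thesis using assms by (simp add: hat_mean_def abs_divide pos_divide_le_eq power2_eq_square mult.assoc)
qed

text \<open>Each window moves by \<open>h\<close>, and the estimate for windows is averaged. The hat
  that starts at \<open>a + h\<close> ends at \<open>a + 3 * h\<close>, hence the condition on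
  \<open>a\<close>.\<close>

lemma hat_mean_shift:
  assumes \<xi>: "\<xi> \<in> L2 S" and \<zeta>: "\<zeta> \<in> L2 S" and h: "0 < h" and a: "0 \<le> a" "a + 3 * h \<le> T"
  shows "\<bar>hat_mean h \<xi> \<zeta> (a + h) - hat_mean h \<xi> \<zeta> a\<bar> \<le> L * h * L2_norm S \<xi> * L2_norm S \<zeta>"
proof -
  let ?c = "L * h * L2_norm S \<xi> * L2_norm S \<zeta>"
  let ?w = "\<lambda>a \<sigma>. integral {a + \<sigma>..a + \<sigma> + h} (form \<xi> \<zeta>)"
  have i: "?w a integrable_on {0..h}" for a using window_integrable[OF \<xi> \<zeta>] h by simp
  have 1: "\<bar>?w (a + h) \<sigma> - ?w a \<sigma>\<bar> \<le> h * ?c" if "\<sigma> \<in> {0..h}" for \<sigma>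
    using form_shift[OF \<xi> \<zeta> h, of "a + \<sigma>" "a + \<sigma> + h"] that a h by (simp add: algebra_simps)
  have "\<bar>integral {0..h} (\<lambda>\<sigma>. ?w (a + h) \<sigma> - ?w a \<sigma>)\<bar> \<le> (h * ?c) * h"
    using abs_integral_le[OF Henstock_Kurzweil_Integration.integrable_diff[OF i i], of "h * ?c" "a + h" a] 1 L h
    by (simp del: integral_diff)
  then have "\<bar>integral {0..h} (?w (a + h)) - integral {0..h} (?w a)\<bar> \<le> ?c * h\<^sup>2"
    unfolding Henstock_Kurzweil_Integration.integral_diff[OF i i]
    by (simp add: power2_eq_square mult_ac)
  then show ?thesis
    using h by (simp add: hat_mean_def abs_divide pos_divide_le_eq flip: diff_divide_distrib)
qed

end

section \<open>The energy inequality\<close>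

context bounded_open
begin

lemma continuous_into_mem: "v \<in> continuous_into {0..T::real} V N \<Longrightarrow> 0 \<le> t \<Longrightarrow> t \<le> T \<Longrightarrow> v t \<in> V"
  by (auto simp: continuous_into_def)

lemma continuous_into_eps:
  assumes v: "v \<in> continuous_into {0..T::real} (L2 S) (L2_norm S)" and t: "0 \<le> t" "t \<le> T" and e: "0 < (e::real)"
  shows "\<exists>d>0. \<forall>r\<in>{0..T}. \<bar>r - t\<bar> < d \<longrightarrow> L2_norm S (\<lambda>x. v r x - v t x) < e"
proof -
  have "((\<lambda>r. L2_norm S (\<lambda>x. v r x - v t x)) \<longlongrightarrow> 0) (at t within {0..T})"
    using v t by (auto simp: continuous_into_def)
  from tendstoD[OF this e] obtain d where d: "d > 0"
    "\<And>r. r \<in> {0..T} \<Longrightarrow> r \<noteq> t \<Longrightarrow> dist r t < d \<Longrightarrow> L2_norm S (\<lambda>x. v r x - v t x) < e"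
    by (auto simp: eventually_at)
  have "L2_norm S (\<lambda>x. v r x - v t x) < e" if "r \<in> {0..T}" "\<bar>r - t\<bar> < d" for r
    using d(2)[of r] that e by (cases "r = t") (auto simp: dist_real_def)
  then show ?thesis using d(1) by blast
qed

lemma continuous_into_inner:
  assumes v: "v \<in> continuous_into {0..T} (L2 S) (L2_norm S)" and \<eta>: "\<eta> \<in> L2 S"
  shows "continuous_on {0..T::real} (\<lambda>r. L2_inner S (v r) \<eta>)"
  unfolding continuous_on_iff
proof (intro ballI allI impI)
  fix t e :: real assume t: "t \<in> {0..T}" and e: "e > 0"
  have n: "0 < L2_norm S \<eta> + 1" using L2_norm_nonneg[of \<eta>] by linarith
  then have e': "e / (L2_norm S \<eta> + 1) > 0" using e by simp
  obtain d where d: "d > 0" "\<And>r. r \<in> {0..T} \<Longrightarrow> \<bar>r - t\<bar> < d \<Longrightarrow> L2_norm S (\<lambda>x. v r x - v t x) < e / (L2_norm S \<eta> + 1)"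
    using continuous_into_eps[OF v _ _ e', of t] t by auto
  note vm = continuous_into_mem[OF v]
  have "dist (L2_inner S (v r) \<eta>) (L2_inner S (v t) \<eta>) < e" if r: "r \<in> {0..T}" "dist r t < d" for r
  proof -
    have "dist (L2_inner S (v r) \<eta>) (L2_inner S (v t) \<eta>) = \<bar>L2_inner S (\<lambda>x. v r x - v t x) \<eta>\<bar>"
      using r t \<eta> by (simp add: dist_real_def L2_inner_diff_left vm)
    also have "\<dots> \<le> L2_norm S (\<lambda>x. v r x - v t x) * L2_norm S \<eta>"
      using r t \<eta> by (intro L2_Cauchy_Schwarz L2_diff vm) auto
    also have "\<dots> \<le> e / (L2_norm S \<eta> + 1) * L2_norm S \<eta>"
      using d(2)[of r] r by (intro mult_right_mono) (auto simp: dist_real_def)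
    also have "\<dots> < e" using e n by (simp add: pos_divide_less_eq distrib_left)
    finally show ?thesis .
  qed
  then show "\<exists>d>0. \<forall>r\<in>{0..T}. dist r t < d \<longrightarrow> dist (L2_inner S (v r) \<eta>) (L2_inner S (v t) \<eta>) < e"
    using d(1) by blast
qed

end

text \<open>\<open>Z\<close> is the difference of two solutions and \<open>G\<close> its gradient. The equation enters only through \<open>key\<close>, in
  which the gradient is frozen at time \<open>c\<close> at the price of the oscillation \<open>\<omega>\<close>.\<close>
locale energy = coefficient S b lo hi L T
  for S :: "'a::euclidean_space set" and b lo hi L T +
  fixes Z v :: "real \<Rightarrow> 'a \<Rightarrow> real" and G :: "real \<Rightarrow> 'a \<Rightarrow> 'a" and A :: "real \<Rightarrow> real"
    and E k lam :: real
  assumes Z_L2: "0 \<le> t \<Longrightarrow> t \<le> T \<Longrightarrow> Z t \<in> L2 S"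
    and G_L2: "0 \<le> t \<Longrightarrow> t \<le> T \<Longrightarrow> G t \<in> L2 S"
    and v_continuous: "v \<in> continuous_into {0..T} (L2 S) (L2_norm S)"
    and primitive: "0 \<le> s \<Longrightarrow> s \<le> t \<Longrightarrow> t \<le> T \<Longrightarrow> \<eta> \<in> L2 S \<Longrightarrow>
      L2_inner S (\<lambda>x. Z t x - Z s x) \<eta> = integral {s..t} (\<lambda>r. L2_inner S (v r) \<eta>)"
    and A_continuous: "continuous_on {0..T} A"
    and G_A: "0 \<le> s \<Longrightarrow> s \<le> t \<Longrightarrow> t \<le> T \<Longrightarrow> L2_norm S (\<lambda>x. G t x - G s x) \<le> A t - A s"
    and v_0: "L2_norm S (v 0) = 0" and G_0: "L2_norm S (G 0) = 0"
    and key: "0 \<le> s \<Longrightarrow> s \<le> t \<Longrightarrow> t \<le> T \<Longrightarrow> c \<in> {0..T} \<Longrightarrow> p \<in> {0..T} \<Longrightarrow> q \<in> {0..T} \<Longrightarrow>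
      (\<And>r. s \<le> r \<Longrightarrow> r \<le> t \<Longrightarrow> L2_norm S (\<lambda>x. G r x - G c x) \<le> \<omega>) \<Longrightarrow>
      L2_inner S (\<lambda>x. v t x - v s x) (\<lambda>x. Z p x - Z q x) \<le>
        - integral {s..t} (form (G c) (\<lambda>x. G p x - G q x))
        + (t - s) * (hi * \<omega> * L2_norm S (\<lambda>x. G p x - G q x) + E * (k * exp (lam * t / 2)) * L2_norm S (\<lambda>x. Z p x - Z q x))"
    and v_bound: "0 \<le> t \<Longrightarrow> t \<le> T \<Longrightarrow> L2_norm S (v t) \<le> k * exp (lam * t / 2)"
    and G_bound: "0 \<le> t \<Longrightarrow> t \<le> T \<Longrightarrow> L2_norm S (G t) \<le> k * exp (lam * t / 2)"
    and E: "0 \<le> E" and k: "0 \<le> k" and lam: "0 < lam"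
begin

text \<open>The assumed bound for the two norms. Its square is the bound for the energy, hence the
  half in the exponent.\<close>

abbreviation "m t \<equiv> k * exp (lam * t / 2)"

lemma m_mono: "s \<le> t \<Longrightarrow> m s \<le> m t"
  using k lam by (intro mult_left_mono) auto

lemma m_nonneg: "0 \<le> m t"
  using k by simp

lemma m_square: "(m t)\<^sup>2 = k\<^sup>2 * exp (lam * t)"
  by (simp add: power_mult_distrib flip: exp_of_nat_mult)

lemmas v_L2 = continuous_into_mem[OF v_continuous]
  and v_eps = continuous_into_eps[OF v_continuous]
  and v_inner_continuous = continuous_into_inner[OF v_continuous]

lemma v_inner_integrable:
  "\<eta> \<in> L2 S \<Longrightarrow> 0 \<le> s \<Longrightarrow> t \<le> T \<Longrightarrow> (\<lambda>r. L2_inner S (v r) \<eta>) integrable_on {s..t}"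
  by (intro integrable_continuous_interval continuous_on_subset[OF v_inner_continuous]) auto

text \<open>\<open>Z\<close> is a primitive of \<open>v\<close> only in the weak sense, against each
  fixed \<eta>. Testing with the defect itself and dividing by its norm yields a norm estimate. With
  \<open>w = 0\<close> it bounds increments, with a value of \<open>v\<close> it controls the
  difference quotient.\<close>

lemma primitive_approx:
  assumes st: "0 \<le> s" "s \<le> t" "t \<le> T" and w: "w \<in> L2 S"
    and e: "\<And>r. s \<le> r \<Longrightarrow> r \<le> t \<Longrightarrow> L2_norm S (\<lambda>x. v r x - w x) \<le> e"
  shows "L2_norm S (\<lambda>x. Z t x - Z s x - (t - s) * w x) \<le> (t - s) * e"
proof -
  let ?d = "\<lambda>x. Z t x - Z s x - (t - s) * w x"
  have d: "?d \<in> L2 S" using st w by (intro L2_diff L2_scale Z_L2) auto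
  have e0: "0 \<le> e" using e[of s] st by (meson L2_norm_nonneg order_refl order_trans)
  have "(L2_norm S ?d)\<^sup>2 = L2_inner S (\<lambda>x. Z t x - Z s x) ?d - (t - s) * L2_inner S w ?d"
    using st d w by (simp add: L2_norm_square L2_inner_diff_left L2_diff L2_scale Z_L2 L2_inner_scale_left)
  also have "\<dots> = integral {s..t} (\<lambda>r. L2_inner S (v r) ?d) - integral {s..t} (\<lambda>r. L2_inner S w ?d)"
    using st d by (simp add: primitive)
  also have "\<dots> = integral {s..t} (\<lambda>r. L2_inner S (v r) ?d - L2_inner S w ?d)"
    using st by (intro Henstock_Kurzweil_Integration.integral_diff[symmetric] v_inner_integrable d) auto
  also have "\<dots> \<le> (e * L2_norm S ?d) * (t - s)"
  proof (rule abs_le_D1, rule abs_integral_le)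
    show "(\<lambda>r. L2_inner S (v r) ?d - L2_inner S w ?d) integrable_on {s..t}"
      using st by (intro Henstock_Kurzweil_Integration.integrable_diff v_inner_integrable d) auto
    fix r assume r: "r \<in> {s..t}"
    have "\<bar>L2_inner S (v r) ?d - L2_inner S w ?d\<bar> = \<bar>L2_inner S (\<lambda>x. v r x - w x) ?d\<bar>"
      using r st d w by (simp add: L2_inner_diff_left v_L2)
    also have "\<dots> \<le> L2_norm S (\<lambda>x. v r x - w x) * L2_norm S ?d"
      using r st by (intro L2_Cauchy_Schwarz[OF L2_diff[OF v_L2 w] d]) auto
    also have "\<dots> \<le> e * L2_norm S ?d" using e r by (intro mult_right_mono) auto
    finally show "\<bar>L2_inner S (v r) ?d - L2_inner S w ?d\<bar> \<le> e * L2_norm S ?d" .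
  qed (use st e0 in auto)
  finally have "L2_norm S ?d * L2_norm S ?d \<le> ((t - s) * e) * L2_norm S ?d"
    by (simp add: power2_eq_square mult_ac)
  then show ?thesis
    using e0 st by (cases "L2_norm S ?d = 0") (auto simp: less_le)
qed

lemma primitive_bound:
  assumes "0 \<le> s" "s \<le> t" "t \<le> T" "\<And>r. s \<le> r \<Longrightarrow> r \<le> t \<Longrightarrow> L2_norm S (v r) \<le> e"
  shows "L2_norm S (\<lambda>x. Z t x - Z s x) \<le> (t - s) * e"
  using primitive_approx[OF assms(1-3) L2_zero] assms(4) by simp

text \<open>With \<eta> = P + R, the product of \<open>P - R\<close> with \<eta> is the difference
  of the two squared norms. As \<open>P\<close> and \<open>R\<close> are integrals of
  \<open>v\<close> over adjacent intervals, \<open>P - R\<close> is the integral of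
  \<open>v (a + \<sigma> + h) - v (a + \<sigma>)\<close> over \<sigma>, and \<open>key\<close>
  applies for each \<sigma> with the gradient frozen at the midpoint \<open>a + h\<close>.\<close>

lemma energy_step:
  assumes h: "0 < h" and a: "0 \<le> a" "a + 2 * h \<le> T"
  shows "(L2_norm S (\<lambda>x. Z (a + 2 * h) x - Z (a + h) x))\<^sup>2 / h\<^sup>2
      + hat_mean h (G (a + h)) (G (a + 2 * h)) a
    \<le> (L2_norm S (\<lambda>x. Z (a + h) x - Z a x))\<^sup>2 / h\<^sup>2 + hat_mean h (G (a + h)) (G a) a
      + hi * (A (a + 2 * h) - A a)\<^sup>2 + 2 * E * h * (m (a + 2 * h))\<^sup>2"
proof -
  define \<alpha> where "\<alpha> = A (a + 2 * h) - A a"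
  define \<eta> where "\<eta> = (\<lambda>x. Z (a + 2 * h) x - Z a x)"
  define \<zeta> where "\<zeta> = (\<lambda>x. G (a + 2 * h) x - G a x)"
  define P where "P = (\<lambda>x. Z (a + 2 * h) x - Z (a + h) x)"
  define R where "R = (\<lambda>x. Z (a + h) x - Z a x)"
  \<comment> \<open>The bracket from \<open>key\<close>, with the oscillation replaced by \<alpha>
    and the weight enlarged to its value at the right end \<open>a + 2 * h\<close>.\<close>
  define e where "e = hi * \<alpha> * L2_norm S \<zeta> + E * m (a + 2 * h) * L2_norm S \<eta>"
  have PR: "P \<in> L2 S" "R \<in> L2 S" "\<eta> \<in> L2 S" "\<zeta> \<in> L2 S"
    unfolding P_def R_def \<eta>_def \<zeta>_def using a h by (auto intro!: L2_diff Z_L2 G_L2)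
  have \<eta>PR: "\<eta> = (\<lambda>x. P x + R x)" by (auto simp: \<eta>_def P_def R_def)
  have Amono: "A s \<le> A t" if "0 \<le> s" "s \<le> t" "t \<le> T" for s t
    using order_trans[OF L2_norm_nonneg G_A[OF that]] by simp
  \<comment> \<open>The increment \<alpha> of \<open>A\<close> over the double step bounds the
    distance from the midpoint in both directions. It bounds \<zeta> as well, so the freezing error
    becomes quadratic in \<alpha>.\<close>
  have \<omega>: "L2_norm S (\<lambda>x. G r x - G (a + h) x) \<le> \<alpha>" if r: "a \<le> r" "r \<le> a + 2 * h" for r
  proof (cases "a + h \<le> r")
    case True
    then have "L2_norm S (\<lambda>x. G r x - G (a + h) x) \<le> A r - A (a + h)" using a h r by (intro G_A) auto
    also have "\<dots> \<le> \<alpha>" using Amono[of r "a + 2 * h"] Amono[of a "a + h"] a h r by (simp add: \<alpha>_def)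
    finally show ?thesis .
  next
    case False
    then have "L2_norm S (\<lambda>x. G r x - G (a + h) x) \<le> A (a + h) - A r"
      using a h r by (subst L2_norm_minus_commute) (intro G_A, auto)
    also have "\<dots> \<le> \<alpha>" using Amono[of a r] Amono[of "a + h" "a + 2 * h"] a h r False by (simp add: \<alpha>_def)
    finally show ?thesis .
  qed
  have \<zeta>\<alpha>: "L2_norm S \<zeta> \<le> \<alpha>" unfolding \<zeta>_def \<alpha>_def using a h by (intro G_A) auto
  have \<alpha>0: "0 \<le> \<alpha>" using order_trans[OF L2_norm_nonneg \<zeta>\<alpha>] .
  have \<eta>m: "L2_norm S \<eta> \<le> 2 * h * m (a + 2 * h)"
  proof -
    have "L2_norm S (v r) \<le> m (a + 2 * h)" if "a \<le> r" "r \<le> a + 2 * h" for r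
      using v_bound[of r] m_mono[OF that(2)] that a h by linarith
    then show ?thesis using primitive_bound[of a "a + 2 * h" "m (a + 2 * h)"] a h by (simp add: \<eta>_def)
  qed
  have e_le: "e \<le> hi * \<alpha>\<^sup>2 + 2 * E * h * (m (a + 2 * h))\<^sup>2"
  proof -
    have "hi * \<alpha> * L2_norm S \<zeta> \<le> hi * \<alpha> * \<alpha>" using hi \<alpha>0 \<zeta>\<alpha> by (intro mult_left_mono) auto
    moreover have "E * m (a + 2 * h) * L2_norm S \<eta> \<le> E * m (a + 2 * h) * (2 * h * m (a + 2 * h))"
      using E m_nonneg \<eta>m by (intro mult_left_mono) auto
    ultimately show ?thesis by (simp add: e_def power2_eq_square mult_ac)
  qed
  have shift: "integral {a + h..a + 2 * h} (\<lambda>r. L2_inner S (v r) \<eta>) = integral {0..h} (\<lambda>\<sigma>. L2_inner S (v (a + \<sigma> + h)) \<eta>)"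
    "integral {a..a + h} (\<lambda>r. L2_inner S (v r) \<eta>) = integral {0..h} (\<lambda>\<sigma>. L2_inner S (v (a + \<sigma>)) \<eta>)"
    using integral_shift_Icc_real[of 0 h "\<lambda>r. L2_inner S (v r) \<eta>" "a + h"]
      integral_shift_Icc_real[of 0 h "\<lambda>r. L2_inner S (v r) \<eta>" a]
    by (simp_all add: comp_def algebra_simps)
  have ci: "(\<lambda>\<sigma>. L2_inner S (v (c + \<sigma>)) \<eta>) integrable_on {0..h}" if "0 \<le> c" "c + h \<le> T" for c
    by (rule integrable_continuous_interval, rule continuous_on_compose2[OF v_inner_continuous[OF PR(3)]])
      (use that in \<open>auto intro!: continuous_intros\<close>)
  have i1: "(\<lambda>\<sigma>. L2_inner S (v (a + \<sigma> + h)) \<eta>) integrable_on {0..h}"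
    using ci[of "a + h"] a h by (simp add: add_ac)
  have i2: "(\<lambda>\<sigma>. L2_inner S (v (a + \<sigma>)) \<eta>) integrable_on {0..h}" using ci[of a] a h by simp
  let ?w = "\<lambda>\<sigma>. integral {a + \<sigma>..a + \<sigma> + h} (form (G (a + h)) \<zeta>)"
  have w: "?w integrable_on {0..h}" using a h PR by (intro window_integrable G_L2) auto
  have "(L2_norm S P)\<^sup>2 - (L2_norm S R)\<^sup>2 = L2_inner S P \<eta> - L2_inner S R \<eta>"
    using PR by (simp add: \<eta>PR L2_norm_square L2_inner_add_right L2_inner_commute[of R P])
  also have "\<dots> = integral {0..h} (\<lambda>\<sigma>. L2_inner S (v (a + \<sigma> + h)) \<eta> - L2_inner S (v (a + \<sigma>)) \<eta>)"
    unfolding P_def R_def using a h PR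
    by (simp add: primitive shift Henstock_Kurzweil_Integration.integral_diff[OF i1 i2])
  also have "\<dots> \<le> integral {0..h} (\<lambda>\<sigma>. h * e - ?w \<sigma>)"
  proof (rule integral_le)
    show "(\<lambda>\<sigma>. L2_inner S (v (a + \<sigma> + h)) \<eta> - L2_inner S (v (a + \<sigma>)) \<eta>) integrable_on {0..h}"
      by (intro Henstock_Kurzweil_Integration.integrable_diff i1 i2)
    show "(\<lambda>\<sigma>. h * e - ?w \<sigma>) integrable_on {0..h}"
      by (intro Henstock_Kurzweil_Integration.integrable_diff w) auto
    fix \<sigma> assume \<sigma>: "\<sigma> \<in> {0..h}"
    have "L2_inner S (v (a + \<sigma> + h)) \<eta> - L2_inner S (v (a + \<sigma>)) \<eta> = L2_inner S (\<lambda>x. v (a + \<sigma> + h) x - v (a + \<sigma>) x) \<eta>"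
      using \<sigma> a h PR by (simp add: L2_inner_diff_left v_L2)
    also have "\<dots> \<le> - ?w \<sigma> + (a + \<sigma> + h - (a + \<sigma>)) * (hi * \<alpha> * L2_norm S \<zeta> + E * m (a + \<sigma> + h) * L2_norm S \<eta>)"
      unfolding \<eta>_def \<zeta>_def by (rule key) (use \<sigma> a h \<omega> in auto)
    also have "\<dots> \<le> h * e - ?w \<sigma>"
    proof -
      have "E * m (a + \<sigma> + h) * L2_norm S \<eta> \<le> E * m (a + 2 * h) * L2_norm S \<eta>"
        using E \<sigma> by (intro mult_right_mono[OF mult_left_mono[OF m_mono]]) auto
      then have "h * (hi * \<alpha> * L2_norm S \<zeta> + E * m (a + \<sigma> + h) * L2_norm S \<eta>) \<le> h * e"
        using h by (intro mult_left_mono) (auto simp: e_def)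
      then show ?thesis by simp
    qed
    finally show "L2_inner S (v (a + \<sigma> + h)) \<eta> - L2_inner S (v (a + \<sigma>)) \<eta> \<le> h * e - ?w \<sigma>" .
  qed
  also have "\<dots> = h\<^sup>2 * (e - hat_mean h (G (a + h)) \<zeta> a)"
  proof -
    have "integral {0..h} (\<lambda>\<sigma>. h * e - ?w \<sigma>) = h * (h * e) - integral {0..h} ?w"
      using h by (subst Henstock_Kurzweil_Integration.integral_diff[OF _ w]) auto
    moreover have "h * (h * e) - I = h\<^sup>2 * (e - I / h\<^sup>2)" for I
      using h by (simp add: right_diff_distrib power2_eq_square)
    ultimately show ?thesis by (simp only: hat_mean_def)
  qed
  finally have "(L2_norm S P)\<^sup>2 / h\<^sup>2 - (L2_norm S R)\<^sup>2 / h\<^sup>2 \<le> e - hat_mean h (G (a + h)) \<zeta> a"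
    using h by (simp add: pos_divide_le_eq mult.commute flip: diff_divide_distrib)
  moreover have "hat_mean h (G (a + h)) \<zeta> a = hat_mean h (G (a + h)) (G (a + 2 * h)) a - hat_mean h (G (a + h)) (G a) a"
    unfolding \<zeta>_def using a h by (intro hat_mean_diff_right G_L2) auto
  ultimately show ?thesis using e_le unfolding P_def R_def \<alpha>_def by simp
qed

text \<open>From \<open>1 + x \<le> exp x\<close>. It bounds a Riemann summand by an increment, so
  that the sums telescope and the factor \<open>1 / lam\<close> appears.\<close>

lemma exp_step: "0 < h \<Longrightarrow> h * (m t)\<^sup>2 \<le> k\<^sup>2 / lam * (exp (lam * (t + h)) - exp (lam * t))"
proof -
  assume h: "0 < h"
  have "lam * h * exp (lam * t) \<le> (exp (lam * h) - 1) * exp (lam * t)"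
    by (rule mult_right_mono) (use exp_ge_add_one_self[of "lam * h"] in linarith, simp)
  also have "\<dots> = exp (lam * (t + h)) - exp (lam * t)"
    by (simp add: exp_add algebra_simps)
  finally have "k\<^sup>2 * (lam * h * exp (lam * t)) \<le> k\<^sup>2 * (exp (lam * (t + h)) - exp (lam * t))"
    by (rule mult_left_mono) simp
  then show ?thesis unfolding m_square using lam by (simp add: field_simps)
qed

text \<open>The sum of the single steps. Increments of \<open>A\<close> over double steps overlap,
  so their sum leaves two terms at each end; one factor of each square is bounded by \<delta>. In
  the constant, \<open>2 * E\<close> comes from each step and \<open>L\<close> from moving the hat
  by \<open>h\<close>, which matches the mixed terms of neighbouring steps. The exponentials run
  from \<open>2 * h\<close> to \<open>(n + 3) * h\<close> because the step starting at
  \<open>a\<close> contributes the weight at \<open>a + 2 * h\<close>.\<close>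

lemma energy_sum:
  assumes h: "0 < h" and \<delta>: "\<And>s t. 0 \<le> s \<Longrightarrow> s \<le> t \<Longrightarrow> t \<le> T \<Longrightarrow> t \<le> s + 2 * h \<Longrightarrow> A t - A s \<le> \<delta>"
    and n: "(real n + 2) * h \<le> T"
  shows "(L2_norm S (\<lambda>x. Z ((real n + 2) * h) x - Z ((real n + 1) * h) x))\<^sup>2 / h\<^sup>2
      + hat_mean h (G ((real n + 1) * h)) (G ((real n + 2) * h)) (real n * h)
    \<le> (L2_norm S (\<lambda>x. Z h x - Z 0 x))\<^sup>2 / h\<^sup>2
      + hi * \<delta> * (A ((real n + 2) * h) + A ((real n + 1) * h) - A h - A 0)
      + (2 * E + L) * k\<^sup>2 / lam * (exp (lam * ((real n + 3) * h)) - exp (lam * (2 * h)))"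
  using n
proof (induction n)
  have Amono: "A s \<le> A t" if "0 \<le> s" "s \<le> t" "t \<le> T" for s t
    using order_trans[OF L2_norm_nonneg G_A[OF that]] by simp
  have sq: "hi * (A (a + 2 * h) - A a)\<^sup>2 \<le> hi * \<delta> * (A (a + 2 * h) - A a)" if "0 \<le> a" "a + 2 * h \<le> T" for a
    using Amono[of a "a + 2 * h"] \<delta>[of a "a + 2 * h"] that h hi
    by (auto simp: power2_eq_square mult.assoc intro!: mult_left_mono mult_right_mono)
  have ex: "h * (m t)\<^sup>2 * c \<le> c * k\<^sup>2 / lam * (exp (lam * (t + h)) - exp (lam * t))" if "0 \<le> c" for t c
    using mult_left_mono[OF exp_step[OF h, of t] that] by (simp add: mult_ac)
  {
    case 0
    \<comment> \<open>The initial gradient vanishes, so the chain of mixed terms starts from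
      zero.\<close>
    have "hat_mean h (G h) (G 0) 0 = 0"
      using hat_mean_bound[of "G h" "G 0" h 0] G_0 h 0 by (simp add: G_L2)
    moreover have "h * (m (2 * h))\<^sup>2 * (2 * E) \<le> (2 * E + L) * k\<^sup>2 / lam * (exp (lam * (3 * h)) - exp (lam * (2 * h)))"
    proof -
      have "h * (m (2 * h))\<^sup>2 * (2 * E) \<le> h * (m (2 * h))\<^sup>2 * (2 * E + L)"
        using L h by (intro mult_left_mono) auto
      also have "\<dots> \<le> (2 * E + L) * k\<^sup>2 / lam * (exp (lam * (2 * h + h)) - exp (lam * (2 * h)))"
        using E L by (intro ex) auto
      finally show ?thesis by simp
    qed
    ultimately show ?case
      using energy_step[OF h, of 0] sq[of 0] 0 by (simp add: algebra_simps)
  next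
    case (Suc n)
    define a where "a = real n * h"
    have a: "0 \<le> a" "a + 3 * h \<le> T" using Suc.prems h by (auto simp: a_def algebra_simps)
    have eqs: "real n * h = a" "(real n + 1) * h = a + h" "(real n + 2) * h = a + 2 * h" "(real n + 3) * h = a + 3 * h"
      "(real (Suc n) + 2) * h = a + 3 * h" "(real (Suc n) + 1) * h = a + 2 * h" "(real (Suc n) + 3) * h = a + 4 * h"
      "real (Suc n) * h = a + h"
      by (simp_all add: a_def algebra_simps)
    have IH: "(L2_norm S (\<lambda>x. Z (a + 2 * h) x - Z (a + h) x))\<^sup>2 / h\<^sup>2 + hat_mean h (G (a + h)) (G (a + 2 * h)) a
      \<le> (L2_norm S (\<lambda>x. Z h x - Z 0 x))\<^sup>2 / h\<^sup>2 + hi * \<delta> * (A (a + 2 * h) + A (a + h) - A h - A 0)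
        + (2 * E + L) * k\<^sup>2 / lam * (exp (lam * (a + 3 * h)) - exp (lam * (2 * h)))"
      using Suc.IH a h unfolding eqs by simp
    have G2: "G (a + h) \<in> L2 S" "G (a + 2 * h) \<in> L2 S" using a h by (auto intro!: G_L2)
    have "L2_norm S (G (a + h)) * L2_norm S (G (a + 2 * h)) \<le> m (a + 3 * h) * m (a + 3 * h)"
    proof (intro mult_mono)
      show "L2_norm S (G (a + h)) \<le> m (a + 3 * h)"
        using G_bound[of "a + h"] m_mono[of "a + h" "a + 3 * h"] a h by simp
      show "L2_norm S (G (a + 2 * h)) \<le> m (a + 3 * h)"
        using G_bound[of "a + 2 * h"] m_mono[of "a + 2 * h" "a + 3 * h"] a h by simp
    qed (use m_nonneg in auto)
    then have "L * h * (L2_norm S (G (a + h)) * L2_norm S (G (a + 2 * h))) \<le> L * h * (m (a + 3 * h))\<^sup>2"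
      using L h by (intro mult_left_mono) (auto simp: power2_eq_square)
    \<comment> \<open>Symmetry and a shift of the hat turn the mixed term on the right of the new
      step into the one on the left of the previous step.\<close>
    then have sh: "hat_mean h (G (a + 2 * h)) (G (a + h)) (a + h) \<le> hat_mean h (G (a + h)) (G (a + 2 * h)) a + L * h * (m (a + 3 * h))\<^sup>2"
      using hat_mean_shift[OF G2 h a] hat_mean_commute[of h "G (a + 2 * h)" "G (a + h)"] by (simp add: mult.assoc abs_le_iff)
    have st: "(L2_norm S (\<lambda>x. Z (a + 3 * h) x - Z (a + 2 * h) x))\<^sup>2 / h\<^sup>2 + hat_mean h (G (a + 2 * h)) (G (a + 3 * h)) (a + h)
      \<le> (L2_norm S (\<lambda>x. Z (a + 2 * h) x - Z (a + h) x))\<^sup>2 / h\<^sup>2 + hat_mean h (G (a + 2 * h)) (G (a + h)) (a + h)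
        + hi * (A (a + 3 * h) - A (a + h))\<^sup>2 + 2 * E * h * (m (a + 3 * h))\<^sup>2"
    proof -
      have e: "a + h + 2 * h = a + 3 * h" "a + h + h = a + 2 * h" by simp_all
      show ?thesis by (rule energy_step[OF h, of "a + h", unfolded e]) (use a h in simp_all)
    qed
    have sq': "hi * (A (a + 3 * h) - A (a + h))\<^sup>2 \<le> hi * \<delta> * (A (a + 3 * h) - A (a + h))"
      using sq[of "a + h"] a h by (simp add: add.assoc)
    have ex': "2 * E * h * (m (a + 3 * h))\<^sup>2 + L * h * (m (a + 3 * h))\<^sup>2 \<le> (2 * E + L) * k\<^sup>2 / lam * (exp (lam * (a + 4 * h)) - exp (lam * (a + 3 * h)))"
      using ex[of "2 * E + L" "a + 3 * h"] E L by (simp add: algebra_simps)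
    define c where "c = (2 * E + L) * k\<^sup>2 / lam"
    show ?case
      unfolding eqs using IH sh st sq' ex'
      unfolding c_def[symmetric] right_diff_distrib distrib_left by linarith
  }
qed

theorem energy_inequality:
  assumes \<tau>: "0 < \<tau>" "\<tau> < T"
  shows "(L2_norm S (v \<tau>))\<^sup>2 + lo * (L2_norm S (G \<tau>))\<^sup>2 \<le> (2 * E + L) * k\<^sup>2 / lam * exp (lam * \<tau>)"
proof -
  define c where "c = (2 * E + L) * k\<^sup>2 / lam"
  have c: "0 \<le> c" using E L lam by (simp add: c_def)
  define B where "B = A T - A 0"
  have Amono: "A s \<le> A t" if "0 \<le> s" "s \<le> t" "t \<le> T" for s t
    using order_trans[OF L2_norm_nonneg G_A[OF that]] by simp
  let ?V = "L2_norm S (v \<tau>)" and ?G = "L2_norm S (G \<tau>)"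
  \<comment> \<open>All errors are collected for a fixed \<epsilon>. The maximum with
    \<open>0\<close> keeps squaring monotone when \<epsilon> exceeds the norm of
    \<open>v \<tau>\<close>.\<close>
  have main: "(max 0 (?V - \<epsilon>))\<^sup>2 + lo * ?G\<^sup>2 - hi * ?G * \<epsilon> \<le> \<epsilon>\<^sup>2 + hi * \<epsilon> * (2 * B) + c * exp (lam * (\<tau> + 2 * \<epsilon>))"
    if \<epsilon>: "0 < \<epsilon>" for \<epsilon>
  proof -
    obtain d0 where d0: "d0 > 0" "\<And>r. r \<in> {0..T} \<Longrightarrow> \<bar>r - 0\<bar> < d0 \<Longrightarrow> L2_norm S (\<lambda>x. v r x - v 0 x) < \<epsilon>"
      using v_eps[of 0 \<epsilon>] \<epsilon> \<tau> by auto
    obtain d1 where d1: "d1 > 0" "\<And>r. r \<in> {0..T} \<Longrightarrow> \<bar>r - \<tau>\<bar> < d1 \<Longrightarrow> L2_norm S (\<lambda>x. v r x - v \<tau> x) < \<epsilon>"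
      using v_eps[of \<tau> \<epsilon>] \<epsilon> \<tau> by auto
    obtain d2 where d2: "d2 > 0" "\<And>s t. s \<in> {0..T} \<Longrightarrow> t \<in> {0..T} \<Longrightarrow> dist t s < d2 \<Longrightarrow> dist (A t) (A s) < \<epsilon>"
      using compact_uniformly_continuous[OF A_continuous] \<epsilon> unfolding uniformly_continuous_on_def by auto
    \<comment> \<open>In turn: \<open>d0\<close> makes the velocity small during the initial step,
      \<open>d1\<close> controls the final difference quotient, \<open>d2\<close> is halved because
      increments of \<open>A\<close> are taken over \<open>2 * h\<close>, \<epsilon> bounds the
      shift in the exponent, and \<open>T - \<tau>\<close> keeps \<open>\<tau> + h\<close> in the
      time interval.\<close>
    define D where "D = min (min d0 d1) (min (d2 / 2) (min \<epsilon> (T - \<tau>)))"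
    have D: "D > 0" "D \<le> d0" "D \<le> d1" "D \<le> d2 / 2" "D \<le> \<epsilon>" "D \<le> T - \<tau>"
      using d0(1) d1(1) d2(1) \<epsilon> \<tau> by (auto simp: D_def min_def)
    obtain n :: nat where n: "\<tau> / D < real n" using reals_Archimedean2 by blast
    \<comment> \<open>This makes \<tau> the grid point \<open>(n + 1) * h\<close>, the left end of
      the last difference quotient and the midpoint of the last double step.\<close>
    define h where "h = \<tau> / (real n + 1)"
    have h: "0 < h" "h < D"
    proof -
      show "0 < h" using \<tau> by (simp add: h_def)
      have "\<tau> < D * (real n + 1)" using n D(1) by (simp add: field_simps)
      then show "h < D" using D(1) by (simp add: h_def field_simps)
    qed
    have hn: "(real n + 1) * h = \<tau>" by (simp add: h_def)
    then have hn2: "(real n + 2) * h = \<tau> + h" "(real n + 3) * h = \<tau> + 2 * h" by (simp_all add: algebra_simps)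
    have \<tau>h: "\<tau> + h \<le> T" using h D by simp
    have \<delta>: "A t - A s \<le> \<epsilon>" if "0 \<le> s" "s \<le> t" "t \<le> T" "t \<le> s + 2 * h" for s t
      using d2(2)[of s t] that h D by (auto simp: dist_real_def)
    note es = energy_sum[OF h(1) \<delta>, of n, unfolded hn hn2, OF _ _ _ _ \<tau>h, folded c_def]
    have v0: "L2_norm S (\<lambda>x. Z h x - Z 0 x) \<le> h * \<epsilon>"
    proof -
      have "L2_norm S (v r) \<le> \<epsilon>" if "0 \<le> r" "r \<le> h" for r
      proof -
        have r: "r \<in> {0..T}" "\<bar>r - 0\<bar> < d0" using that h D \<tau>h \<tau> by auto
        have "L2_norm S (v r) - L2_norm S (v 0) \<le> L2_norm S (\<lambda>x. v r x - v 0 x)"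
          using L2_norm_diff_ineq[of "v r" "v 0"] r \<tau> by (simp add: v_L2 abs_le_iff)
        then show ?thesis using d0(2)[OF r] v_0 by simp
      qed
      then show ?thesis using primitive_bound[of 0 h \<epsilon>] h \<tau>h \<tau> by simp
    qed
    have first: "(L2_norm S (\<lambda>x. Z h x - Z 0 x))\<^sup>2 / h\<^sup>2 \<le> \<epsilon>\<^sup>2"
    proof -
      have "(L2_norm S (\<lambda>x. Z h x - Z 0 x))\<^sup>2 \<le> (h * \<epsilon>)\<^sup>2" using v0 by (intro power_mono) auto
      then show ?thesis using h by (simp add: power_mult_distrib pos_divide_le_eq mult.commute)
    qed
    have last: "(max 0 (?V - \<epsilon>))\<^sup>2 \<le> (L2_norm S (\<lambda>x. Z (\<tau> + h) x - Z \<tau> x))\<^sup>2 / h\<^sup>2"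
    proof -
      have vt: "v \<tau> \<in> L2 S" using \<tau> by (intro v_L2) auto
      have Zd: "(\<lambda>x. Z (\<tau> + h) x - Z \<tau> x) \<in> L2 S" using \<tau> \<tau>h h by (intro L2_diff Z_L2) auto
      have "L2_norm S (\<lambda>x. Z (\<tau> + h) x - Z \<tau> x - (\<tau> + h - \<tau>) * v \<tau> x) \<le> (\<tau> + h - \<tau>) * \<epsilon>"
        using \<tau> \<tau>h h D d1(2) by (intro primitive_approx vt) (auto intro!: less_imp_le[OF d1(2)])
      then have "h * ?V - L2_norm S (\<lambda>x. Z (\<tau> + h) x - Z \<tau> x) \<le> h * \<epsilon>"
        using L2_norm_diff_ineq[OF Zd L2_scale[OF vt, of h]] h by (simp add: L2_norm_scale abs_le_iff)
      then have "h * max 0 (?V - \<epsilon>) \<le> L2_norm S (\<lambda>x. Z (\<tau> + h) x - Z \<tau> x)"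
        using h by (simp add: max_def algebra_simps)
      then have "(h * max 0 (?V - \<epsilon>))\<^sup>2 \<le> (L2_norm S (\<lambda>x. Z (\<tau> + h) x - Z \<tau> x))\<^sup>2"
        using h by (intro power_mono) auto
      then show ?thesis using h by (simp add: power_mult_distrib pos_le_divide_eq mult.commute)
    qed
    \<comment> \<open>Coercivity is recovered here: the second gradient is replaced by the first one
      at the cost of an increment of \<open>A\<close>.\<close>
    have hm: "lo * ?G\<^sup>2 - hi * ?G * \<epsilon> \<le> hat_mean h (G \<tau>) (G (\<tau> + h)) (real n * h)"
    proof -
      have g: "G \<tau> \<in> L2 S" "G (\<tau> + h) \<in> L2 S" using \<tau> \<tau>h h by (auto intro!: G_L2)
      have "L2_norm S (\<lambda>x. G (\<tau> + h) x - G \<tau> x) \<le> \<epsilon>"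
        using G_A[of \<tau> "\<tau> + h"] \<delta>[of \<tau> "\<tau> + h"] \<tau> \<tau>h h by simp
      then have "hi * ?G * L2_norm S (\<lambda>x. G (\<tau> + h) x - G \<tau> x) \<le> hi * ?G * \<epsilon>"
        using hi by (intro mult_left_mono) auto
      then have "\<bar>hat_mean h (G \<tau>) (\<lambda>x. G (\<tau> + h) x - G \<tau> x) (real n * h)\<bar> \<le> hi * ?G * \<epsilon>"
        using hat_mean_bound[OF g(1) L2_diff[OF g(2,1)] h(1), of "real n * h"] by simp
      then show ?thesis
        using hat_mean_coercive[OF g(1) h(1), of "real n * h"] hat_mean_diff_right[OF g(1,2,1), of h "real n * h"] h
        by (simp add: abs_le_iff)
    qed
    have "hi * \<epsilon> * (A (\<tau> + h) + A \<tau> - A h - A 0) \<le> hi * \<epsilon> * (2 * B)"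
      using Amono[of "\<tau> + h" T] Amono[of \<tau> T] Amono[of 0 h] hi \<epsilon> \<tau> \<tau>h h
      by (intro mult_left_mono) (auto simp: B_def)
    moreover have "c * (exp (lam * (\<tau> + 2 * h)) - exp (lam * (2 * h))) \<le> c * exp (lam * (\<tau> + 2 * \<epsilon>))"
    proof (rule mult_left_mono[OF _ c])
      have "exp (lam * (\<tau> + 2 * h)) \<le> exp (lam * (\<tau> + 2 * \<epsilon>))" using lam h D by simp
      then show "exp (lam * (\<tau> + 2 * h)) - exp (lam * (2 * h)) \<le> exp (lam * (\<tau> + 2 * \<epsilon>))"
        using exp_gt_zero[of "lam * (2 * h)"] by linarith
    qed
    ultimately show ?thesis using es first last hm by linarith
  qed
  have "?V\<^sup>2 + lo * ?G\<^sup>2 \<le> c * exp (lam * \<tau>)"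
  proof (rule tendsto_le[OF trivial_limit_at_right_real])
    have "((\<lambda>\<epsilon>. \<epsilon>\<^sup>2 + hi * \<epsilon> * (2 * B) + c * exp (lam * (\<tau> + 2 * \<epsilon>))) \<longlongrightarrow>
        0\<^sup>2 + hi * 0 * (2 * B) + c * exp (lam * (\<tau> + 2 * 0))) (at_right 0)"
      by (intro tendsto_intros)
    then show "((\<lambda>\<epsilon>. \<epsilon>\<^sup>2 + hi * \<epsilon> * (2 * B) + c * exp (lam * (\<tau> + 2 * \<epsilon>))) \<longlongrightarrow> c * exp (lam * \<tau>)) (at_right 0)"
      by simp
    have "((\<lambda>\<epsilon>. (max 0 (?V - \<epsilon>))\<^sup>2 + lo * ?G\<^sup>2 - hi * ?G * \<epsilon>) \<longlongrightarrow> (max 0 (?V - 0))\<^sup>2 + lo * ?G\<^sup>2 - hi * ?G * 0) (at_right 0)"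
      by (intro tendsto_intros)
    then show "((\<lambda>\<epsilon>. (max 0 (?V - \<epsilon>))\<^sup>2 + lo * ?G\<^sup>2 - hi * ?G * \<epsilon>) \<longlongrightarrow> ?V\<^sup>2 + lo * ?G\<^sup>2) (at_right 0)"
      by (simp add: max_def)
    show "\<forall>\<^sub>F \<epsilon> in at_right 0. (max 0 (?V - \<epsilon>))\<^sup>2 + lo * ?G\<^sup>2 - hi * ?G * \<epsilon> \<le> \<epsilon>\<^sup>2 + hi * \<epsilon> * (2 * B) + c * exp (lam * (\<tau> + 2 * \<epsilon>))"
      using main by (auto simp: eventually_at_filter)
  qed
  then show ?thesis by (simp add: c_def)
qed

end

section \<open>Solutions and their time primitives\<close>

context bounded_open
begin

lemma seminormed_L2: "seminormed_space (L2 S :: ('a \<Rightarrow> real) set) (L2_norm S)"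
  by unfold_locales (auto intro: L2_add L2_scale L2_norm_triangle simp: L2_norm_scale)

lemma seminormed_H10: "seminormed_space (H10 S) (H1_norm S)"
  by unfold_locales
    (auto intro: H10_zero H10_add H10_scale H1_norm_triangle H1_norm_scale H10_imp_H1)

lemma H10_dual_bound:
  assumes F: "F \<in> H10_dual S" and u: "u \<in> H10 S"
  shows "\<bar>F u\<bar> \<le> H10_dual_norm S F * H1_norm S u" and "0 \<le> H10_dual_norm S F"
proof -
  obtain C where C: "\<And>u. u \<in> H10 S \<Longrightarrow> \<bar>F u\<bar> \<le> C * H1_norm S u"
    using F unfolding H10_dual_def by blast
  have scale: "F (\<lambda>x. c * u x) = c * F u" if "u \<in> H10 S" for c u
    using F that by (auto simp: H10_dual_def)
  \<comment> \<open>The supremum of a set of reals means something only for a set bounded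
    above.\<close>
  have bdd: "bdd_above ((\<lambda>u. \<bar>F u\<bar>) ` {u \<in> H10 S. H1_norm S u \<le> 1})"
  proof (rule bdd_aboveI2)
    fix u assume u: "u \<in> {u \<in> H10 S. H1_norm S u \<le> 1}"
    have "\<bar>F u\<bar> \<le> \<bar>C\<bar> * H1_norm S u"
      using C[of u] u mult_right_mono[OF abs_ge_self[of C] H1_norm_nonneg[of u]] by simp
    also have "\<dots> \<le> \<bar>C\<bar> * 1" using u by (intro mult_left_mono) auto
    finally show "\<bar>F u\<bar> \<le> \<bar>C\<bar>" by simp
  qed
  have upper: "\<bar>F u\<bar> \<le> H10_dual_norm S F" if "u \<in> H10 S" "H1_norm S u \<le> 1" for u
    unfolding H10_dual_norm_def using that by (intro cSUP_upper bdd) auto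
  have n0: "H1_norm S (\<lambda>_. 0) = 0"
    using H1_norm_scale[OF H10_imp_H1[OF H10_zero], of 0] by simp
  show "0 \<le> H10_dual_norm S F"
    using upper[OF H10_zero] n0 by simp
  show "\<bar>F u\<bar> \<le> H10_dual_norm S F * H1_norm S u"
  proof (cases "H1_norm S u = 0")
    case True
    \<comment> \<open>An element of seminorm zero cannot be normalised; boundedness of the
      functional makes its value zero.\<close>
    then show ?thesis using C[OF u] by simp
  next
    case False
    then have pos: "0 < H1_norm S u" using H1_norm_nonneg[of u] by linarith
    let ?u = "\<lambda>x. 1 / H1_norm S u * u x"
    have "H1_norm S ?u = 1" using H1_norm_scale[OF H10_imp_H1[OF u], of "1 / H1_norm S u"] pos by simp
    then have "\<bar>F ?u\<bar> \<le> H10_dual_norm S F" by (intro upper[OF H10_scale[OF u]]) simp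
    then show ?thesis unfolding scale[OF u] using pos by (simp add: abs_mult field_simps)
  qed
qed

lemma fun_space_H10_dual: "fun_space (H10_dual S)"
proof
  show "(\<lambda>_. 0) \<in> H10_dual S" by (auto simp: H10_dual_def intro: exI[of _ 0])
next
  fix F G assume F: "F \<in> H10_dual S" and G: "G \<in> H10_dual S"
  have "\<bar>F u + G u\<bar> \<le> (H10_dual_norm S F + H10_dual_norm S G) * H1_norm S u" if "u \<in> H10 S" for u
    using H10_dual_bound(1)[OF F that] H10_dual_bound(1)[OF G that] by (simp add: distrib_right)
  then have "\<exists>C. \<forall>u\<in>H10 S. \<bar>F u + G u\<bar> \<le> C * H1_norm S u" by blast
  then show "(\<lambda>x. F x + G x) \<in> H10_dual S"
    using F G by (auto simp: H10_dual_def distrib_left)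
next
  fix F c assume F: "F \<in> H10_dual S"
  have "\<bar>c * F u\<bar> \<le> (\<bar>c\<bar> * H10_dual_norm S F) * H1_norm S u" if "u \<in> H10 S" for u
    using mult_left_mono[OF H10_dual_bound(1)[OF F that], of "\<bar>c\<bar>"] by (simp add: abs_mult mult.assoc)
  then have "\<exists>C. \<forall>u\<in>H10 S. \<bar>c * F u\<bar> \<le> C * H1_norm S u" by blast
  then show "(\<lambda>x. c * F x) \<in> H10_dual S"
    using F by (auto simp: H10_dual_def distrib_left)
qed

text \<open>The added \<open>1\<close> makes the constant positive, as the exchange with the Bochner
  integral divides by it.\<close>

lemma L2_functional:
  fixes \<eta> :: "'a \<Rightarrow> real"
  assumes \<eta>: "\<eta> \<in> L2 S"
  shows "linear_functional (L2 S) (\<lambda>u. L2_inner S u \<eta>)"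
    and "u \<in> L2 S \<Longrightarrow> \<bar>L2_inner S u \<eta>\<bar> \<le> (L2_norm S \<eta> + 1) * L2_norm S u"
proof -
  interpret seminormed_space "L2 S :: ('a \<Rightarrow> real) set" "L2_norm S" by (rule seminormed_L2)
  show "linear_functional (L2 S) (\<lambda>u. L2_inner S u \<eta>)"
    by unfold_locales (use \<eta> in \<open>auto simp: L2_inner_add_left L2_inner_scale_left\<close>)
  show "\<bar>L2_inner S u \<eta>\<bar> \<le> (L2_norm S \<eta> + 1) * L2_norm S u" if "u \<in> L2 S"
    using L2_Cauchy_Schwarz[OF that \<eta>] L2_norm_nonneg[of u]
    unfolding distrib_right mult.commute[of "L2_norm S u"] by linarith
qed

lemma H10_L2_functional:
  assumes \<eta>: "\<eta> \<in> L2 S"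
  shows "linear_functional (H10 S) (\<lambda>u. L2_inner S u \<eta>)"
    and "u \<in> H10 S \<Longrightarrow> \<bar>L2_inner S u \<eta>\<bar> \<le> (L2_norm S \<eta> + 1) * H1_norm S u"
proof -
  interpret seminormed_space "H10 S" "H1_norm S" by (rule seminormed_H10)
  show "linear_functional (H10 S) (\<lambda>u. L2_inner S u \<eta>)"
    by unfold_locales (use \<eta> in \<open>auto simp: L2_inner_add_left L2_inner_scale_left H10_imp_L2\<close>)
  show "\<bar>L2_inner S u \<eta>\<bar> \<le> (L2_norm S \<eta> + 1) * H1_norm S u" if "u \<in> H10 S"
    using L2_functional(2)[OF \<eta> H10_imp_L2[OF that]] L2_norm_le_H1_norm[of u] L2_norm_nonneg[of \<eta>]
    by (meson add_nonneg_nonneg mult_left_mono order_trans zero_le_one)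
qed

text \<open>This functional carries gradients through the Bochner integral in \<open>H10\<close>.
  The choice inside \<open>grad\<close> does not disturb linearity, because the pairing ignores null
  sets.\<close>

lemma grad_functional:
  assumes \<xi>: "\<xi> \<in> L2 S"
  shows "linear_functional (H10 S) (\<lambda>u. L2_inner S (grad S u) \<xi>)"
    and "u \<in> H10 S \<Longrightarrow> \<bar>L2_inner S (grad S u) \<xi>\<bar> \<le> L2_norm S \<xi> * H1_norm S u"
proof -
  interpret seminormed_space "H10 S" "H1_norm S" by (rule seminormed_H10)
  note g = grad_weak_gradient(1)[OF H10_imp_H1]
  have add: "L2_inner S (grad S (\<lambda>x. u x + v x)) \<xi> = L2_inner S (grad S u) \<xi> + L2_inner S (grad S v) \<xi>"
    if u: "u \<in> H10 S" and v: "v \<in> H10 S" for u v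
  proof -
    have ae: "AE x in M. grad S u x + grad S v x = grad S (\<lambda>x. u x + v x) x"
      using H1_add(2)[OF H10_imp_H1[OF u] H10_imp_H1[OF v]] by eventually_elim simp
    from L2_inner_AE_left[OF L2_add[OF g[OF u] g[OF v]] this \<xi>] show ?thesis
      using g[OF u] g[OF v] \<xi> by (simp add: L2_inner_add_left)
  qed
  have scale: "L2_inner S (grad S (\<lambda>x. c * u x)) \<xi> = c * L2_inner S (grad S u) \<xi>" if u: "u \<in> H10 S" for u c
  proof -
    have ae: "AE x in M. c *\<^sub>R grad S u x = grad S (\<lambda>x. c * u x) x"
      using H1_scale(2)[OF H10_imp_H1[OF u], of c] by eventually_elim simp
    from L2_inner_AE_left[OF L2_scaleR[OF g[OF u]] this \<xi>] show ?thesis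
      by (simp add: L2_inner_scaleR_left)
  qed
  show "linear_functional (H10 S) (\<lambda>u. L2_inner S (grad S u) \<xi>)"
    by unfold_locales (use add scale in auto)
  show "\<bar>L2_inner S (grad S u) \<xi>\<bar> \<le> L2_norm S \<xi> * H1_norm S u" if "u \<in> H10 S"
    using L2_Cauchy_Schwarz[OF g[OF that] \<xi>] mult_left_mono[OF grad_norm_le_H1_norm[of u] L2_norm_nonneg[of \<xi>]]
    by (simp add: mult.commute)
qed

text \<open>Evaluation at a fixed \<eta> reduces the second time derivative, which takes values in
  the dual, to a real function of time.\<close>

lemma evaluation_functional:
  assumes \<eta>: "\<eta> \<in> H10 S"
  shows "linear_functional (H10_dual S) (\<lambda>F. F \<eta>)"
    and "F \<in> H10_dual S \<Longrightarrow> \<bar>F \<eta>\<bar> \<le> (H1_norm S \<eta> + 1) * H10_dual_norm S F"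
proof -
  interpret fun_space "H10_dual S" by (rule fun_space_H10_dual)
  show "linear_functional (H10_dual S) (\<lambda>F. F \<eta>)" by unfold_locales auto
  show "\<bar>F \<eta>\<bar> \<le> (H1_norm S \<eta> + 1) * H10_dual_norm S F" if "F \<in> H10_dual S"
    using H10_dual_bound[OF that \<eta>] by (simp add: algebra_simps)
qed

text \<open>Pairing with \<eta> turns the vector-valued distributional derivative into a real one,
  and the du Bois-Reymond lemma integrates it.\<close>

lemma weak_time_deriv_L2:
  assumes u: "u \<in> continuous_into {0..T} (L2 S) (L2_norm S)" and v: "v \<in> continuous_into {0..T} (L2 S) (L2_norm S)"
    and d: "weak_time_deriv T (L2 S) (L2_norm S) u v"
    and st: "0 \<le> s" "s \<le> t" "t \<le> T" and \<eta>: "\<eta> \<in> L2 S"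
  shows "L2_inner S (\<lambda>x. u t x - u s x) \<eta> = integral {s..t} (\<lambda>r. L2_inner S (v r) \<eta>)"
proof -
  interpret linear_functional "L2 S" "\<lambda>u. L2_inner S u \<eta>" by (rule L2_functional(1)[OF \<eta>])
  have C: "0 < L2_norm S \<eta> + 1" using L2_norm_nonneg[of \<eta>] by linarith
  note fb = functional_bochner_integral[OF _ _ L2_functional(2)[OF \<eta>] C]
  have "L2_inner S (u t) \<eta> - L2_inner S (u s) \<eta> = integral {s..t} (\<lambda>r. L2_inner S (v r) \<eta>)"
  proof (rule du_Bois_Reymond[OF continuous_into_inner[OF u \<eta>]
        integrable_lebesgue_on_open_interval[OF continuous_into_inner[OF v \<eta>]] _ st])
    fix \<phi> assume "\<phi> \<in> test_functions {0<..<T}"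
    then obtain I where I: "has_bochner_integral_in (lebesgue_on {0<..<T}) (L2 S) (L2_norm S) (\<lambda>t x. deriv \<phi> t * u t x) I"
      "has_bochner_integral_in (lebesgue_on {0<..<T}) (L2 S) (L2_norm S) (\<lambda>t x. \<phi> t * v t x) (\<lambda>x. - I x)"
      using d by (auto simp: weak_time_deriv_def)
    have "L2_inner S (\<lambda>x. - I x) \<eta> = - L2_inner S I \<eta>"
      using L2_inner_scale_left[of "-1" I \<eta>] by simp
    then show "(\<integral>x. deriv \<phi> x * L2_inner S (u x) \<eta> \<partial>lebesgue_on {0<..<T}) = - (\<integral>x. \<phi> x * L2_inner S (v x) \<eta> \<partial>lebesgue_on {0<..<T})"
      using fb(2)[OF _ I(1)] fb(2)[OF _ I(2)] by (simp add: L2_inner_scale_left)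
  qed
  then show ?thesis using u st \<eta> by (simp add: L2_inner_diff_left continuous_into_mem)
qed

text \<open>The same reduction in the dual. Integrability of the scalar function comes from square
  integrability of the dual norm on a finite interval.\<close>

lemma weak_time_deriv_dual:
  assumes v: "v \<in> continuous_into {0..T} (L2 S) (L2_norm S)"
    and w: "w \<in> bochner_L2 (lebesgue_on {0<..<T}) (H10_dual S) (H10_dual_norm S)"
    and d: "weak_time_deriv T (H10_dual S) (H10_dual_norm S) (\<lambda>t \<eta>. L2_inner S (v t) \<eta>) w"
    and \<eta>: "\<eta> \<in> H10 S"
  shows "integrable (lebesgue_on {0<..<T}) (\<lambda>t. w t \<eta>)"
    and "0 \<le> s \<Longrightarrow> s \<le> t \<Longrightarrow> t \<le> T \<Longrightarrow> L2_inner S (\<lambda>x. v t x - v s x) \<eta> = integral {s..t} (\<lambda>r. w r \<eta>)"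
proof -
  let ?I = "lebesgue_on {0<..<T}"
  interpret linear_functional "H10_dual S" "\<lambda>F. F \<eta>" by (rule evaluation_functional(1)[OF \<eta>])
  have C: "0 < H1_norm S \<eta> + 1" using H1_norm_nonneg[of \<eta>] by linarith
  have fb: "(\<integral>t. u t \<eta> \<partial>?I) = J \<eta>"
    if "has_bochner_integral_in ?I (H10_dual S) (H10_dual_norm S) u J" for u J
    by (rule functional_bochner_integral(2)[where N = "H10_dual_norm S", OF _ that evaluation_functional(2)[OF \<eta>] C]) auto
  have sm: "strongly_measurable ?I (H10_dual S) (H10_dual_norm S) w"
    and sq: "integrable ?I (\<lambda>t. (H10_dual_norm S (w t))\<^sup>2)"
    using w by (auto simp: bochner_L2_def)
  interpret I: finite_measure ?I by (rule finite_measure_lebesgue_on) simp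
  show int: "integrable ?I (\<lambda>t. w t \<eta>)"
  proof (rule Bochner_Integration.integrable_bound)
    show "integrable ?I (\<lambda>t. (H1_norm S \<eta> + 1) * (1 + (H10_dual_norm S (w t))\<^sup>2))"
      using sq by simp
    show "(\<lambda>t. w t \<eta>) \<in> borel_measurable ?I"
      by (rule functional_measurable[OF _ sm evaluation_functional(2)[OF \<eta>]]) auto
    have "AE t in ?I. w t \<in> H10_dual S" using sm by (simp add: strongly_measurable_def)
    then show "AE t in ?I. norm (w t \<eta>) \<le> norm ((H1_norm S \<eta> + 1) * (1 + (H10_dual_norm S (w t))\<^sup>2))"
    proof eventually_elim
      case (elim t)
      have "y \<le> 1 + y\<^sup>2" for y :: real
        using zero_le_power2[of "y - 1"] zero_le_power2[of y]
        unfolding power2_diff one_power2 mult_1_right by linarith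
      then have "\<bar>w t \<eta>\<bar> \<le> (H1_norm S \<eta> + 1) * (1 + (H10_dual_norm S (w t))\<^sup>2)"
        by (intro order_trans[OF evaluation_functional(2)[OF \<eta> elim] mult_left_mono]) (use C in auto)
      from order_trans[OF this abs_ge_self] show ?case by (simp only: real_norm_def)
    qed
  qed
  assume st: "0 \<le> s" "s \<le> t" "t \<le> T"
  have \<eta>2: "\<eta> \<in> L2 S" using \<eta> by (rule H10_imp_L2)
  have "L2_inner S (v t) \<eta> - L2_inner S (v s) \<eta> = integral {s..t} (\<lambda>r. w r \<eta>)"
  proof (rule du_Bois_Reymond[OF continuous_into_inner[OF v \<eta>2] int _ st])
    fix \<phi> assume "\<phi> \<in> test_functions {0<..<T}"
    then obtain I where I: "has_bochner_integral_in ?I (H10_dual S) (H10_dual_norm S) (\<lambda>t x. deriv \<phi> t * L2_inner S (v t) x) I"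
      "has_bochner_integral_in ?I (H10_dual S) (H10_dual_norm S) (\<lambda>t x. \<phi> t * w t x) (\<lambda>x. - I x)"
      using d by (auto simp: weak_time_deriv_def)
    show "(\<integral>x. deriv \<phi> x * L2_inner S (v x) \<eta> \<partial>?I) = - (\<integral>x. \<phi> x * w x \<eta> \<partial>?I)"
      using fb[OF I(1)] fb[OF I(2)] by simp
  qed
  then show "L2_inner S (\<lambda>x. v t x - v s x) \<eta> = integral {s..t} (\<lambda>r. w r \<eta>)"
    using v st \<eta>2 by (simp add: L2_inner_diff_left continuous_into_mem)
qed

end

lemma strongly_measurable_subset:
  assumes u: "strongly_measurable (lebesgue_on B) V N u" and AB: "A \<subseteq> B" "A \<in> sets lebesgue" "B \<in> sets lebesgue"
  shows "strongly_measurable (lebesgue_on A) V N u"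
proof -
  obtain s where s: "\<And>n. simple_function (lebesgue_on B) (s n)" "\<And>n. s n ` B \<subseteq> V"
    and lim: "AE t in lebesgue_on B. (\<lambda>n. N (\<lambda>x. s n t x - u t x)) \<longlonglongrightarrow> 0"
    and uV: "AE t in lebesgue_on B. u t \<in> V"
    using u by (auto simp: strongly_measurable_def)
  have "simple_function (lebesgue_on A) (s n)" for n
    unfolding simple_function_def
  proof (intro conjI ballI)
    show "finite (s n ` space (lebesgue_on A))"
      using simple_functionD(1)[OF s(1)[of n]] AB(1) by (auto intro: finite_subset[OF image_mono])
    fix x
    have "s n -` {x} \<inter> B \<in> sets lebesgue"
      using simple_functionD(2)[OF s(1)[of n], of "{x}"] AB(3) by (auto simp: sets_restrict_space_iff)
    then have "(s n -` {x} \<inter> B) \<inter> A \<in> sets lebesgue" using AB(2) by blast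
    moreover have "(s n -` {x} \<inter> B) \<inter> A = s n -` {x} \<inter> A" using AB(1) by auto
    ultimately show "s n -` {x} \<inter> space (lebesgue_on A) \<in> sets (lebesgue_on A)"
      using AB(2) by (simp add: sets_restrict_space_iff)
  qed
  moreover have "s n ` space (lebesgue_on A) \<subseteq> V" for n
    using image_mono[OF AB(1), of "s n"] s(2)[of n] by simp
  ultimately show ?thesis
    unfolding strongly_measurable_def
    using AE_lebesgue_on_subset[OF uV AB] AE_lebesgue_on_subset[OF lim AB]
    by (intro conjI exI[of _ s] allI) auto
qed

context bounded_open
begin

text \<open>\<open>J t\<close> is the Bochner integral of \<open>v\<close> in \<open>H10 S\<close> from \<open>0\<close> to \<open>t\<close>, and \<open>A t\<close> the integral of \<open>H1_norm S (v r)\<close>.\<close>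
lemma H10_primitive:
  assumes u: "u \<in> continuous_into {0..T} (L2 S) (L2_norm S)" and v: "v \<in> continuous_into {0..T} (L2 S) (L2_norm S)"
    and vH: "v \<in> bochner_L2 (lebesgue_on {0<..<T}) (H10 S) (H1_norm S)"
    and d: "weak_time_deriv T (L2 S) (L2_norm S) u v"
  obtains J A where
    "\<And>t. 0 \<le> t \<Longrightarrow> t \<le> T \<Longrightarrow> J t \<in> H10 S"
    "\<And>t. 0 \<le> t \<Longrightarrow> t \<le> T \<Longrightarrow> AE x in M. J t x = u t x - u 0 x"
    "\<And>s t \<eta>. 0 \<le> s \<Longrightarrow> s \<le> t \<Longrightarrow> t \<le> T \<Longrightarrow> \<eta> \<in> L2 S \<Longrightarrow>
      L2_inner S (\<lambda>x. J t x - J s x) \<eta> = integral {s..t} (\<lambda>r. L2_inner S (v r) \<eta>)"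
    "continuous_on {0..T} A"
    "\<And>s t. 0 \<le> s \<Longrightarrow> s \<le> t \<Longrightarrow> t \<le> T \<Longrightarrow> L2_norm S (\<lambda>x. grad S (J t) x - grad S (J s) x) \<le> A t - A s"
proof -
  let ?I = "\<lambda>t. lebesgue_on {0<..<t}"
  interpret H: seminormed_space "H10 S" "H1_norm S" by (rule seminormed_H10)
  interpret IT: finite_measure "?I T" by (rule finite_measure_lebesgue_on) simp
  have sm: "strongly_measurable (?I T) (H10 S) (H1_norm S) v"
    and sq: "integrable (?I T) (\<lambda>t. (H1_norm S (v t))\<^sup>2)"
    using vH by (auto simp: bochner_L2_def)
  have Nint: "integrable (?I T) (\<lambda>t. H1_norm S (v t))"
  proof (rule Bochner_Integration.integrable_bound)
    show "integrable (?I T) (\<lambda>t. 1 + (H1_norm S (v t))\<^sup>2)" using sq by simp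
    have "(\<lambda>t. sqrt ((H1_norm S (v t))\<^sup>2)) \<in> borel_measurable (?I T)"
      by (rule measurable_compose[OF borel_measurable_integrable[OF sq] borel_measurable_sqrt])
    then show "(\<lambda>t. H1_norm S (v t)) \<in> borel_measurable (?I T)" by simp
    have "y \<le> 1 + y\<^sup>2" for y :: real
      using zero_le_power2[of "y - 1"] zero_le_power2[of y]
        unfolding power2_diff one_power2 mult_1_right by linarith
    then show "AE t in ?I T. norm (H1_norm S (v t)) \<le> norm (1 + (H1_norm S (v t))\<^sup>2)" by simp
  qed
  \<comment> \<open>The velocity is integrated in \<open>H10\<close> up to each time separately, so
    the values exist for every \<open>t\<close>.\<close>
  have "\<exists>I. has_bochner_integral_in (?I t) (H10 S) (H1_norm S) v I" if t: "0 \<le> t" "t \<le> T" for t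
  proof (rule H.has_bochner_integral_in_exists)
    show "\<exists>g\<in>H10 S. (\<lambda>n. H1_norm S (\<lambda>x. f n x - g x)) \<longlonglongrightarrow> 0"
      if "\<And>n. f n \<in> H10 S" "\<And>e. e > 0 \<Longrightarrow> \<exists>k. \<forall>m\<ge>k. \<forall>n\<ge>k. H1_norm S (\<lambda>x. f m x - f n x) < e" for f
      using H10_complete[OF that] by blast
    show "finite_measure (?I t)" by (rule finite_measure_lebesgue_on) simp
    show "strongly_measurable (?I t) (H10 S) (H1_norm S) v"
      by (rule strongly_measurable_subset[OF sm]) (use t in auto)
    have "integrable (?I t) (\<lambda>r. H1_norm S (v r))"
      using integral_lebesgue_on_subinterval(1)[OF Nint, of 0 t] t by simp
    then show "(\<integral>\<^sup>+r. ennreal (H1_norm S (v r)) \<partial>?I t) < \<infinity>"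
      by (simp add: nn_integral_eq_integral)
  qed
  then obtain J where J: "\<And>t. 0 \<le> t \<Longrightarrow> t \<le> T \<Longrightarrow> has_bochner_integral_in (?I t) (H10 S) (H1_norm S) v (J t)"
    by metis
  have JH: "J t \<in> H10 S" if "0 \<le> t" "t \<le> T" for t
    using J[OF that] by (simp add: has_bochner_integral_in_def)
  have vint: "(\<lambda>r. L2_inner S (v r) \<eta>) integrable_on {s..t}" if "0 \<le> s" "t \<le> T" "\<eta> \<in> L2 S" for s t \<eta>
    by (rule integrable_continuous_interval[OF continuous_on_subset[OF continuous_into_inner[OF v that(3)]]]) (use that in auto)
  have JL: "L2_inner S (J t) \<eta> = integral {0..t} (\<lambda>r. L2_inner S (v r) \<eta>)" if t: "0 \<le> t" "t \<le> T" and \<eta>: "\<eta> \<in> L2 S" for t \<eta>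
  proof -
    interpret linear_functional "H10 S" "\<lambda>u. L2_inner S u \<eta>" by (rule H10_L2_functional(1)[OF \<eta>])
    have C: "0 < L2_norm S \<eta> + 1" using L2_norm_nonneg[of \<eta>] by linarith
    have "L2_inner S (J t) \<eta> = (\<integral>r. L2_inner S (v r) \<eta> \<partial>?I t)"
      by (rule functional_bochner_integral(2)[OF _ J[OF t] H10_L2_functional(2)[OF \<eta>] C, symmetric]) auto
    also have "\<dots> = integral {0..t} (\<lambda>r. L2_inner S (v r) \<eta>)"
      using integral_lebesgue_on_subinterval(3)[OF integrable_lebesgue_on_open_interval[OF continuous_into_inner[OF v \<eta>]]] t by simp
    finally show ?thesis .
  qed
  have JL2: "L2_inner S (\<lambda>x. J t x - J s x) \<eta> = integral {s..t} (\<lambda>r. L2_inner S (v r) \<eta>)"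
    if "0 \<le> s" "s \<le> t" "t \<le> T" "\<eta> \<in> L2 S" for s t \<eta>
  proof -
    have "integral {0..s} (\<lambda>r. L2_inner S (v r) \<eta>) + integral {s..t} (\<lambda>r. L2_inner S (v r) \<eta>) = integral {0..t} (\<lambda>r. L2_inner S (v r) \<eta>)"
      using that by (intro Henstock_Kurzweil_Integration.integral_combine vint) auto
    then show ?thesis
      using that by (simp add: L2_inner_diff_left H10_imp_L2 JH JL)
  qed
  \<comment> \<open>Both functions have the same inner product with every \<eta>; taking their
    difference as \<eta> shows that its norm is zero.\<close>
  have Jae: "AE x in M. J t x = u t x - u 0 x" if t: "0 \<le> t" "t \<le> T" for t
  proof -
    let ?e = "\<lambda>x. J t x - (u t x - u 0 x)"
    have ut: "(\<lambda>x. u t x - u 0 x) \<in> L2 S" using u t by (intro L2_diff) (auto intro: continuous_into_mem)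
    have e: "?e \<in> L2 S" by (rule L2_diff[OF H10_imp_L2[OF JH[OF t]] ut])
    have "(L2_norm S ?e)\<^sup>2 = L2_inner S (J t) ?e - L2_inner S (\<lambda>x. u t x - u 0 x) ?e"
      using e ut JH[OF t] by (simp add: L2_norm_square L2_inner_diff_left H10_imp_L2)
    also have "\<dots> = 0"
      using JL[OF t e] weak_time_deriv_L2[OF u v d _ _ _ e, of 0 t] t by simp
    finally show ?thesis using L2_norm_eq_0_iff[OF e] by simp
  qed
  define A where "A = (\<lambda>t. integral {0..t} (\<lambda>r. H1_norm S (v r)))"
  have Ni: "(\<lambda>r. H1_norm S (v r)) absolutely_integrable_on {s..t}" "(\<lambda>r. H1_norm S (v r)) integrable_on {s..t}" if "0 \<le> s" "t \<le> T" for s t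
    using integral_lebesgue_on_subinterval(2)[OF Nint that] set_lebesgue_integral_eq_integral(1) by auto
  have Acont: "continuous_on {0..T} A"
    unfolding A_def by (rule indefinite_integral_continuous_1[OF Ni(2)]) auto
  \<comment> \<open>The increment of the gradient is paired with itself. The resulting inequality
    between the squared norm and the norm times the increment of \<open>A\<close> is then divided by
    the norm.\<close>
  have gA: "L2_norm S (\<lambda>x. grad S (J t) x - grad S (J s) x) \<le> A t - A s" if st: "0 \<le> s" "s \<le> t" "t \<le> T" for s t
  proof -
    define \<xi> where "\<xi> = (\<lambda>x. grad S (J t) x - grad S (J s) x)"
    have g: "grad S (J t) \<in> L2 S" "grad S (J s) \<in> L2 S"
      using st by (auto intro!: grad_weak_gradient(1) H10_imp_H1 JH)
    have \<xi>: "\<xi> \<in> L2 S" unfolding \<xi>_def by (intro L2_diff g)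
    interpret linear_functional "H10 S" "\<lambda>u. L2_inner S (grad S u) \<xi>" by (rule grad_functional(1)[OF \<xi>])
    have C: "0 < L2_norm S \<xi> + 1" using L2_norm_nonneg[of \<xi>] by linarith
    have bd: "\<bar>L2_inner S (grad S u) \<xi>\<bar> \<le> (L2_norm S \<xi> + 1) * H1_norm S u" if "u \<in> H10 S" for u
      using grad_functional(2)[OF \<xi> that] by (simp add: distrib_right add_increasing2)
    have T0: "0 \<le> T" using st by simp
    note gi = functional_bochner_integral(1)[OF _ J[OF T0 order_refl] bd C]
    have gi: "integrable (?I T) (\<lambda>r. L2_inner S (grad S (v r)) \<xi>)" by (rule gi) auto
    have JG: "L2_inner S (grad S (J q)) \<xi> = integral {0..q} (\<lambda>r. L2_inner S (grad S (v r)) \<xi>)" if q: "0 \<le> q" "q \<le> T" for q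
    proof -
      have "L2_inner S (grad S (J q)) \<xi> = (\<integral>r. L2_inner S (grad S (v r)) \<xi> \<partial>?I q)"
        by (rule functional_bochner_integral(2)[OF _ J[OF q] bd C, symmetric]) auto
      then show ?thesis
        using integral_lebesgue_on_subinterval(3)[OF gi, of 0 q] q by simp
    qed
    note gai = integral_lebesgue_on_subinterval(2)[OF gi]
    have gii: "(\<lambda>r. L2_inner S (grad S (v r)) \<xi>) integrable_on {p..q}" if "0 \<le> p" "q \<le> T" for p q
      using gai[OF that] set_lebesgue_integral_eq_integral(1) by blast
    have "(L2_norm S \<xi>)\<^sup>2 = L2_inner S (grad S (J t)) \<xi> - L2_inner S (grad S (J s)) \<xi>"
      using L2_inner_diff_left[OF g \<xi>] by (simp add: L2_norm_square flip: \<xi>_def)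
    also have "\<dots> = integral {s..t} (\<lambda>r. L2_inner S (grad S (v r)) \<xi>)"
      using Henstock_Kurzweil_Integration.integral_combine[OF st(1,2) gii] st by (simp add: JG)
    also have "\<dots> \<le> integral {s..t} (\<lambda>r. L2_norm S \<xi> * H1_norm S (v r))"
    proof (rule integral_le_AE)
      show "(\<lambda>r. L2_inner S (grad S (v r)) \<xi>) absolutely_integrable_on {s..t}" using st by (intro gai) auto
      show "(\<lambda>r. L2_norm S \<xi> * H1_norm S (v r)) absolutely_integrable_on {s..t}"
        using Ni(1)[of s t] st by (intro set_integrable_mult_right) auto
      have "AE r in ?I T. v r \<in> H10 S" using sm by (simp add: strongly_measurable_def)
      then have "AE r in lebesgue_on {s<..<t}. v r \<in> H10 S"
        by (rule AE_lebesgue_on_subset) (use st in auto)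
      then show "AE r in lebesgue_on {s<..<t}. L2_inner S (grad S (v r)) \<xi> \<le> L2_norm S \<xi> * H1_norm S (v r)"
        by eventually_elim (use grad_functional(2)[OF \<xi>] in \<open>auto simp: abs_le_iff\<close>)
    qed
    also have "\<dots> = L2_norm S \<xi> * (A t - A s)"
      using Henstock_Kurzweil_Integration.integral_combine[OF st(1,2) Ni(2)] st by (simp add: A_def)
    finally have *: "L2_norm S \<xi> * L2_norm S \<xi> \<le> L2_norm S \<xi> * (A t - A s)" by (simp add: power2_eq_square)
    have "0 \<le> integral {s..t} (\<lambda>r. H1_norm S (v r))" using st by (intro Henstock_Kurzweil_Integration.integral_nonneg Ni) auto
    then have "0 \<le> A t - A s"
      using Henstock_Kurzweil_Integration.integral_combine[OF st(1,2) Ni(2)] st by (simp add: A_def)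
    with * have "L2_norm S \<xi> \<le> A t - A s"
      using L2_norm_nonneg[of \<xi>] by (cases "L2_norm S \<xi> = 0") (auto simp: less_le)
    then show ?thesis by (simp add: \<xi>_def)
  qed
  show ?thesis by (rule that[OF JH Jae JL2 Acont gA])
qed

end

section \<open>The Caputo derivative\<close>

lemma le_if_square_le_mult:
  fixes x y :: real
  assumes "0 \<le> x" "x * x \<le> x * y" "0 \<le> y"
  shows "x \<le> y"
proof (cases "x = 0")
  case False
  with assms(1) have "0 < x" by simp
  then show ?thesis using assms(2) by (simp add: mult_le_cancel_left_pos)
qed (use assms in simp)

lemma integrable_on_open_interval:
  fixes f :: "real \<Rightarrow> real"
  assumes "f absolutely_integrable_on {s..t}"
  shows "integrable (lebesgue_on {s<..<t}) f"
proof -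
  have "f absolutely_integrable_on {s<..<t}"
    using assms by (rule set_integrable_subset) auto
  then show ?thesis
    by (simp add: integrable_restrict_space set_integrable_def)
qed

text \<open>The reciprocal Gamma function is continuous on the compact interval. At
  \<open>0\<close>, a pole of Gamma, it agrees with \<open>1 / Gamma\<close> through the default
  value of division by zero.\<close>

lemma rGamma_bounded:
  obtains R where "0 < R" "\<And>y::real. 0 \<le> y \<Longrightarrow> y \<le> 1 \<Longrightarrow> \<bar>1 / Gamma y\<bar> \<le> R"
proof -
  have "bounded (rGamma ` {0..1::real})"
    by (intro compact_imp_bounded compact_continuous_image continuous_on_rGamma) auto
  then obtain R where "R > 0" "\<forall>y\<in>{0..1::real}. norm (rGamma y) \<le> R"
    by (auto simp: bounded_pos)
  then show ?thesis
    by (intro that[of R]) (auto simp: rGamma_inverse_Gamma divide_inverse)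
qed

text \<open>The antiderivative is continuous up to the singular end because the order is below
  \<open>1\<close>, so it is enough to differentiate it in the interior.\<close>

lemma Caputo_kernel:
  fixes t a :: real
  assumes t: "0 < t" and a: "0 \<le> a" "a < 1"
  shows "(\<lambda>r. (t - r) powr - a) absolutely_integrable_on {0..t}"
    and "integral {0..t} (\<lambda>r. (t - r) powr - a) = t powr (1 - a) / (1 - a)"
proof -
  have "((\<lambda>r. (t - r) powr - a) has_integral - ((t - t) powr (1 - a) / (1 - a)) - - ((t - 0) powr (1 - a) / (1 - a))) {0..t}"
  proof (rule fundamental_theorem_of_calculus_interior)
    show "continuous_on {0..t} (\<lambda>r. - ((t - r) powr (1 - a) / (1 - a)))"
      using a by (intro continuous_on_minus continuous_on_divide continuous_on_powr' continuous_intros) auto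
    fix r assume r: "r \<in> {0<..<t}"
    have "((\<lambda>r. (t - r) powr (1 - a)) has_real_derivative ((1 - a) * (t - r) powr (1 - a - 1)) * - 1) (at r)"
      by (rule DERIV_chain2[OF has_real_derivative_powr]) (use r in \<open>auto intro!: derivative_eq_intros\<close>)
    from DERIV_minus[OF DERIV_cdivide[OF this, of "1 - a"]]
    have "((\<lambda>r. - ((t - r) powr (1 - a) / (1 - a))) has_real_derivative (t - r) powr - a) (at r)"
      using a by simp
    then show "((\<lambda>r. - ((t - r) powr (1 - a) / (1 - a))) has_vector_derivative (t - r) powr - a) (at r)"
      by (simp add: has_real_derivative_iff_has_vector_derivative)
  qed (use t in auto)
  then have i: "((\<lambda>r. (t - r) powr - a) has_integral t powr (1 - a) / (1 - a)) {0..t}"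
    using a by simp
  then show "integral {0..t} (\<lambda>r. (t - r) powr - a) = t powr (1 - a) / (1 - a)"
    by (rule integral_unique)
  show "(\<lambda>r. (t - r) powr - a) absolutely_integrable_on {0..t}"
    using i by (intro nonnegative_absolutely_integrable_1) (auto simp: has_integral_integrable)
qed

context bounded_open
begin

lemma continuous_into_norm:
  assumes v: "v \<in> continuous_into {0..T::real} (L2 S) (L2_norm S)"
  shows "continuous_on {0..T} (\<lambda>t. L2_norm S (v t))"
  unfolding continuous_on_iff
proof (intro ballI allI impI)
  fix t e :: real assume t: "t \<in> {0..T}" and e: "e > 0"
  obtain d where d: "d > 0" "\<And>r. r \<in> {0..T} \<Longrightarrow> \<bar>r - t\<bar> < d \<Longrightarrow> L2_norm S (\<lambda>x. v r x - v t x) < e"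
    using continuous_into_eps[OF v _ _ e, of t] t by auto
  have "dist (L2_norm S (v r)) (L2_norm S (v t)) < e" if "r \<in> {0..T}" "dist r t < d" for r
    using L2_norm_diff_ineq[of "v r" "v t"] continuous_into_mem[OF v] that t d(2)[of r]
    by (fastforce simp: dist_real_def)
  then show "\<exists>d>0. \<forall>r\<in>{0..T}. dist r t < d \<longrightarrow> dist (L2_norm S (v r)) (L2_norm S (v t)) < e"
    using d(1) by blast
qed

text \<open>\<open>bochner_integral_in\<close> is a choice and says something only if an integral
  exists. Measurability comes from continuity inside the interval, away from the singularity, and
  finiteness from the integrable kernel and the bounded velocity.\<close>

lemma Caputo_has_bochner_integral:
  assumes v: "v \<in> continuous_into {0..T::real} (L2 S) (L2_norm S)"
    and t: "0 < t" "t \<le> T" and a: "0 \<le> a" "a < 1"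
  shows "has_bochner_integral_in (lebesgue_on {0<..<t}) (L2 S) (L2_norm S) (\<lambda>r y. v r y / (t - r) powr a)
    (bochner_integral_in (lebesgue_on {0<..<t}) (L2 S) (L2_norm S) (\<lambda>r y. v r y / (t - r) powr a))"
proof -
  interpret V: seminormed_space "L2 S :: ('a \<Rightarrow> real) set" "L2_norm S" by (rule seminormed_L2)
  let ?u = "\<lambda>r y. v r y / (t - r) powr a"
  define k where "k = (\<lambda>r. (t - r) powr - a)"
  have u: "?u r = (\<lambda>y. k r * v r y)" for r by (auto simp: k_def powr_minus_divide)
  note vm = continuous_into_mem[OF v]
  have k0: "0 \<le> k r" for r by (simp add: k_def)
  have "\<exists>I. has_bochner_integral_in (lebesgue_on {0<..<t}) (L2 S) (L2_norm S) ?u I"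
  proof (rule V.has_bochner_integral_in_exists)
    show "\<exists>g\<in>L2 S. (\<lambda>n. L2_norm S (\<lambda>x. f n x - g x)) \<longlonglongrightarrow> 0"
      if "\<And>n. f n \<in> L2 S" "\<And>e. e > 0 \<Longrightarrow> \<exists>k. \<forall>m\<ge>k. \<forall>n\<ge>k. L2_norm S (\<lambda>x. f m x - f n x) < e" for f :: "nat \<Rightarrow> 'a \<Rightarrow> real"
      using L2_complete[OF that] by blast
    show "finite_measure (lebesgue_on {0<..<t})" by (rule finite_measure_lebesgue_on) simp
    show "strongly_measurable (lebesgue_on {0<..<t}) (L2 S) (L2_norm S) ?u"
    proof (rule V.strongly_measurable_continuous)
      show "?u r \<in> L2 S" if "0 < r" "r < t" for r
        unfolding u using that t by (intro L2_scale vm) auto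
      fix p e :: real assume p: "0 < p" "p < t" and e: "e > 0"
      \<comment> \<open>The usual splitting of a difference of products: the kernel times the change
        of \<open>v\<close>, plus the change of the kernel times \<open>v p\<close>.\<close>
      define F where "F = (\<lambda>r. k r * L2_norm S (\<lambda>x. v r x - v p x) + \<bar>k r - k p\<bar> * L2_norm S (v p))"
      have "(F \<longlongrightarrow> k p * 0 + \<bar>k p - k p\<bar> * L2_norm S (v p)) (at p within {0..T})"
        unfolding F_def
      proof (intro tendsto_intros)
        show "(k \<longlongrightarrow> k p) (at p within {0..T})"
          unfolding k_def using p by (intro tendsto_intros) auto
        then show "(k \<longlongrightarrow> k p) (at p within {0..T})" .
        show "((\<lambda>r. L2_norm S (\<lambda>x. v r x - v p x)) \<longlongrightarrow> 0) (at p within {0..T})"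
          using v p t by (auto simp: continuous_into_def)
      qed
      then have "(F \<longlongrightarrow> 0) (at p within {0..T})" by simp
      from tendstoD[OF this e] obtain d where d: "d > 0"
        "\<And>r. r \<in> {0..T} \<Longrightarrow> r \<noteq> p \<Longrightarrow> dist r p < d \<Longrightarrow> \<bar>F r\<bar> < e"
        by (auto simp: eventually_at)
      have "L2_norm S (\<lambda>x. ?u r x - ?u p x) < e" if r: "0 < r" "r < t" "\<bar>r - p\<bar> < d" for r
      proof -
        have m: "v r \<in> L2 S" "v p \<in> L2 S" using r p t by (auto intro!: vm)
        have "(\<lambda>x. ?u r x - ?u p x) = (\<lambda>x. k r * (v r x - v p x) + (k r - k p) * v p x)"
          using fun_cong[OF u[of r]] fun_cong[OF u[of p]] by (auto simp: algebra_simps)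
        then have "L2_norm S (\<lambda>x. ?u r x - ?u p x) \<le> L2_norm S (\<lambda>x. k r * (v r x - v p x)) + L2_norm S (\<lambda>x. (k r - k p) * v p x)"
          using m by (simp add: L2_norm_triangle[OF L2_scale[OF L2_diff] L2_scale])
        also have "\<dots> = F r" using k0 by (simp add: L2_norm_scale F_def)
        also have "F r < e"
          using d(2)[of r] r p t e by (cases "r = p") (auto simp: dist_real_def F_def)
        finally show ?thesis .
      qed
      then show "\<exists>d>0. \<forall>r. 0 < r \<and> r < t \<and> \<bar>r - p\<bar> < d \<longrightarrow> L2_norm S (\<lambda>x. ?u r x - ?u p x) < e"
        using d(1) by blast
    qed
    have "bounded ((\<lambda>t. L2_norm S (v t)) ` {0..T})"
      by (intro compact_imp_bounded compact_continuous_image continuous_into_norm[OF v]) auto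
    then obtain B where B: "B > 0" "\<And>r. r \<in> {0..T} \<Longrightarrow> L2_norm S (v r) \<le> B"
      by (auto simp: bounded_pos)
    have ki: "integrable (lebesgue_on {0<..<t}) k"
      by (rule integrable_on_open_interval) (use Caputo_kernel(1)[OF t(1) a] in \<open>simp add: k_def\<close>)
    have "(\<integral>\<^sup>+r. ennreal (L2_norm S (?u r)) \<partial>lebesgue_on {0<..<t}) \<le> (\<integral>\<^sup>+r. ennreal (B * k r) \<partial>lebesgue_on {0<..<t})"
    proof (rule nn_integral_mono, rule ennreal_leI)
      fix r assume "r \<in> space (lebesgue_on {0<..<t})"
      then show "L2_norm S (?u r) \<le> B * k r"
        unfolding u L2_norm_scale using mult_left_mono[OF B(2)[of r] k0[of r]] k0[of r] t
        by (simp add: mult.commute)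
    qed
    also have "\<dots> < \<infinity>"
      using ki B(1) k0 by (subst nn_integral_eq_integral) auto
    finally show "(\<integral>\<^sup>+r. ennreal (L2_norm S (?u r)) \<partial>lebesgue_on {0<..<t}) < \<infinity>" .
  qed
  then show ?thesis unfolding bochner_integral_in_def by (rule someI_ex)
qed

text \<open>The integrals arise as choices, so they are not subtracted by linearity. Both are paired
  with their own difference \<xi>, and the resulting real integrals are subtracted.\<close>

lemma Caputo_integral_difference:
  assumes v: "v \<in> continuous_into {0..T::real} (L2 S) (L2_norm S)" and v': "v' \<in> continuous_into {0..T::real} (L2 S) (L2_norm S)"
    and t: "0 < t" "t \<le> T" and a: "0 \<le> a" "a < 1"
    and B: "\<And>r. 0 \<le> r \<Longrightarrow> r \<le> t \<Longrightarrow> L2_norm S (\<lambda>x. v r x - v' r x) \<le> B"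
    and I: "has_bochner_integral_in (lebesgue_on {0<..<t}) (L2 S) (L2_norm S) (\<lambda>r y. v r y / (t - r) powr a) I"
    and I': "has_bochner_integral_in (lebesgue_on {0<..<t}) (L2 S) (L2_norm S) (\<lambda>r y. v' r y / (t - r) powr a) I'"
  shows "L2_norm S (\<lambda>x. I x - I' x) \<le> B * (t powr (1 - a) / (1 - a))"
proof -
  let ?M = "lebesgue_on {0<..<t}"
  define k where "k = (\<lambda>r. (t - r) powr - a)"
  have k0: "0 \<le> k r" for r by (simp add: k_def)
  note vm = continuous_into_mem[OF v] continuous_into_mem[OF v']
  have IL: "I \<in> L2 S" "I' \<in> L2 S" using I I' by (auto simp: has_bochner_integral_in_def)
  define \<xi> where "\<xi> = (\<lambda>x. I x - I' x)"
  have \<xi>: "\<xi> \<in> L2 S" unfolding \<xi>_def using IL by (rule L2_diff)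
  interpret linear_functional "L2 S" "\<lambda>u. L2_inner S u \<xi>" by (rule L2_functional(1)[OF \<xi>])
  have C: "0 < L2_norm S \<xi> + 1" using L2_norm_nonneg[of \<xi>] by linarith
  have L: "{0<..<t} \<in> lmeasurable" by simp
  note fb = functional_bochner_integral[OF L I L2_functional(2)[OF \<xi>] C]
    and fb' = functional_bochner_integral[OF L I' L2_functional(2)[OF \<xi>] C]
  have B0: "0 \<le> B" using order_trans[OF L2_norm_nonneg B[of 0]] t by simp
  have ki: "integrable ?M k"
    by (rule integrable_on_open_interval) (use Caputo_kernel(1)[OF t(1) a] in \<open>simp add: k_def\<close>)
  have kv: "(\<integral>r. k r \<partial>?M) = t powr (1 - a) / (1 - a)"
    using lebesgue_integral_eq_integral[OF ki] Caputo_kernel(2)[OF t(1) a]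
    by (simp add: k_def integral_open_interval_real)
  have "(L2_norm S \<xi>)\<^sup>2 = L2_inner S I \<xi> - L2_inner S I' \<xi>"
    using L2_inner_diff_left[OF IL \<xi>] by (simp add: L2_norm_square flip: \<xi>_def)
  also have "\<dots> = (\<integral>r. L2_inner S (\<lambda>y. v r y / (t - r) powr a) \<xi> - L2_inner S (\<lambda>y. v' r y / (t - r) powr a) \<xi> \<partial>?M)"
    using fb fb' by simp
  also have "\<dots> \<le> (\<integral>r. (B * L2_norm S \<xi>) * k r \<partial>?M)"
  proof (rule integral_mono)
    show "integrable ?M (\<lambda>r. L2_inner S (\<lambda>y. v r y / (t - r) powr a) \<xi> - L2_inner S (\<lambda>y. v' r y / (t - r) powr a) \<xi>)"
      using fb(1) fb'(1) by simp
    show "integrable ?M (\<lambda>r. (B * L2_norm S \<xi>) * k r)" using ki by simp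
    fix r assume "r \<in> space ?M"
    then have r: "0 \<le> r" "r \<le> t" "r \<le> T" using t by auto
    have e: "(\<lambda>y. w y / (t - r) powr a) = (\<lambda>y. k r * w y)" for w :: "'a \<Rightarrow> real"
      by (auto simp: k_def powr_minus_divide)
    have "L2_inner S (\<lambda>y. v r y / (t - r) powr a) \<xi> - L2_inner S (\<lambda>y. v' r y / (t - r) powr a) \<xi>
        = k r * L2_inner S (\<lambda>x. v r x - v' r x) \<xi>"
      unfolding e L2_inner_scale_left using vm r \<xi> by (simp add: L2_inner_diff_left right_diff_distrib)
    also have "\<dots> \<le> k r * (B * L2_norm S \<xi>)"
    proof (rule mult_left_mono[OF _ k0])
      have "\<bar>L2_inner S (\<lambda>x. v r x - v' r x) \<xi>\<bar> \<le> L2_norm S (\<lambda>x. v r x - v' r x) * L2_norm S \<xi>"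
        using vm r \<xi> by (intro L2_Cauchy_Schwarz L2_diff) auto
      also have "\<dots> \<le> B * L2_norm S \<xi>" using B r by (intro mult_right_mono) auto
      finally show "L2_inner S (\<lambda>x. v r x - v' r x) \<xi> \<le> B * L2_norm S \<xi>" by simp
    qed
    finally show "L2_inner S (\<lambda>y. v r y / (t - r) powr a) \<xi> - L2_inner S (\<lambda>y. v' r y / (t - r) powr a) \<xi> \<le> (B * L2_norm S \<xi>) * k r"
      by (simp add: mult.commute)
  qed
  also have "\<dots> = L2_norm S \<xi> * (B * (t powr (1 - a) / (1 - a)))" using kv by simp
  finally have "L2_norm S \<xi> * L2_norm S \<xi> \<le> L2_norm S \<xi> * (B * (t powr (1 - a) / (1 - a)))"
    by (simp add: power2_eq_square)
  moreover have "0 \<le> B * (t powr (1 - a) / (1 - a))" using B0 a by simp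
  ultimately have "L2_norm S \<xi> \<le> B * (t powr (1 - a) / (1 - a))"
    by (intro le_if_square_le_mult[OF L2_norm_nonneg])
  then show ?thesis by (simp add: \<xi>_def)
qed

text \<open>The constant is uniform in time and in the order: the reciprocal Gamma factor is at most
  \<open>R\<close>, the power of \<open>t\<close> at most \<open>max 1 T\<close>, and
  \<open>1 / (1 - \<mu> t)\<close> at most \<open>1 / (1 - m)\<close>.\<close>

lemma caputo_difference:
  assumes "m < 1" "0 < T"
  obtains C where "0 \<le> C"
    "\<And>\<mu> v v' t B. v \<in> continuous_into {0..T::real} (L2 S) (L2_norm S) \<Longrightarrow> v' \<in> continuous_into {0..T::real} (L2 S) (L2_norm S) \<Longrightarrow>
      0 < t \<Longrightarrow> t \<le> T \<Longrightarrow> 0 \<le> \<mu> t \<Longrightarrow> \<mu> t \<le> m \<Longrightarrow>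
      \<forall>r\<in>{0..t}. L2_norm S (\<lambda>x. v r x - v' r x) \<le> B \<Longrightarrow>
      caputo S \<mu> v t \<in> L2 S \<and> caputo S \<mu> v' t \<in> L2 S \<and>
      L2_norm S (\<lambda>x. caputo S \<mu> v t x - caputo S \<mu> v' t x) \<le> C * B"
proof -
  obtain R where R: "0 < R" "\<And>y::real. 0 \<le> y \<Longrightarrow> y \<le> 1 \<Longrightarrow> \<bar>1 / Gamma y\<bar> \<le> R"
    using rGamma_bounded by blast
  define C where "C = R * (max 1 T / (1 - m))"
  have "caputo S \<mu> v t \<in> L2 S \<and> caputo S \<mu> v' t \<in> L2 S \<and>
      L2_norm S (\<lambda>x. caputo S \<mu> v t x - caputo S \<mu> v' t x) \<le> C * B"
    if v: "v \<in> continuous_into {0..T::real} (L2 S) (L2_norm S)" and v': "v' \<in> continuous_into {0..T::real} (L2 S) (L2_norm S)"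
      and t: "0 < t" "t \<le> T" and \<mu>: "0 \<le> \<mu> t" "\<mu> t \<le> m"
      and B': "\<forall>r\<in>{0..t}. L2_norm S (\<lambda>x. v r x - v' r x) \<le> B" for \<mu> v v' t B
  proof -
    have B: "L2_norm S (\<lambda>x. v r x - v' r x) \<le> B" if "0 \<le> r" "r \<le> t" for r
      using B' that by simp
    have a: "0 \<le> \<mu> t" "\<mu> t < 1" using \<mu> assms by auto
    define I where "I = bochner_integral_in (lebesgue_on {0<..<t}) (L2 S) (L2_norm S) (\<lambda>r y. v r y / (t - r) powr \<mu> t)"
    define I' where "I' = bochner_integral_in (lebesgue_on {0<..<t}) (L2 S) (L2_norm S) (\<lambda>r y. v' r y / (t - r) powr \<mu> t)"
    have hI: "has_bochner_integral_in (lebesgue_on {0<..<t}) (L2 S) (L2_norm S) (\<lambda>r y. v r y / (t - r) powr \<mu> t) I"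
      unfolding I_def by (rule Caputo_has_bochner_integral[OF v t a])
    have hI': "has_bochner_integral_in (lebesgue_on {0<..<t}) (L2 S) (L2_norm S) (\<lambda>r y. v' r y / (t - r) powr \<mu> t) I'"
      unfolding I'_def by (rule Caputo_has_bochner_integral[OF v' t a])
    have IL: "I \<in> L2 S" "I' \<in> L2 S" using hI hI' by (auto simp: has_bochner_integral_in_def)
    have B0: "0 \<le> B" using order_trans[OF L2_norm_nonneg B[of 0]] t by simp
    have c: "caputo S \<mu> v t = (\<lambda>x. 1 / Gamma (1 - \<mu> t) * I x)" "caputo S \<mu> v' t = (\<lambda>x. 1 / Gamma (1 - \<mu> t) * I' x)"
      by (auto simp: caputo_def I_def I'_def)
    have "t powr (1 - \<mu> t) \<le> max 1 T"
    proof (cases "t \<le> 1")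
      case True
      then have "t powr (1 - \<mu> t) \<le> 1" using t a by (intro powr_le1) auto
      then show ?thesis by simp
    next
      case False
      then have "t powr (1 - \<mu> t) \<le> t powr 1" using a by (intro powr_mono) auto
      then show ?thesis using t by simp
    qed
    then have q: "t powr (1 - \<mu> t) / (1 - \<mu> t) \<le> max 1 T / (1 - m)"
      using \<mu> assms by (intro frac_le) auto
    have q0: "0 \<le> t powr (1 - \<mu> t) / (1 - \<mu> t)" using a by simp
    have "(\<lambda>x. caputo S \<mu> v t x - caputo S \<mu> v' t x) = (\<lambda>x. 1 / Gamma (1 - \<mu> t) * (I x - I' x))"
      by (simp add: c right_diff_distrib)
    then have "L2_norm S (\<lambda>x. caputo S \<mu> v t x - caputo S \<mu> v' t x) = \<bar>1 / Gamma (1 - \<mu> t)\<bar> * L2_norm S (\<lambda>x. I x - I' x)"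
      by (simp only: L2_norm_scale)
    also have "\<dots> \<le> R * (B * (max 1 T / (1 - m)))"
    proof (rule mult_mono)
      show "\<bar>1 / Gamma (1 - \<mu> t)\<bar> \<le> R" using a by (intro R(2)) auto
      show "L2_norm S (\<lambda>x. I x - I' x) \<le> B * (max 1 T / (1 - m))"
        using Caputo_integral_difference[OF v v' t a B hI hI'] mult_left_mono[OF q B0] by linarith
    qed (use R in auto)
    also have "\<dots> = C * B" by (simp add: C_def)
    finally show ?thesis unfolding c by (intro conjI L2_scale IL)
  qed
  moreover have "0 \<le> C" using R assms by (simp add: C_def)
  ultimately show ?thesis by (intro that[of C]) auto
qed

end

section \<open>Uniqueness\<close>

text \<open>This passes the weak time derivative of the coefficient on to Borel
  representatives.\<close>

lemma weak_partial_AE: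
  fixes u u' g g' :: "'a::euclidean_space \<Rightarrow> real"
  assumes P: "P \<in> sets lebesgue" and i: "i \<in> Basis"
    and m: "u \<in> borel_measurable (lebesgue_on P)" "u' \<in> borel_measurable (lebesgue_on P)"
      "g \<in> borel_measurable (lebesgue_on P)" "g' \<in> borel_measurable (lebesgue_on P)"
    and ae: "AE x in lebesgue_on P. u x = u' x" "AE x in lebesgue_on P. g x = g' x"
    and wp: "weak_partial P i u g"
  shows "weak_partial P i u' g'"
  unfolding weak_partial_def
proof
  fix \<phi> assume \<phi>: "\<phi> \<in> test_functions P"
  have cm: "f \<in> borel_measurable (lebesgue_on P)" if "continuous_on UNIV f" for f :: "'a \<Rightarrow> real"
    using that by (intro measurable_restrict_space1 measurable_completion) (simp add: borel_measurable_continuous_onI)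
  note \<phi>m = cm[OF test_function_continuous[OF \<phi>]] and dm = cm[OF test_function_derivative_continuous[OF \<phi> i]]
  have "(\<integral>x. u' x * frechet_derivative \<phi> (at x) i \<partial>lebesgue_on P) = (\<integral>x. u x * frechet_derivative \<phi> (at x) i \<partial>lebesgue_on P)"
    using ae(1) by (intro integral_cong_AE borel_measurable_times m dm) (auto elim: eventually_mono)
  moreover have "(\<integral>x. g' x * \<phi> x \<partial>lebesgue_on P) = (\<integral>x. g x * \<phi> x \<partial>lebesgue_on P)"
    using ae(2) by (intro integral_cong_AE borel_measurable_times m \<phi>m) (auto elim: eventually_mono)
  ultimately show "(\<integral>x. u' x * frechet_derivative \<phi> (at x) i \<partial>lebesgue_on P) = - (\<integral>x. g' x * \<phi> x \<partial>lebesgue_on P)"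
    using wp \<phi> by (simp add: weak_partial_def)
qed

context bounded_open
begin

lemma L2_norm_mono:
  fixes u :: "'a \<Rightarrow> 'b::euclidean_space" and v :: "'a \<Rightarrow> 'c::euclidean_space"
  assumes u: "u \<in> borel_measurable M" and v: "v \<in> L2 S" and le: "\<And>x. norm (u x) \<le> norm (v x)"
  shows "u \<in> L2 S" "L2_norm S u \<le> L2_norm S v"
proof -
  have sq: "(norm (u x))\<^sup>2 \<le> (norm (v x))\<^sup>2" for x using le by (intro power_mono) auto
  show uL: "u \<in> L2 S" by (rule L2_bound[OF u L2_square_integrable[OF v]]) (use sq in auto)
  have "(L2_norm S u)\<^sup>2 \<le> (L2_norm S v)\<^sup>2"
    unfolding L2_norm_square_integral by (intro integral_mono L2_square_integrable uL v sq)
  then show "L2_norm S u \<le> L2_norm S v" by (rule power2_le_imp_le) simp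
qed

lemma L2_Lipschitz:
  fixes f :: "real \<Rightarrow> real"
  assumes f: "\<And>z z'. \<bar>f z - f z'\<bar> \<le> K * \<bar>z - z'\<bar>" and K: "0 \<le> K"
    and u: "u \<in> L2 S" and u': "u' \<in> L2 S"
  shows "(\<lambda>x. f (u x)) \<in> L2 S" "L2_norm S (\<lambda>x. f (u x) - f (u' x)) \<le> K * L2_norm S (\<lambda>x. u x - u' x)"
proof -
  have "K-lipschitz_on UNIV f" using f K by (intro lipschitz_onI) (auto simp: dist_real_def)
  then have [measurable]: "f \<in> borel_measurable borel"
    by (intro borel_measurable_continuous_onI lipschitz_on_continuous_on)
  have m: "(\<lambda>x. f (w x)) \<in> borel_measurable M" if "w \<in> L2 S" for w
    using that by (intro measurable_compose[OF L2_measurable]) auto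
  have Kd: "(\<lambda>x. K * (w x - w' x)) \<in> L2 S" if "w \<in> L2 S" "w' \<in> L2 S" for w w'
    using that by (intro L2_scale L2_diff)
  have z: "(\<lambda>_. c) \<in> L2 S" for c :: real by (simp add: L2_def)
  have *: "(\<lambda>x. f (w x) - f (w' x)) \<in> L2 S"
    "L2_norm S (\<lambda>x. f (w x) - f (w' x)) \<le> L2_norm S (\<lambda>x. K * (w x - w' x))" if "w \<in> L2 S" "w' \<in> L2 S" for w w'
  proof -
    have "norm (f (w x) - f (w' x)) \<le> norm (K * (w x - w' x))" for x
      using f K by (simp add: abs_mult)
    from L2_norm_mono[OF borel_measurable_diff[OF m[OF that(1)] m[OF that(2)]] Kd[OF that] this]
    show "(\<lambda>x. f (w x) - f (w' x)) \<in> L2 S"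
      "L2_norm S (\<lambda>x. f (w x) - f (w' x)) \<le> L2_norm S (\<lambda>x. K * (w x - w' x))" .
  qed
  show "(\<lambda>x. f (u x)) \<in> L2 S"
    \<comment> \<open>The value \<open>f 0\<close> is split off; being constant it is
      square-integrable on a set of finite measure.\<close>
    using L2_add[OF *(1)[OF u z] z, of 0 "f 0"] by simp
  show "L2_norm S (\<lambda>x. f (u x) - f (u' x)) \<le> K * L2_norm S (\<lambda>x. u x - u' x)"
    using *(2)[OF u u'] K by (simp add: L2_norm_scale)
qed

text \<open>Only the identity tested with \<open>z\<close> itself is needed: Cauchy-Schwarz bounds
  its right side by \<open>r * B\<close> times the norm of \<open>z\<close>.\<close>

lemma primitive_norm_bound:
  assumes v: "v \<in> continuous_into {0..T} (L2 S) (L2_norm S)"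
    and r: "0 \<le> r" "r \<le> T" and Z: "z \<in> L2 S"
    and p: "L2_inner S z z = integral {0..r} (\<lambda>t. L2_inner S (v t) z)"
    and B: "\<And>t. 0 \<le> t \<Longrightarrow> t \<le> r \<Longrightarrow> L2_norm S (v t) \<le> B"
  shows "L2_norm S z \<le> r * B"
proof (rule le_if_square_le_mult[OF L2_norm_nonneg])
  have B0: "0 \<le> B" using order_trans[OF L2_norm_nonneg B[of 0]] r by simp
  then show "0 \<le> r * B" using r by simp
  have "integral {0..r} (\<lambda>t. L2_inner S (v t) z) \<le> B * L2_norm S z * (r - 0)"
  proof (rule abs_le_D1, rule abs_integral_le)
    show "(\<lambda>t. L2_inner S (v t) z) integrable_on {0..r}"
      by (rule integrable_continuous_interval[OF continuous_on_subset[OF continuous_into_inner[OF v Z]]]) (use r in auto)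
    fix t assume t: "t \<in> {0..r}"
    have "\<bar>L2_inner S (v t) z\<bar> \<le> L2_norm S (v t) * L2_norm S z"
      using t r by (intro L2_Cauchy_Schwarz continuous_into_mem[OF v] Z) auto
    also have "\<dots> \<le> B * L2_norm S z" using B t by (intro mult_right_mono) auto
    finally show "\<bar>L2_inner S (v t) z\<bar> \<le> B * L2_norm S z" .
  qed (use r B0 in auto)
  then show "L2_norm S z * L2_norm S z \<le> L2_norm S z * (r * B)"
    using p by (simp add: L2_norm_square power2_eq_square[symmetric] mult_ac)
qed

text \<open>\<open>J\<close> is the version of \<open>\<Phi> t - \<Phi> 0\<close> that lies in
  \<open>H10\<close> at every time, while \<Phi> itself does so only almost everywhere.
  \<open>A\<close> measures the motion of its gradient.\<close>

lemma weak_solution_data: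
  assumes "weak_solution T S \<mu> \<rho> \<beta> Q f \<Phi>\<^sub>0 \<Psi>\<^sub>0 \<Phi>"
  obtains v w J A where
    "v \<in> continuous_into {0..T} (L2 S) (L2_norm S)"
    "\<Phi> \<in> continuous_into {0..T} (L2 S) (L2_norm S)"
    "AE t in lebesgue_on {0<..<T}. \<Phi> t \<in> H10 S"
    "AE x in M. \<Phi> 0 x = \<Phi>\<^sub>0 x" "AE x in M. v 0 x = \<Psi>\<^sub>0 x"
    "\<And>\<eta>. \<eta> \<in> H10 S \<Longrightarrow> integrable (lebesgue_on {0<..<T}) (\<lambda>t. w t \<eta>)"
    "\<And>\<eta> s t. \<eta> \<in> H10 S \<Longrightarrow> 0 \<le> s \<Longrightarrow> s \<le> t \<Longrightarrow> t \<le> T \<Longrightarrow>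
      L2_inner S (\<lambda>x. v t x - v s x) \<eta> = integral {s..t} (\<lambda>r. w r \<eta>)"
    "\<And>\<eta>. \<eta> \<in> H10 S \<Longrightarrow> AE t in lebesgue_on {0<..<T}.
        w t \<eta> + L2_inner S (\<lambda>x. \<rho> t x * caputo S \<mu> v t x) \<eta>
          + L2_inner S (\<lambda>x. \<beta> t x *\<^sub>R grad S (\<Phi> t) x) (grad S \<eta>)
        = L2_inner S (\<lambda>x. f (\<Phi> t x)) \<eta> + L2_inner S (Q t) \<eta>"
    "\<And>t. 0 \<le> t \<Longrightarrow> t \<le> T \<Longrightarrow> J t \<in> H10 S"
    "\<And>t. 0 \<le> t \<Longrightarrow> t \<le> T \<Longrightarrow> AE x in M. J t x = \<Phi> t x - \<Phi> 0 x"
    "\<And>s t \<eta>. 0 \<le> s \<Longrightarrow> s \<le> t \<Longrightarrow> t \<le> T \<Longrightarrow> \<eta> \<in> L2 S \<Longrightarrow>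
      L2_inner S (\<lambda>x. J t x - J s x) \<eta> = integral {s..t} (\<lambda>r. L2_inner S (v r) \<eta>)"
    "continuous_on {0..T} A"
    "\<And>s t. 0 \<le> s \<Longrightarrow> s \<le> t \<Longrightarrow> t \<le> T \<Longrightarrow> L2_norm S (\<lambda>x. grad S (J t) x - grad S (J s) x) \<le> A t - A s"
proof -
  obtain v w where
    \<Phi>: "\<Phi> \<in> continuous_into {0..T} (L2 S) (L2_norm S)"
      "\<Phi> \<in> bochner_L2 (lebesgue_on {0<..<T}) (H10 S) (H1_norm S)"
    and v: "v \<in> bochner_L2 (lebesgue_on {0<..<T}) (H10 S) (H1_norm S)"
      "v \<in> continuous_into {0..T} (L2 S) (L2_norm S)"
    and w: "w \<in> bochner_L2 (lebesgue_on {0<..<T}) (H10_dual S) (H10_dual_norm S)"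
    and d1: "weak_time_deriv T (L2 S) (L2_norm S) \<Phi> v"
    and d2: "weak_time_deriv T (H10_dual S) (H10_dual_norm S) (\<lambda>t \<eta>. L2_inner S (v t) \<eta>) w"
    and init: "AE x in M. \<Phi> 0 x = \<Phi>\<^sub>0 x" "AE x in M. v 0 x = \<Psi>\<^sub>0 x"
    and eq: "\<And>\<eta>. \<eta> \<in> H10 S \<Longrightarrow> AE t in lebesgue_on {0<..<T}.
        w t \<eta> + L2_inner S (\<lambda>x. \<rho> t x * caputo S \<mu> v t x) \<eta>
          + L2_inner S (\<lambda>x. \<beta> t x *\<^sub>R grad S (\<Phi> t) x) (grad S \<eta>)
        = L2_inner S (\<lambda>x. f (\<Phi> t x)) \<eta> + L2_inner S (Q t) \<eta>"
    using assms unfolding weak_solution_def by blast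
  have \<Phi>H: "AE t in lebesgue_on {0<..<T}. \<Phi> t \<in> H10 S"
    using \<Phi>(2) by (simp add: bochner_L2_def strongly_measurable_def)
  note wd = weak_time_deriv_dual[OF v(2) w d2]
  show ?thesis
    by (rule H10_primitive[OF \<Phi>(1) v(2) v(1) d1]) (rule that[OF v(2) \<Phi>(1) \<Phi>H init wd eq])
qed

lemma L2_bounded_mult_inner:
  fixes r :: "'a \<Rightarrow> real"
  assumes r: "r \<in> borel_measurable M" "AE x in M. \<bar>r x\<bar> \<le> C" "0 \<le> C"
    and c: "c \<in> L2 S" "c' \<in> L2 S" and \<eta>: "\<eta> \<in> L2 S"
  shows "\<bar>L2_inner S (\<lambda>x. r x * c x) \<eta> - L2_inner S (\<lambda>x. r x * c' x) \<eta>\<bar> \<le> C * L2_norm S (\<lambda>x. c x - c' x) * L2_norm S \<eta>"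
proof -
  note rc = L2_bounded_mult(1)[OF r(1,2) c(1)] L2_bounded_mult(1)[OF r(1,2) c(2)]
  note rd = L2_bounded_mult[OF r(1,2) L2_diff[OF c]]
  have "L2_inner S (\<lambda>x. r x * c x) \<eta> - L2_inner S (\<lambda>x. r x * c' x) \<eta> = L2_inner S (\<lambda>x. r x *\<^sub>R (c x - c' x)) \<eta>"
    using rc \<eta> by (simp add: right_diff_distrib L2_inner_diff_left)
  also have "\<bar>\<dots>\<bar> \<le> L2_norm S (\<lambda>x. r x *\<^sub>R (c x - c' x)) * L2_norm S \<eta>"
    by (rule L2_Cauchy_Schwarz[OF rd(1) \<eta>])
  also have "\<dots> \<le> C * L2_norm S (\<lambda>x. c x - c' x) * L2_norm S \<eta>"
    using rd(2) r(3) by (intro mult_right_mono) auto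
  finally show ?thesis .
qed

end

context coefficient
begin

text \<open>The two equations are subtracted at a single time. The common term \<open>q\<close>
  cancels, and the elliptic part is expressed through a given representative \<open>g\<close> of the
  difference of the gradients.\<close>

lemma equation_difference:
  assumes u: "u \<in> H1 S" "u' \<in> H1 S" and \<eta>: "\<eta> \<in> H1 S"
    and g: "g \<in> L2 S" "AE x in M. grad S u x - grad S u' x = g x"
    and f: "\<And>z z'. \<bar>f z - f z'\<bar> \<le> K * \<bar>z - z'\<bar>" "0 \<le> K"
    and r: "r \<in> borel_measurable M" "AE x in M. \<bar>r x\<bar> \<le> C" "0 \<le> C"
    and c: "c \<in> L2 S" "c' \<in> L2 S"
    and \<beta>: "AE x in M. \<beta> x = b (x, t)"
    and eq: "w + L2_inner S (\<lambda>x. r x * c x) \<eta> + L2_inner S (\<lambda>x. \<beta> x *\<^sub>R grad S u x) (grad S \<eta>)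
        = L2_inner S (\<lambda>x. f (u x)) \<eta> + q"
      "w' + L2_inner S (\<lambda>x. r x * c' x) \<eta> + L2_inner S (\<lambda>x. \<beta> x *\<^sub>R grad S u' x) (grad S \<eta>)
        = L2_inner S (\<lambda>x. f (u' x)) \<eta> + q"
  shows "w - w' \<le> - form g (grad S \<eta>) t
    + (C * L2_norm S (\<lambda>x. c x - c' x) + K * L2_norm S (\<lambda>x. u x - u' x)) * L2_norm S \<eta>"
proof -
  note uL = u[THEN H1_imp_L2] and \<eta>L = \<eta>[THEN H1_imp_L2] and gu = u[THEN grad_weak_gradient(1)] and g\<eta> = \<eta>[THEN grad_weak_gradient(1)]
  have 1: "\<bar>L2_inner S (\<lambda>x. r x * c x) \<eta> - L2_inner S (\<lambda>x. r x * c' x) \<eta>\<bar> \<le> C * L2_norm S (\<lambda>x. c x - c' x) * L2_norm S \<eta>"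
    by (rule L2_bounded_mult_inner[OF r c \<eta>L])
  have fL: "(\<lambda>x. f (u x)) \<in> L2 S" "(\<lambda>x. f (u' x)) \<in> L2 S" using L2_Lipschitz(1)[OF f] uL by blast+
  have "\<bar>L2_inner S (\<lambda>x. f (u x) - f (u' x)) \<eta>\<bar> \<le> L2_norm S (\<lambda>x. f (u x) - f (u' x)) * L2_norm S \<eta>"
    by (rule L2_Cauchy_Schwarz[OF L2_diff[OF fL] \<eta>L])
  also have "\<dots> \<le> K * L2_norm S (\<lambda>x. u x - u' x) * L2_norm S \<eta>"
    by (intro mult_right_mono L2_Lipschitz(2)[OF f uL]) simp
  finally have 2: "\<bar>L2_inner S (\<lambda>x. f (u x)) \<eta> - L2_inner S (\<lambda>x. f (u' x)) \<eta>\<bar> \<le> K * L2_norm S (\<lambda>x. u x - u' x) * L2_norm S \<eta>"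
    using fL \<eta>L by (simp add: L2_inner_diff_left)
  have \<beta>e: "L2_inner S (\<lambda>x. \<beta> x *\<^sub>R h x) (grad S \<eta>) = L2_inner S (\<lambda>x. b (x, t) *\<^sub>R h x) (grad S \<eta>)" if "h \<in> L2 S" for h :: "'a \<Rightarrow> 'a"
  proof (rule L2_inner_AE_left[OF b_mult(1)[OF that] _ g\<eta>])
    show "AE x in M. b (x, t) *\<^sub>R h x = \<beta> x *\<^sub>R h x" using \<beta> by eventually_elim simp
  qed
  have "L2_inner S (\<lambda>x. \<beta> x *\<^sub>R grad S u x) (grad S \<eta>) - L2_inner S (\<lambda>x. \<beta> x *\<^sub>R grad S u' x) (grad S \<eta>)
      = L2_inner S (\<lambda>x. b (x, t) *\<^sub>R grad S u x - b (x, t) *\<^sub>R grad S u' x) (grad S \<eta>)"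
    using gu g\<eta> by (simp add: \<beta>e b_mult L2_inner_diff_left)
  also have "\<dots> = form g (grad S \<eta>) t"
    unfolding form_def
  proof (rule L2_inner_AE_left[OF b_mult(1)[OF g(1)] _ g\<eta>])
    show "AE x in M. b (x, t) *\<^sub>R g x = b (x, t) *\<^sub>R grad S u x - b (x, t) *\<^sub>R grad S u' x"
      using g(2) by eventually_elim (simp flip: scaleR_diff_right)
  qed
  finally show ?thesis using 1 2 eq unfolding distrib_right by linarith
qed

lemma form_AE_right:
  assumes "\<xi> \<in> L2 S" "\<zeta> \<in> L2 S" "AE x in M. \<zeta> x = \<zeta>' x"
  shows "form \<xi> \<zeta>' t = form \<xi> \<zeta> t"
  unfolding form_def
  using L2_inner_AE_left[OF assms(2,3) b_mult(1)[OF assms(1), of t]] by (simp add: L2_inner_commute)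

end

theorem theorem2p2:
  fixes T :: real and \<Theta> :: "(real ^ 'd) set"
    and \<mu> :: "real \<Rightarrow> real" and \<rho> \<beta> Q :: "real \<Rightarrow> real ^ 'd \<Rightarrow> real"
    and f :: "real \<Rightarrow> real" and \<Phi>\<^sub>0 \<Psi>\<^sub>0 :: "real ^ 'd \<Rightarrow> real"
    and \<Phi> \<Phi>' :: "real \<Rightarrow> real ^ 'd \<Rightarrow> real"
    and L\<^sub>f \<beta>\<^sub>0 :: real
  assumes T: "T > 0" and domain: "lipschitz_domain \<Theta>"
    and AS1: "\<mu> \<in> Linf {0..T}" "AE t in lebesgue_on {0..T}. 0 \<le> \<mu> t"
      "esssup (lebesgue_on {0..T}) (\<lambda>t. ereal (\<mu> t)) < 1"
    and AS2: "(\<lambda>(x, t). \<rho> t x) \<in> Linf (\<Theta> \<times> {0<..<T})" "(\<lambda>(x, t). \<beta> t x) \<in> Linf (\<Theta> \<times> {0<..<T})"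
    and AS3: "Q \<in> continuous_into {0..T} (L2 \<Theta>) (L2_norm \<Theta>)"
    and AS4: "L\<^sub>f > 0" "\<And>z\<^sub>1 z\<^sub>2. \<bar>f z\<^sub>1 - f z\<^sub>2\<bar> \<le> L\<^sub>f * \<bar>z\<^sub>1 - z\<^sub>2\<bar>"
    and AS5: "\<beta>\<^sub>0 > 0" "AE (x, t) in lebesgue_on (\<Theta> \<times> {0<..<T}). \<beta> t x \<ge> \<beta>\<^sub>0"
    and AS6: "\<exists>\<beta>\<^sub>t\<in>Linf (\<Theta> \<times> {0<..<T}).
      weak_partial (\<Theta> \<times> {0<..<T}) (0, 1) (\<lambda>(x, t). \<beta> t x) \<beta>\<^sub>t"
    and AS7: "AE (x, t) in lebesgue_on (\<Theta> \<times> {0<..<T}). \<rho> t x \<ge> 0"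
    and AS8: "\<Phi>\<^sub>0 \<in> H10 \<Theta>" "\<Psi>\<^sub>0 \<in> L2 \<Theta>"
    and solutions: "weak_solution T \<Theta> \<mu> \<rho> \<beta> Q f \<Phi>\<^sub>0 \<Psi>\<^sub>0 \<Phi>" "weak_solution T \<Theta> \<mu> \<rho> \<beta> Q f \<Phi>\<^sub>0 \<Psi>\<^sub>0 \<Phi>'"
  shows "\<forall>t\<in>{0..T}. AE x in lebesgue_on \<Theta>. \<Phi> t x = \<Phi>' t x"
proof -
  have \<Theta>: "open \<Theta>" "bounded \<Theta>" using domain by (auto simp: lipschitz_domain_def)
  interpret bounded_open \<Theta> using \<Theta> by unfold_locales
  let ?P = "\<Theta> \<times> {0<..<T}" and ?I = "lebesgue_on {0<..<T}"
  have P: "?P \<in> sets lebesgue" using \<Theta> by (simp add: open_Times)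
  have sections: "AE t in ?I. AE x in M. X (x, t)" if "AE p in lebesgue_on ?P. X p" for X
    using AE_lebesgue_on_Times[OF _ _ P that] by simp

  \<comment> \<open>Borel representatives of the coefficient \<beta> and of its time
    derivative\<close>
  obtain C\<^sub>\<beta> where C\<^sub>\<beta>: "(\<lambda>(x, t). \<beta> t x) \<in> borel_measurable (lebesgue_on ?P)"
    "AE p in lebesgue_on ?P. \<bar>(\<lambda>(x, t). \<beta> t x) p\<bar> \<le> C\<^sub>\<beta>"
    using AS2(2) by (auto simp: Linf_def)
  \<comment> \<open>The maximum ensures that the interval used for clamping is nonempty.\<close>
  define hi where "hi = max \<beta>\<^sub>0 C\<^sub>\<beta>"
  have "AE p in lebesgue_on ?P. \<beta>\<^sub>0 \<le> (\<lambda>(x, t). \<beta> t x) p \<and> (\<lambda>(x, t). \<beta> t x) p \<le> hi"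
    using C\<^sub>\<beta>(2) AS5(2) by eventually_elim (auto simp: hi_def)
  from borel_version[OF P C\<^sub>\<beta>(1) this]
  obtain b where b: "b \<in> borel_measurable borel" "\<And>p. \<beta>\<^sub>0 \<le> b p" "\<And>p. b p \<le> hi"
    and b\<beta>: "AE p in lebesgue_on ?P. (\<lambda>(x, t). \<beta> t x) p = b p"
    by (auto simp: hi_def)
  obtain \<beta>\<^sub>t C\<^sub>t where \<beta>\<^sub>t: "\<beta>\<^sub>t \<in> borel_measurable (lebesgue_on ?P)" "AE p in lebesgue_on ?P. \<bar>\<beta>\<^sub>t p\<bar> \<le> C\<^sub>t"
    "weak_partial ?P (0, 1) (\<lambda>(x, t). \<beta> t x) \<beta>\<^sub>t"
    using AS6 by (auto simp: Linf_def)
  define L where "L = max 0 C\<^sub>t"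
  have "AE p in lebesgue_on ?P. - L \<le> \<beta>\<^sub>t p \<and> \<beta>\<^sub>t p \<le> L"
    using \<beta>\<^sub>t(2) by eventually_elim (auto simp: L_def)
  from borel_version[OF P \<beta>\<^sub>t(1) this]
  obtain d where d: "d \<in> borel_measurable borel" "\<And>p. - L \<le> d p" "\<And>p. d p \<le> L"
    and d\<beta>: "AE p in lebesgue_on ?P. \<beta>\<^sub>t p = d p"
    by (auto simp: L_def)
  have onP: "g \<in> borel_measurable (lebesgue_on ?P)" if "g \<in> borel_measurable borel" for g :: "(real ^ 'd) \<times> real \<Rightarrow> real"
    using that by (intro measurable_restrict_space1 measurable_completion) simp
  have wp: "weak_partial ?P (0, 1) b d"
    by (rule weak_partial_AE[OF P _ C\<^sub>\<beta>(1) onP[OF b(1)] \<beta>\<^sub>t(1) onP[OF d(1)] b\<beta> d\<beta> \<beta>\<^sub>t(3)]) (simp add: Basis_prod_def)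
  interpret coefficient \<Theta> b \<beta>\<^sub>0 hi L T
  proof
    show "b \<in> borel_measurable borel" "\<beta>\<^sub>0 \<le> b p" "b p \<le> hi" for p by (rule b)+
    show "0 \<le> \<beta>\<^sub>0" "0 \<le> L" using AS5 by (auto simp: L_def)
    fix h :: real assume h: "0 < h"
    show "AE p in lebesgue_on (\<Theta> \<times> {0<..<T - h}). \<bar>b (p + (0, h)) - b p\<bar> \<le> L * h"
    proof (rule AE_Lipschitz_in_time[OF \<Theta> h b(1) _ d(1) _ wp])
      show "\<bar>b p\<bar> \<le> hi" for p using b(2)[of p] b(3)[of p] AS5(1) by simp
      show "\<bar>d p\<bar> \<le> L" for p using d(2)[of p] d(3)[of p] by (simp add: abs_le_iff)
    qed
  qed
  have \<beta>_section: "AE t in ?I. AE x in M. \<beta> t x = b (x, t)"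
    using sections[OF b\<beta>] by simp

  \<comment> \<open>Measurability and bounds of \<rho> on almost every time section\<close>
  obtain C\<^sub>\<rho>' where C\<^sub>\<rho>': "(\<lambda>(x, t). \<rho> t x) \<in> borel_measurable (lebesgue_on ?P)"
    "AE p in lebesgue_on ?P. \<bar>(\<lambda>(x, t). \<rho> t x) p\<bar> \<le> C\<^sub>\<rho>'"
    using AS2(1) by (auto simp: Linf_def)
  define C\<^sub>\<rho> where "C\<^sub>\<rho> = max 0 C\<^sub>\<rho>'"
  have "AE p in lebesgue_on ?P. - C\<^sub>\<rho> \<le> (\<lambda>(x, t). \<rho> t x) p \<and> (\<lambda>(x, t). \<rho> t x) p \<le> C\<^sub>\<rho>"
    using C\<^sub>\<rho>'(2) by eventually_elim (auto simp: C\<^sub>\<rho>_def)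
  from borel_version[OF P C\<^sub>\<rho>'(1) this]
  obtain r where r: "r \<in> borel_measurable borel" "\<And>p. - C\<^sub>\<rho> \<le> r p" "\<And>p. r p \<le> C\<^sub>\<rho>"
    and r\<rho>: "AE p in lebesgue_on ?P. (\<lambda>(x, t). \<rho> t x) p = r p"
    by (auto simp: C\<^sub>\<rho>_def)
  have \<rho>_section: "AE t in ?I. \<rho> t \<in> borel_measurable M \<and> (AE x in M. \<bar>\<rho> t x\<bar> \<le> C\<^sub>\<rho>)"
    using sections[OF r\<rho>]
  proof eventually_elim
    case (elim t)
    then have ae: "AE x in M. r (x, t) = \<rho> t x" by (auto elim: eventually_mono)
    note [measurable] = r(1)
    have "(\<lambda>x. r (x, t)) \<in> borel_measurable M"
      by (intro measurable_restrict_space1 measurable_completion) measurable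
    from borel_measurable_lebesgue_on_AE[OF S_lebesgue this ae]
    have "\<rho> t \<in> borel_measurable M" .
    moreover have "AE x in M. \<bar>\<rho> t x\<bar> \<le> C\<^sub>\<rho>"
      using ae
    proof eventually_elim
      case (elim x)
      then show ?case using r(2)[of "(x, t)"] r(3)[of "(x, t)"] by (simp add: abs_le_iff)
    qed
    ultimately show ?case ..
  qed

  \<comment> \<open>The range of the order \<mu> and the Caputo estimate\<close>
  obtain m where m: "m < 1" "esssup (lebesgue_on {0..T}) (\<lambda>t. ereal (\<mu> t)) < ereal m"
    using ereal_dense2[OF AS1(3)] by (auto simp: one_ereal_def)
  \<comment> \<open>A number between the essential supremum and \<open>1\<close> keeps the orders
    uniformly away from \<open>1\<close> at almost every time.\<close>
  have "AE t in lebesgue_on {0..T}. \<mu> t \<le> m"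
    using esssup_AE[of "\<lambda>t. ereal (\<mu> t)" "lebesgue_on {0..T}"]
  proof eventually_elim
    case (elim t)
    from le_less_trans[OF this m(2)] show ?case by simp
  qed
  with AS1(2) have "AE t in lebesgue_on {0..T}. 0 \<le> \<mu> t \<and> \<mu> t \<le> m"
    by eventually_elim simp
  then have \<mu>_range: "AE t in ?I. 0 \<le> \<mu> t \<and> \<mu> t \<le> m"
    by (rule AE_lebesgue_on_subset) auto
  obtain C\<^sub>D where C\<^sub>D: "0 \<le> C\<^sub>D"
    "\<And>\<mu> v v' t B. v \<in> continuous_into {0..T} (L2 \<Theta>) (L2_norm \<Theta>) \<Longrightarrow> v' \<in> continuous_into {0..T} (L2 \<Theta>) (L2_norm \<Theta>) \<Longrightarrow>
      0 < t \<Longrightarrow> t \<le> T \<Longrightarrow> 0 \<le> \<mu> t \<Longrightarrow> \<mu> t \<le> m \<Longrightarrow>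
      \<forall>r\<in>{0..t}. L2_norm \<Theta> (\<lambda>x. v r x - v' r x) \<le> B \<Longrightarrow>
      caputo \<Theta> \<mu> v t \<in> L2 \<Theta> \<and> caputo \<Theta> \<mu> v' t \<in> L2 \<Theta> \<and>
      L2_norm \<Theta> (\<lambda>x. caputo \<Theta> \<mu> v t x - caputo \<Theta> \<mu> v' t x) \<le> C\<^sub>D * B"
    by (rule caputo_difference[OF m(1) T]) (rule that)

  \<comment> \<open>Data of the two solutions\<close>
  obtain v1 w1 J1 A1 where v1: "v1 \<in> continuous_into {0..T} (L2 \<Theta>) (L2_norm \<Theta>)"
    and \<Phi>1: "\<Phi> \<in> continuous_into {0..T} (L2 \<Theta>) (L2_norm \<Theta>)" "AE t in ?I. \<Phi> t \<in> H10 \<Theta>"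
    and init1: "AE x in M. \<Phi> 0 x = \<Phi>\<^sub>0 x" "AE x in M. v1 0 x = \<Psi>\<^sub>0 x"
    and w1: "\<And>\<eta>. \<eta> \<in> H10 \<Theta> \<Longrightarrow> integrable ?I (\<lambda>t. w1 t \<eta>)"
      "\<And>\<eta> s t. \<eta> \<in> H10 \<Theta> \<Longrightarrow> 0 \<le> s \<Longrightarrow> s \<le> t \<Longrightarrow> t \<le> T \<Longrightarrow>
        L2_inner \<Theta> (\<lambda>x. v1 t x - v1 s x) \<eta> = integral {s..t} (\<lambda>r. w1 r \<eta>)"
    and eq1: "\<And>\<eta>. \<eta> \<in> H10 \<Theta> \<Longrightarrow> AE t in ?I.
        w1 t \<eta> + L2_inner \<Theta> (\<lambda>x. \<rho> t x * caputo \<Theta> \<mu> v1 t x) \<eta>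
          + L2_inner \<Theta> (\<lambda>x. \<beta> t x *\<^sub>R grad \<Theta> (\<Phi> t) x) (grad \<Theta> \<eta>)
        = L2_inner \<Theta> (\<lambda>x. f (\<Phi> t x)) \<eta> + L2_inner \<Theta> (Q t) \<eta>"
    and J1: "\<And>t. 0 \<le> t \<Longrightarrow> t \<le> T \<Longrightarrow> J1 t \<in> H10 \<Theta>"
      "\<And>t. 0 \<le> t \<Longrightarrow> t \<le> T \<Longrightarrow> AE x in M. J1 t x = \<Phi> t x - \<Phi> 0 x"
      "\<And>s t \<eta>. 0 \<le> s \<Longrightarrow> s \<le> t \<Longrightarrow> t \<le> T \<Longrightarrow> \<eta> \<in> L2 \<Theta> \<Longrightarrow>
        L2_inner \<Theta> (\<lambda>x. J1 t x - J1 s x) \<eta> = integral {s..t} (\<lambda>r. L2_inner \<Theta> (v1 r) \<eta>)"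
    and A1: "continuous_on {0..T} A1"
      "\<And>s t. 0 \<le> s \<Longrightarrow> s \<le> t \<Longrightarrow> t \<le> T \<Longrightarrow> L2_norm \<Theta> (\<lambda>x. grad \<Theta> (J1 t) x - grad \<Theta> (J1 s) x) \<le> A1 t - A1 s"
    by (rule weak_solution_data[OF solutions(1)]) (rule that)
  obtain v2 w2 J2 A2 where v2: "v2 \<in> continuous_into {0..T} (L2 \<Theta>) (L2_norm \<Theta>)"
    and \<Phi>2: "\<Phi>' \<in> continuous_into {0..T} (L2 \<Theta>) (L2_norm \<Theta>)" "AE t in ?I. \<Phi>' t \<in> H10 \<Theta>"
    and init2: "AE x in M. \<Phi>' 0 x = \<Phi>\<^sub>0 x" "AE x in M. v2 0 x = \<Psi>\<^sub>0 x"
    and w2: "\<And>\<eta>. \<eta> \<in> H10 \<Theta> \<Longrightarrow> integrable ?I (\<lambda>t. w2 t \<eta>)"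
      "\<And>\<eta> s t. \<eta> \<in> H10 \<Theta> \<Longrightarrow> 0 \<le> s \<Longrightarrow> s \<le> t \<Longrightarrow> t \<le> T \<Longrightarrow>
        L2_inner \<Theta> (\<lambda>x. v2 t x - v2 s x) \<eta> = integral {s..t} (\<lambda>r. w2 r \<eta>)"
    and eq2: "\<And>\<eta>. \<eta> \<in> H10 \<Theta> \<Longrightarrow> AE t in ?I.
        w2 t \<eta> + L2_inner \<Theta> (\<lambda>x. \<rho> t x * caputo \<Theta> \<mu> v2 t x) \<eta>
          + L2_inner \<Theta> (\<lambda>x. \<beta> t x *\<^sub>R grad \<Theta> (\<Phi>' t) x) (grad \<Theta> \<eta>)
        = L2_inner \<Theta> (\<lambda>x. f (\<Phi>' t x)) \<eta> + L2_inner \<Theta> (Q t) \<eta>"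
    and J2: "\<And>t. 0 \<le> t \<Longrightarrow> t \<le> T \<Longrightarrow> J2 t \<in> H10 \<Theta>"
      "\<And>t. 0 \<le> t \<Longrightarrow> t \<le> T \<Longrightarrow> AE x in M. J2 t x = \<Phi>' t x - \<Phi>' 0 x"
      "\<And>s t \<eta>. 0 \<le> s \<Longrightarrow> s \<le> t \<Longrightarrow> t \<le> T \<Longrightarrow> \<eta> \<in> L2 \<Theta> \<Longrightarrow>
        L2_inner \<Theta> (\<lambda>x. J2 t x - J2 s x) \<eta> = integral {s..t} (\<lambda>r. L2_inner \<Theta> (v2 r) \<eta>)"
    and A2: "continuous_on {0..T} A2"
      "\<And>s t. 0 \<le> s \<Longrightarrow> s \<le> t \<Longrightarrow> t \<le> T \<Longrightarrow> L2_norm \<Theta> (\<lambda>x. grad \<Theta> (J2 t) x - grad \<Theta> (J2 s) x) \<le> A2 t - A2 s"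
    by (rule weak_solution_data[OF solutions(2)]) (rule that)

  \<comment> \<open>The difference of the two solutions\<close>
  define Z where "Z = (\<lambda>t x. J1 t x - J2 t x)"
  define v where "v = (\<lambda>t x. v1 t x - v2 t x)"
  define G where "G = (\<lambda>t. grad \<Theta> (Z t))"
  define A where "A = (\<lambda>t. A1 t + A2 t)"
  note v1m = continuous_into_mem[OF v1] and v2m = continuous_into_mem[OF v2]
  \<comment> \<open>Built from the primitives, \<open>Z t\<close> lies in \<open>H10\<close> at
    every time and may serve as a test function. Equal initial data make it agree with
    \<open>\<Phi> t - \<Phi>' t\<close> almost everywhere in space.\<close>
  have ZH: "Z t \<in> H10 \<Theta>" if "0 \<le> t" "t \<le> T" for t
    unfolding Z_def using J1(1) J2(1) that by (intro H10_diff)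
  note ZL = H10_imp_L2[OF ZH] and ZH1 = H10_imp_H1[OF ZH]
  have GL: "G t \<in> L2 \<Theta>" if "0 \<le> t" "t \<le> T" for t
    unfolding G_def by (rule grad_weak_gradient(1)[OF ZH1[OF that]])
  have Zae: "AE x in M. Z t x = \<Phi> t x - \<Phi>' t x" if "0 \<le> t" "t \<le> T" for t
    using J1(2)[OF that] J2(2)[OF that] init1(1) init2(1) by eventually_elim (simp add: Z_def)
  have vL: "v t \<in> L2 \<Theta>" if "0 \<le> t" "t \<le> T" for t
    unfolding v_def using v1m v2m that by (intro L2_diff)
  have vc: "v \<in> continuous_into {0..T} (L2 \<Theta>) (L2_norm \<Theta>)"
    unfolding continuous_into_def
  proof (intro CollectI ballI conjI)
    fix t assume t: "t \<in> {0..T}"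
    then show "v t \<in> L2 \<Theta>" by (intro vL) auto
    show "((\<lambda>r. L2_norm \<Theta> (\<lambda>x. v r x - v t x)) \<longlongrightarrow> 0) (at t within {0..T})"
    proof (rule Lim_null_comparison)
      show "((\<lambda>r. L2_norm \<Theta> (\<lambda>x. v1 r x - v1 t x) + L2_norm \<Theta> (\<lambda>x. v2 r x - v2 t x)) \<longlongrightarrow> 0) (at t within {0..T})"
        using v1 v2 t by (intro tendsto_add_zero) (auto simp: continuous_into_def)
      show "\<forall>\<^sub>F r in at t within {0..T}. norm (L2_norm \<Theta> (\<lambda>x. v r x - v t x))
          \<le> L2_norm \<Theta> (\<lambda>x. v1 r x - v1 t x) + L2_norm \<Theta> (\<lambda>x. v2 r x - v2 t x)"
        unfolding eventually_at_filter
      proof (intro always_eventually allI impI)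
        fix r assume "r \<in> {0..T}"
        then have "L2_norm \<Theta> (\<lambda>x. (v1 r x - v1 t x) - (v2 r x - v2 t x))
          \<le> L2_norm \<Theta> (\<lambda>x. v1 r x - v1 t x) + L2_norm \<Theta> (\<lambda>x. v2 r x - v2 t x)"
          using t by (intro L2_norm_triangle_diff L2_diff v1m v2m) auto
        then show "norm (L2_norm \<Theta> (\<lambda>x. v r x - v t x))
          \<le> L2_norm \<Theta> (\<lambda>x. v1 r x - v1 t x) + L2_norm \<Theta> (\<lambda>x. v2 r x - v2 t x)"
          by (simp add: v_def algebra_simps)
      qed
    qed
  qed
  have prim: "L2_inner \<Theta> (\<lambda>x. Z t x - Z s x) \<eta> = integral {s..t} (\<lambda>r. L2_inner \<Theta> (v r) \<eta>)"
    if st: "0 \<le> s" "s \<le> t" "t \<le> T" and \<eta>: "\<eta> \<in> L2 \<Theta>" for s t \<eta>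
  proof -
    have i: "(\<lambda>r. L2_inner \<Theta> (u r) \<eta>) integrable_on {s..t}" if "u \<in> continuous_into {0..T} (L2 \<Theta>) (L2_norm \<Theta>)" for u
      by (rule integrable_continuous_interval[OF continuous_on_subset[OF continuous_into_inner[OF that \<eta>]]]) (use st in auto)
    have JL: "J1 t \<in> L2 \<Theta>" "J1 s \<in> L2 \<Theta>" "J2 t \<in> L2 \<Theta>" "J2 s \<in> L2 \<Theta>"
      using st by (auto intro!: H10_imp_L2 J1(1) J2(1))
    have "L2_inner \<Theta> (\<lambda>x. Z t x - Z s x) \<eta> = L2_inner \<Theta> (\<lambda>x. (J1 t x - J1 s x) - (J2 t x - J2 s x)) \<eta>"
      by (simp add: Z_def algebra_simps)
    also have "\<dots> = L2_inner \<Theta> (\<lambda>x. J1 t x - J1 s x) \<eta> - L2_inner \<Theta> (\<lambda>x. J2 t x - J2 s x) \<eta>"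
      by (intro L2_inner_diff_left L2_diff JL \<eta>)
    also have "\<dots> = integral {s..t} (\<lambda>r. L2_inner \<Theta> (v1 r) \<eta> - L2_inner \<Theta> (v2 r) \<eta>)"
      using J1(3)[OF st \<eta>] J2(3)[OF st \<eta>] Henstock_Kurzweil_Integration.integral_diff[OF i[OF v1] i[OF v2]] by simp
    also have "\<dots> = integral {s..t} (\<lambda>r. L2_inner \<Theta> (v r) \<eta>)"
      using st \<eta> by (intro integral_cong) (simp add: v_def L2_inner_diff_left v1m v2m)
    finally show ?thesis .
  qed
  have Gae: "AE x in M. G t x = grad \<Theta> (J1 t) x - grad \<Theta> (J2 t) x" if "0 \<le> t" "t \<le> T" for t
    unfolding G_def Z_def using J1(1) J2(1) that by (intro H1_diff(2) H10_imp_H1)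
  have GA: "L2_norm \<Theta> (\<lambda>x. G t x - G s x) \<le> A t - A s" if st: "0 \<le> s" "s \<le> t" "t \<le> T" for s t
  proof -
    have g: "grad \<Theta> (J1 q) \<in> L2 \<Theta>" "grad \<Theta> (J2 q) \<in> L2 \<Theta>" if "q \<in> {s, t}" for q
      using that st by (auto intro!: grad_weak_gradient(1) H10_imp_H1 J1(1) J2(1))
    let ?d1 = "\<lambda>x. grad \<Theta> (J1 t) x - grad \<Theta> (J1 s) x" and ?d2 = "\<lambda>x. grad \<Theta> (J2 t) x - grad \<Theta> (J2 s) x"
    have d: "?d1 \<in> L2 \<Theta>" "?d2 \<in> L2 \<Theta>" using g by (auto intro!: L2_diff)
    have t': "0 \<le> t" "s \<le> T" using st by auto
    have ae: "AE x in M. ?d1 x - ?d2 x = G t x - G s x"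
      using Gae[OF t'(1) st(3)] Gae[OF st(1) t'(2)] by eventually_elim simp
    have "L2_norm \<Theta> (\<lambda>x. G t x - G s x) = L2_norm \<Theta> (\<lambda>x. ?d1 x - ?d2 x)"
      by (rule L2_norm_AE[OF L2_diff[OF d] ae])
    also have "\<dots> \<le> L2_norm \<Theta> ?d1 + L2_norm \<Theta> ?d2" by (rule L2_norm_triangle_diff[OF d])
    also have "\<dots> \<le> A t - A s" using A1(2)[OF st] A2(2)[OF st] by (simp add: A_def)
    finally show ?thesis .
  qed
  have Ac: "continuous_on {0..T} A" unfolding A_def by (intro continuous_on_add A1(1) A2(1))
  have Z0: "AE x in M. Z 0 x = 0"
    using Zae[OF order_refl less_imp_le[OF T]] init1(1) init2(1) by eventually_elim simp
  have v0: "L2_norm \<Theta> (v 0) = 0"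
  proof (rule iffD2[OF L2_norm_eq_0_iff])
    show "AE x in M. v 0 x = 0" using init1(2) init2(2) by eventually_elim (simp add: v_def)
  qed (use vL[of 0] T in simp)
  have G0: "L2_norm \<Theta> (G 0) = 0"
  proof (rule iffD2[OF L2_norm_eq_0_iff])
    have "weak_gradient \<Theta> (\<lambda>_. 0 :: real) (\<lambda>_. 0)"
      by (simp add: weak_gradient_def weak_partial_def)
    then have "weak_gradient \<Theta> (Z 0) (\<lambda>_. 0)"
      by (rule weak_gradient_AE[rotated 2]) (use Z0 in \<open>auto elim: eventually_mono\<close>)
    then show "AE x in M. G 0 x = 0"
      unfolding G_def using T by (intro grad_AE ZL) auto
  qed (use GL[of 0] T in simp)
  \<comment> \<open>The first product bounds the Caputo term; the second bounds the source term,
    since a velocity bounded by \<open>B\<close> keeps \<open>Z\<close> below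
    \<open>T * B\<close>.\<close>
  define E where "E = C\<^sub>\<rho> * C\<^sub>D + L\<^sub>f * T"
  have C\<^sub>\<rho>0: "0 \<le> C\<^sub>\<rho>" by (simp add: C\<^sub>\<rho>_def)
  have E0: "0 \<le> E" using C\<^sub>\<rho>0 C\<^sub>D(1) AS4(1) T by (simp add: E_def)

  \<comment> \<open>The tested equation, integrated over a time window\<close>
  have Zbound: "L2_norm \<Theta> (Z r) \<le> r * B"
    if r: "0 \<le> r" "r \<le> T" and B: "\<And>q. 0 \<le> q \<Longrightarrow> q \<le> r \<Longrightarrow> L2_norm \<Theta> (v q) \<le> B" for r B
  proof (rule primitive_norm_bound[OF vc r ZL[OF r] _ B])
    have "AE x in M. Z r x - Z 0 x = Z r x" using Z0 by eventually_elim simp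
    from L2_inner_AE_left[OF L2_diff[OF ZL[OF r] ZL] this ZL[OF r]]
    show "L2_inner \<Theta> (Z r) (Z r) = integral {0..r} (\<lambda>t. L2_inner \<Theta> (v t) (Z r))"
      using prim[of 0 r "Z r"] r ZL T by simp
  qed

  have key: "L2_inner \<Theta> (\<lambda>x. v t x - v s x) (\<lambda>x. Z p x - Z q x) \<le>
        - integral {s..t} (form (G c) (\<lambda>x. G p x - G q x))
        + (t - s) * (hi * \<omega> * L2_norm \<Theta> (\<lambda>x. G p x - G q x) + E * B * L2_norm \<Theta> (\<lambda>x. Z p x - Z q x))"
    if st: "0 \<le> s" "s \<le> t" "t \<le> T" and cpq: "c \<in> {0..T}" "p \<in> {0..T}" "q \<in> {0..T}"
      and \<omega>: "\<And>r. s \<le> r \<Longrightarrow> r \<le> t \<Longrightarrow> L2_norm \<Theta> (\<lambda>x. G r x - G c x) \<le> \<omega>"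
      and B: "\<And>r. 0 \<le> r \<Longrightarrow> r \<le> t \<Longrightarrow> L2_norm \<Theta> (v r) \<le> B" for s t c p q \<omega> B
  proof -
    define \<eta> where "\<eta> = (\<lambda>x. Z p x - Z q x)"
    define \<zeta> where "\<zeta> = (\<lambda>x. G p x - G q x)"
    have \<eta>: "\<eta> \<in> H10 \<Theta>" unfolding \<eta>_def using cpq by (intro H10_diff ZH) auto
    have \<zeta>: "\<zeta> \<in> L2 \<Theta>" unfolding \<zeta>_def using cpq by (intro L2_diff GL) auto
    have Gc: "G c \<in> L2 \<Theta>" using cpq by (intro GL) auto
    have g\<eta>: "AE x in M. \<zeta> x = grad \<Theta> \<eta> x"
      using H1_diff(2)[OF ZH1 ZH1, of p q] cpq by (auto simp: \<zeta>_def \<eta>_def G_def elim: eventually_mono)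
    let ?e = "hi * \<omega> * L2_norm \<Theta> \<zeta> + E * B * L2_norm \<Theta> \<eta>"
    \<comment> \<open>The exceptional times depend on \<eta>, so \<eta> is fixed before the
      inequality is integrated.\<close>
    have pw: "AE r in lebesgue_on {s<..<t}. w1 r \<eta> - w2 r \<eta> \<le> ?e - form (G c) \<zeta> r"
    proof -
      have sub: "AE r in lebesgue_on {s<..<t}. X r" if "AE r in ?I. X r" for X
        by (rule AE_lebesgue_on_subset[OF that]) (use st in auto)
      have "AE r in lebesgue_on {s<..<t}. r \<in> {s<..<t}" by (rule AE_I2) simp
      then show ?thesis
        using sub[OF \<Phi>1(2)] sub[OF \<Phi>2(2)] sub[OF \<beta>_section] sub[OF \<rho>_section] sub[OF \<mu>_range]
          sub[OF eq1[OF \<eta>]] sub[OF eq2[OF \<eta>]]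
      proof eventually_elim
        case (elim r)
        have r: "0 \<le> r" "0 < r" "r \<le> T" "s \<le> r" "r \<le> t" using elim(1) st by auto
        note u = H10_imp_H1[OF elim(2)] H10_imp_H1[OF elim(3)]
        have Br: "L2_norm \<Theta> (v q) \<le> B" if "0 \<le> q" "q \<le> r" for q using B that r by simp
        then have Br': "\<forall>q\<in>{0..r}. L2_norm \<Theta> (\<lambda>x. v1 q x - v2 q x) \<le> B" by (simp add: v_def)
        have cap: "caputo \<Theta> \<mu> v1 r \<in> L2 \<Theta> \<and> caputo \<Theta> \<mu> v2 r \<in> L2 \<Theta> \<and>
            L2_norm \<Theta> (\<lambda>x. caputo \<Theta> \<mu> v1 r x - caputo \<Theta> \<mu> v2 r x) \<le> C\<^sub>D * B"
          by (rule C\<^sub>D(2)[OF v1 v2 r(2,3) _ _ Br']) (use elim(6) in simp_all)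
        \<comment> \<open>At almost every time the gradients of the two solutions exist, and their
          difference is a weak gradient of \<open>Z r\<close> as well; uniqueness identifies it with
          \<open>G r\<close>.\<close>
        have gG: "AE x in M. grad \<Theta> (\<Phi> r) x - grad \<Theta> (\<Phi>' r) x = G r x"
        proof -
          have "AE x in M. \<Phi> r x - \<Phi>' r x = Z r x"
            using Zae[OF r(1,3)] by eventually_elim simp
          from weak_gradient_AE[OF H1_imp_L2[OF H1_diff(1)[OF u]] this grad_weak_gradient(2)[OF H1_diff(1)[OF u]]]
          have "weak_gradient \<Theta> (Z r) (grad \<Theta> (\<lambda>x. \<Phi> r x - \<Phi>' r x))" .
          from grad_AE[OF ZL[OF r(1,3)] grad_weak_gradient(1)[OF H1_diff(1)[OF u]] this] H1_diff(2)[OF u]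
          show ?thesis by eventually_elim (simp add: G_def)
        qed
        have \<Phi>Z: "L2_norm \<Theta> (\<lambda>x. \<Phi> r x - \<Phi>' r x) \<le> T * B"
        proof -
          have B0: "0 \<le> B" using order_trans[OF L2_norm_nonneg Br[of 0]] r by simp
          have "L2_norm \<Theta> (\<lambda>x. \<Phi> r x - \<Phi>' r x) = L2_norm \<Theta> (Z r)"
            by (rule L2_norm_AE[OF ZL[OF r(1,3)] Zae[OF r(1,3)]])
          also have "\<dots> \<le> r * B" by (rule Zbound[OF r(1,3) Br])
          also have "\<dots> \<le> T * B" using r B0 by (intro mult_right_mono) auto
          finally show ?thesis .
        qed
        have "w1 r \<eta> - w2 r \<eta> \<le> - form (G r) (grad \<Theta> \<eta>) r
            + (C\<^sub>\<rho> * L2_norm \<Theta> (\<lambda>x. caputo \<Theta> \<mu> v1 r x - caputo \<Theta> \<mu> v2 r x) + L\<^sub>f * L2_norm \<Theta> (\<lambda>x. \<Phi> r x - \<Phi>' r x)) * L2_norm \<Theta> \<eta>"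
          by (rule equation_difference[where f = f and r = "\<rho> r" and \<beta> = "\<beta> r" and q = "L2_inner \<Theta> (Q r) \<eta>", OF u H10_imp_H1[OF \<eta>] GL[OF r(1,3)] gG AS4(2) _ _ _ C\<^sub>\<rho>0])
            (use elim cap AS4(1) in auto)
        also have "\<dots> \<le> - form (G r) (grad \<Theta> \<eta>) r + (C\<^sub>\<rho> * (C\<^sub>D * B) + L\<^sub>f * (T * B)) * L2_norm \<Theta> \<eta>"
          using cap \<Phi>Z C\<^sub>\<rho>0 AS4(1) by (intro add_left_mono mult_right_mono add_mono mult_left_mono) auto
        also have "\<dots> = - form (G r) \<zeta> r + E * B * L2_norm \<Theta> \<eta>"
          using form_AE_right[OF GL[OF r(1,3)] \<zeta> g\<eta>] by (simp add: E_def algebra_simps)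
        \<comment> \<open>Freezing the gradient at time \<open>c\<close> costs the form at the
          increment \<open>G r - G c\<close>, which is bounded through \<omega>.\<close>
        also have "- form (G r) \<zeta> r \<le> - form (G c) \<zeta> r + hi * \<omega> * L2_norm \<Theta> \<zeta>"
        proof -
          have dG: "(\<lambda>x. G r x - G c x) \<in> L2 \<Theta>" by (intro L2_diff Gc GL r)
          have "form \<zeta> (\<lambda>x. G r x - G c x) r = form \<zeta> (G r) r - form \<zeta> (G c) r"
            by (rule form_diff_right[OF \<zeta> GL[OF r(1,3)] Gc])
          moreover have "\<bar>form \<zeta> (\<lambda>x. G r x - G c x) r\<bar> \<le> hi * L2_norm \<Theta> \<zeta> * \<omega>"
            using form_bound[OF \<zeta> dG, of r] mult_left_mono[OF \<omega>[OF r(4,5)], of "hi * L2_norm \<Theta> \<zeta>"] hi by simp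
          ultimately show ?thesis
            using form_commute[of \<zeta> "G r" r] form_commute[of \<zeta> "G c" r] by (simp add: abs_le_iff mult_ac)
        qed
        finally show ?case by simp
      qed
    qed
    have ai: "(\<lambda>r. w1 r \<eta>) absolutely_integrable_on {s..t}" "(\<lambda>r. w2 r \<eta>) absolutely_integrable_on {s..t}"
      using integral_lebesgue_on_subinterval(2)[OF w1(1)[OF \<eta>]] integral_lebesgue_on_subinterval(2)[OF w2(1)[OF \<eta>]] st by auto
    have "L2_inner \<Theta> (\<lambda>x. v t x - v s x) \<eta> = L2_inner \<Theta> (\<lambda>x. (v1 t x - v1 s x) - (v2 t x - v2 s x)) \<eta>"
      by (simp add: v_def algebra_simps)
    also have "\<dots> = L2_inner \<Theta> (\<lambda>x. v1 t x - v1 s x) \<eta> - L2_inner \<Theta> (\<lambda>x. v2 t x - v2 s x) \<eta>"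
      using st by (intro L2_inner_diff_left L2_diff v1m v2m H10_imp_L2[OF \<eta>]) auto
    also have "\<dots> = integral {s..t} (\<lambda>r. w1 r \<eta> - w2 r \<eta>)"
      using w1(2)[OF \<eta> st] w2(2)[OF \<eta> st] ai set_lebesgue_integral_eq_integral(1)
      by (subst Henstock_Kurzweil_Integration.integral_diff) auto
    also have "\<dots> \<le> integral {s..t} (\<lambda>r. ?e - form (G c) \<zeta> r)"
      by (intro integral_le_AE set_integral_diff ai form_integrable Gc \<zeta> pw) auto
    also have "\<dots> = (t - s) * ?e - integral {s..t} (form (G c) \<zeta>)"
      using st by (subst Henstock_Kurzweil_Integration.integral_diff) (auto intro: form_integrable Gc \<zeta>)
    finally show ?thesis by (simp add: \<eta>_def \<zeta>_def)
  qed

  \<comment> \<open>Absorption by an exponential weight\<close>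
  define e where "e = (\<lambda>t. (L2_norm \<Theta> (v t))\<^sup>2 + (L2_norm \<Theta> (G t))\<^sup>2)"
  define mn where "mn = min 1 \<beta>\<^sub>0"
  have mn: "0 < mn" using AS5(1) by (simp add: mn_def)
  \<comment> \<open>Chosen so that \<open>(2 * E + L) / lam\<close> is at most
    \<open>mn / 2\<close>; the added \<open>1\<close> makes it positive.\<close>
  define lam where "lam = 2 * (2 * E + L) / mn + 1"
  have lam: "0 < lam" using E0 L mn by (simp add: lam_def add_nonneg_pos)
  have Gcont: "continuous_on {0..T} (\<lambda>t. L2_norm \<Theta> (G t))"
    unfolding continuous_on_iff
  proof (intro ballI allI impI)
    fix t \<epsilon> :: real assume t: "t \<in> {0..T}" and \<epsilon>: "\<epsilon> > 0"
    then obtain \<delta> where \<delta>: "\<delta> > 0" "\<And>r. r \<in> {0..T} \<Longrightarrow> dist r t < \<delta> \<Longrightarrow> dist (A r) (A t) < \<epsilon>"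
      using Ac unfolding continuous_on_iff by blast
    have "dist (L2_norm \<Theta> (G r)) (L2_norm \<Theta> (G t)) < \<epsilon>" if r: "r \<in> {0..T}" "dist r t < \<delta>" for r
    proof -
      have "\<bar>L2_norm \<Theta> (G r) - L2_norm \<Theta> (G t)\<bar> \<le> L2_norm \<Theta> (\<lambda>x. G r x - G t x)"
        using r t by (intro L2_norm_diff_ineq GL) auto
      also have "\<dots> \<le> \<bar>A r - A t\<bar>"
        using GA[of t r] GA[of r t] L2_norm_minus_commute[of "G r" "G t"] r t by (cases "t \<le> r") auto
      finally show ?thesis using \<delta>(2)[OF r] by (simp add: dist_real_def)
    qed
    then show "\<exists>\<delta>>0. \<forall>r\<in>{0..T}. dist r t < \<delta> \<longrightarrow> dist (L2_norm \<Theta> (G r)) (L2_norm \<Theta> (G t)) < \<epsilon>"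
      using \<delta>(1) by blast
  qed
  have econt: "continuous_on {0..T} e"
    unfolding e_def by (intro continuous_intros continuous_into_norm[OF vc] Gcont)
  \<comment> \<open>The energy inequality has the assumed bound on its right side, multiplied by at
    most \<open>mn / 2\<close>, while its left side is at least \<open>mn * e\<close>.\<close>
  have halve: "e t \<le> K / 2 * exp (lam * t)"
    if K: "0 \<le> K" "\<And>t. t \<in> {0..T} \<Longrightarrow> e t \<le> K * exp (lam * t)" and t: "t \<in> {0..T}" for K t
  proof -
    define k where "k = sqrt K"
    have ksq: "0 \<le> k" "k\<^sup>2 = K" using K(1) by (auto simp: k_def)
    have m2: "(k * exp (lam * t / 2))\<^sup>2 = K * exp (lam * t)" for t
      using ksq by (simp add: power_mult_distrib flip: exp_of_nat_mult)
    have vb: "L2_norm \<Theta> (v t) \<le> k * exp (lam * t / 2)" and Gb: "L2_norm \<Theta> (G t) \<le> k * exp (lam * t / 2)" if "0 \<le> t" "t \<le> T" for t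
    proof -
      have "(L2_norm \<Theta> (v t))\<^sup>2 \<le> (k * exp (lam * t / 2))\<^sup>2" "(L2_norm \<Theta> (G t))\<^sup>2 \<le> (k * exp (lam * t / 2))\<^sup>2"
        using K(2)[of t] that unfolding m2 e_def
        by (auto intro: order_trans[rotated])
      then show "L2_norm \<Theta> (v t) \<le> k * exp (lam * t / 2)" "L2_norm \<Theta> (G t) \<le> k * exp (lam * t / 2)"
        using ksq by (auto intro: power2_le_imp_le)
    qed
    interpret energy \<Theta> b \<beta>\<^sub>0 hi L T Z v G A E k lam
    proof
      fix s t c p q \<omega> :: real
      assume st: "0 \<le> s" "s \<le> t" "t \<le> T" and cpq: "c \<in> {0..T}" "p \<in> {0..T}" "q \<in> {0..T}"
        and \<omega>: "\<And>r. s \<le> r \<Longrightarrow> r \<le> t \<Longrightarrow> L2_norm \<Theta> (\<lambda>x. G r x - G c x) \<le> \<omega>"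
      have "L2_norm \<Theta> (v r) \<le> k * exp (lam * t / 2)" if "0 \<le> r" "r \<le> t" for r
      proof -
        have "L2_norm \<Theta> (v r) \<le> k * exp (lam * r / 2)" using that st by (intro vb) auto
        also have "\<dots> \<le> k * exp (lam * t / 2)" using that ksq lam by (intro mult_left_mono) auto
        finally show ?thesis .
      qed
      from key[OF st cpq \<omega> this]
      show "L2_inner \<Theta> (\<lambda>x. v t x - v s x) (\<lambda>x. Z p x - Z q x) \<le>
        - integral {s..t} (form (G c) (\<lambda>x. G p x - G q x))
        + (t - s) * (hi * \<omega> * L2_norm \<Theta> (\<lambda>x. G p x - G q x) + E * (k * exp (lam * t / 2)) * L2_norm \<Theta> (\<lambda>x. Z p x - Z q x))" .
    qed (use ZL GL vc prim Ac GA v0 G0 vb Gb E0 ksq lam in auto)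
    have open_case: "e \<tau> - K / 2 * exp (lam * \<tau>) \<le> 0" if \<tau>: "\<tau> \<in> {0<..<T}" for \<tau>
    proof -
      have "mn * e \<tau> = mn * (L2_norm \<Theta> (v \<tau>))\<^sup>2 + mn * (L2_norm \<Theta> (G \<tau>))\<^sup>2"
        by (simp add: e_def distrib_left)
      also have "\<dots> \<le> 1 * (L2_norm \<Theta> (v \<tau>))\<^sup>2 + \<beta>\<^sub>0 * (L2_norm \<Theta> (G \<tau>))\<^sup>2"
        by (intro add_mono mult_right_mono) (auto simp: mn_def)
      also have "\<dots> \<le> (2 * E + L) * k\<^sup>2 / lam * exp (lam * \<tau>)"
        using energy_inequality[of \<tau>] \<tau> by simp
      also have "\<dots> = (2 * E + L) / lam * (K * exp (lam * \<tau>))" by (simp add: ksq)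
      also have "\<dots> \<le> mn / 2 * (K * exp (lam * \<tau>))"
      proof (rule mult_right_mono)
        have "(2 * E + L) \<le> mn / 2 * lam" using mn by (simp add: lam_def field_simps)
        then show "(2 * E + L) / lam \<le> mn / 2" using lam by (simp add: pos_divide_le_eq)
      qed (use K in simp)
      finally have "mn * e \<tau> \<le> mn * (K / 2 * exp (lam * \<tau>))" by simp
      then show ?thesis using mn by (simp add: mult_le_cancel_left_pos)
    qed
    \<comment> \<open>The energy inequality is available strictly inside the time interval;
      continuity of the energy extends the improved bound to both ends.\<close>
    have "continuous_on (closure {0<..<T}) (\<lambda>\<tau>. e \<tau> - K / 2 * exp (lam * \<tau>))"
      using T by (auto intro!: continuous_intros econt)
    from continuous_le_on_closure[OF this _ open_case, of t] show ?thesis using t T by simp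
  qed
  have "bounded (e ` {0..T})"
    by (intro compact_imp_bounded compact_continuous_image econt) auto
  then obtain K where K: "0 < K" "\<And>t. t \<in> {0..T} \<Longrightarrow> \<bar>e t\<bar> \<le> K"
    by (auto simp: bounded_pos)
  have decay: "e t \<le> K / 2 ^ n * exp (lam * t)" if "t \<in> {0..T}" for t n
    using that
  proof (induction n arbitrary: t)
    case 0
    have "e t \<le> K * 1" using K(2)[OF 0] by simp
    also have "\<dots> \<le> K * exp (lam * t)" using 0 lam K(1) by (intro mult_left_mono) auto
    finally show ?case by simp
  next
    case (Suc n)
    show ?case using halve[OF _ Suc.IH Suc.prems] K(1) by simp
  qed
  have v_zero: "L2_norm \<Theta> (v t) = 0" if t: "t \<in> {0..T}" for t
  proof -
    have "(\<lambda>n. K * (1 / 2) ^ n * exp (lam * t)) \<longlonglongrightarrow> K * 0 * exp (lam * t)"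
      by (intro tendsto_intros LIMSEQ_power_zero) auto
    then have "e t \<le> K * 0 * exp (lam * t)"
      by (rule LIMSEQ_le_const) (use decay[OF t] in \<open>auto simp: power_divide\<close>)
    \<comment> \<open>After repeated halving the energy is nonpositive, so the velocity vanishes and
      \<open>Zbound\<close> with bound \<open>0\<close> removes \<open>Z\<close>.\<close>
    then have "(L2_norm \<Theta> (v t))\<^sup>2 \<le> 0"
      using zero_le_power2[of "L2_norm \<Theta> (G t)"] unfolding e_def by linarith
    then show ?thesis by simp
  qed
  show ?thesis
  proof
    fix t assume t: "t \<in> {0..T}"
    have "L2_norm \<Theta> (Z t) \<le> t * 0"
      by (rule Zbound) (use t v_zero in auto)
    then have "L2_norm \<Theta> (Z t) = 0" using L2_norm_nonneg[of "Z t"] by simp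
    then have "AE x in M. Z t x = 0" using L2_norm_eq_0_iff[OF ZL] t by simp
    moreover have "AE x in M. Z t x = \<Phi> t x - \<Phi>' t x" using t by (intro Zae) auto
    ultimately show "AE x in M. \<Phi> t x = \<Phi>' t x" by eventually_elim simp
  qed
qed

end
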